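(* Let $d\in\mathbb{N}$ and $T>0$. Let $\mathcal{L}$ be an unbounded closed operator with dense domain $D\subseteq L^2(\mathbb{R}^d)$, acting on the space variable $x$, which generates a $C_0$-semigroup $(T_t)_{t\ge 0}$ on $L^2(\mathbb{R}^d)$ satisfying $\|T_t\|_{L(L^2(\mathbb{R}^d))}\le M e^{wt}$ for all $t\ge 0$, where $M>0$ and $w\in\mathbb{R}$. Let $Q\in L^\infty(\mathbb{R}^d)\otimes (S)_{-1}$ be a generalized stochastic process of Kondratiev-type with critical exponent $p_1$ and chaos expansion $Q(x,\omega)=\sum_{\gamma\in\mathcal{I}} q_\gamma(x)H_\gamma(\omega)$, where $q_\gamma\in L^\infty(\mathbb{R}^d)$ and $\|q_\gamma\|_{L^\infty}\le \|q_{\mathbf 0}\|_{L^\infty}$ for all $\gamma\in\mathcal{I}$. Put $$M(t):=M\exp\big((w+M\|q_{\mathbf 0}\|_{L^\infty})\,t\big),\qquad \tilde M(t):=\int_0^t M(s)\,ds ,\qquad t\in[0,T],$$ and assume that $\tilde M(T)\,\|q_{\mathbf 0}\|_{L^\infty}\neq 1$. Let $F\in AC([0,T];L^2(\mathbb{R}^d))\otimes (S)_{-1}$, $F=\sum_{\gamma\in\mathcal{I}} f_\gamma H_\gamma$, and $G\in D\otimes (S)_{-1}$, $G=\sum_{\gamma\in\mathcal{I}} g_\gamma H_\gamma$, be generalized stochastic processes of Kondratiev-type with critical exponents $p_2$ and $p_3$, respectively. Then there exists a unique generalized stochastic process $U\in AC([0,T];D)\otimes (S)_{-1}\subseteq AC([0,T];L^2(\mathbb{R}^d))\otimes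 (S)_{-1}$, $U=\sum_{\gamma\in\mathcal{I}} u_\gamma H_\gamma$, satisfying the stochastic initial value problem $$\Big(\frac{\partial}{\partial t}-\mathcal{L}\Big)U(t,x,\omega)+Q(x,\omega)\lozenge U(t,x,\omega)=F(t,x,\omega),\quad t\in(0,T],\ x\in\mathbb{R}^d,\ \omega\in\Omega,$$ $$U(0,x,\omega)=G(x,\omega),\quad x\in\mathbb{R}^d,\ \omega\in\Omega .$$ Moreover, for all $t\in[0,T]$ and all $\gamma\in\mathcal{I}$ the coefficients of $U$ satisfy $$\|u_\gamma(t,\cdot)\|_{L^2}\le M(t)\Bigg\{a_\gamma(t)+\sum_{k=1}^{|\gamma|}\tilde M(t)^k\Bigg(\sum_{\substack{\beta\in\mathcal{I},\ \beta<\gamma\\ 0\le|\beta|\le|\gamma|-k}} a_\beta(t)\Bigg(\sum_{\substack{\theta_1+\dots+\theta_k=\gamma-\beta\\ \theta_i\in\mathcal{I},\ \theta_i\ne\mathbf 0,\ i=1,\dots,k}}\ \prod_{i=1}^k\|q_{\theta_i}\|_{L^\infty}\Bigg)\Bigg)\Bigg\},$$ where $a_\gamma(t):=\|g_\gamma\|_{L^2}+t\,\|f_\gamma\|$ for $\gamma\in\mathcal{I}$, with $\|f_\gamma\|:=\sup_{s\in[0,T]}\|f_\gamma(s,\cdot)\|_{L^2}$.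
   Context: Multi-indices. $\mathcal{I}$ is the set of all sequences $\alpha=(\alpha_1,\alpha_2,\dots)$ of non-negative integers with only finitely many nonzero components; $\mathbf 0$ is the zero sequence; $|\alpha|=\sum_i\alpha_i$. One writes $\alpha\le\beta$ if $\alpha_k\le\beta_k$ for all $k$, and $\alpha<\beta$ if $\alpha\le\beta$ and $\alpha\ne\beta$. For $p\in\mathbb{R}$, $(2\mathbb{N})^{p\alpha}:=\prod_{i=1}^\infty(2i)^{p\alpha_i}$. Empty sums are $0$. The sums over $\theta_1+\dots+\theta_k=\gamma-\beta$ run over ordered $k$-tuples. Fourier-Hermite polynomials. $\Omega$ is the white noise probability space (tempered distributions with the Gaussian white noise measure). For $\gamma\in\mathcal{I}$, $H_\gamma(\omega):=\prod_{k=1}^\infty h_{\gamma_k}(\langle\omega,\xi_k\rangle)$, where $h_k$, $k\in\mathbb{N}_0$, are the Hermite polynomials and $\xi_k$, $k\in\mathbb{N}$, are the Hermite functions. Generalized stochastic processes of Kondratiev-type. For a normed space $X$ and $p\ge 0$, $X\otimes(S)_{-p}$ is the space of (formal) chaos expansions $F=\sum_{\gamma\in\mathcal{I}}f_\gamma H_\gamma$, $f_\gamma\in X$, with $\|F\|^2_{X\otimes(S)_{-p}}:=\sum_{\gamma\in\mathcal{I}}\|f_\gamma\|_X^2(2\mathbb{N})^{-p\gamma}<\infty$. The space $X\otimes(S)_{-1}$ of $X$-valued generalized stochastic processes of Kondratiev-type is the inductive limit (union) of these spaces over $p\ge0$ (here the subscript $-1$ denotes this union, not the case $p=1$). Two processes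 are equal iff all their coefficients coincide. If the sum is finite for some $p$, it is finite for all larger $p$; the minimal $p_0\ge 0$ for which it is finite is called the critical exponent of $F$. Function spaces. $AC([0,T];L^2(\mathbb{R}^d))$ is the space of absolutely continuous functions $[0,T]\to L^2(\mathbb{R}^d)$, i.e. those differentiable a.e. on $[0,T]$ with derivative in $L^1(0,T;L^2(\mathbb{R}^d))$ (and equal to the integral of their derivative); it is normed by $\|f\|=\sup_{t\in[0,T]}\|f(t,\cdot)\|_{L^2}$. $AC([0,T];D)$ is the subset of those functions which take values in $D$, with the same norm; $D$ is normed by the $L^2$-norm. Wick product and solutions. For $Q=\sum_\alpha q_\alpha H_\alpha$ and $U=\sum_\beta u_\beta H_\beta$, the Wick product is $Q\lozenge U:=\sum_{\gamma\in\mathcal{I}}\big(\sum_{\alpha+\beta=\gamma}q_\alpha u_\beta\big)H_\gamma$. The operators $\partial_t$ and $\mathcal{L}$ act on $U$ coefficientwise. Thus $U$ satisfies the initial value problem iff for every $\gamma\in\mathcal{I}$ the function $u_\gamma$ satisfies $\big(\tfrac{\partial}{\partial t}-\mathcal{L}\big)u_\gamma(t,\cdot)+\sum_{\alpha+\beta=\gamma}q_\alpha u_\beta(t,\cdot)=f_\gamma(t,\cdot)$ in $L^2(\mathbb{R}^d)$ for $t\in(0,T]$ and $u_\gamma(0,\cdot)=g_\gamma$.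
   Formalization: The coefficient estimate is stated only when w + M‖q_0‖ ≥ 0; for a negative exponent it is false as printed (e.g. Q=0, G=0, M=1, w=-1, L = multiplication by -(1+|x|²), F constant in t); existence and uniqueness are unrestricted. *)

theory Defs
  imports "HOL-Probability.Probability" "HOL-Library.Poly_Mapping"
begin

section \<open>The space of square integrable functions\<close>

text \<open>The scalars range over any type of class \<open>real_normed_field\<close> (with the
  topological classes needed for Bochner integration), in particular \<open>real\<close> and \<open>complex\<close>.
  Borel representatives suffice: every Lebesgue measurable function is almost
  everywhere equal to a Borel measurable one.\<close>

definition sq_integrable ::
  "('a::euclidean_space \<Rightarrow> 'k::{real_normed_field,banach,second_countable_topology}) \<Rightarrow> bool" where
  "sq_integrable f \<longleftrightarrow>
     f \<in> borel_measurable lborel \<and> integrable lborel (\<lambda>x. (norm (f x))\<^sup>2)"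

definition L2_rel ::
  "('a::euclidean_space \<Rightarrow> 'k::{real_normed_field,banach,second_countable_topology})
   \<Rightarrow> ('a \<Rightarrow> 'k) \<Rightarrow> bool" where
  "L2_rel f g \<longleftrightarrow> sq_integrable f \<and> sq_integrable g \<and> (AE x in lborel. f x = g x)"

lemma sq_integrable_0 [simp]: "sq_integrable (\<lambda>x. 0)"
  by (simp add: sq_integrable_def)

lemma sq_integrable_bound:
  fixes f :: "'a::euclidean_space \<Rightarrow> 'k::{real_normed_field,banach,second_countable_topology}"
  assumes f: "f \<in> borel_measurable lborel" and g: "integrable lborel g"
    and "AE x in lborel. (norm (f x))\<^sup>2 \<le> g x"
  shows "sq_integrable f"
proof -
  have [measurable]: "f \<in> borel_measurable lborel" by fact
  have "integrable lborel (\<lambda>x. (norm (f x))\<^sup>2)"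
    by (rule Bochner_Integration.integrable_bound[OF g])
       (use assms(3) in \<open>measurable, auto\<close>)
  then show ?thesis using f by (simp add: sq_integrable_def)
qed

lemma power2_add_le:
  fixes a b A B :: real
  assumes "0 < A" "0 < B"
  shows "(a + b)\<^sup>2 \<le> (1 + B / A) * a\<^sup>2 + (1 + A / B) * b\<^sup>2"
proof -
  have "0 \<le> (B * a - A * b)\<^sup>2 / (A * B)" using assms by simp
  also have "\<dots> = (1 + B / A) * a\<^sup>2 + (1 + A / B) * b\<^sup>2 - (a + b)\<^sup>2"
    using assms by (simp add: field_simps power2_eq_square)
  finally show ?thesis by simp
qed

lemma norm_add_power2_le:
  fixes x y :: "'k::real_normed_vector" and A B :: real
  assumes "0 < A" "0 < B"
  shows "(norm (x + y))\<^sup>2 \<le> (1 + B / A) * (norm x)\<^sup>2 + (1 + A / B) * (norm y)\<^sup>2"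
  using power2_add_le[OF assms, of "norm x" "norm y"] norm_triangle_ineq[of x y]
  by (meson norm_ge_zero order_trans power_mono)

lemma sq_integrable_add:
  assumes "sq_integrable f" "sq_integrable g"
  shows "sq_integrable (\<lambda>x. f x + g x)"
proof (rule sq_integrable_bound)
  show "(\<lambda>x. f x + g x) \<in> borel_measurable lborel"
    using assms by (auto simp: sq_integrable_def intro: borel_measurable_add)
  show "integrable lborel (\<lambda>x. (1 + 1 / 1) * (norm (f x))\<^sup>2 + (1 + 1 / 1) * (norm (g x))\<^sup>2)"
    using assms unfolding sq_integrable_def
    by (intro Bochner_Integration.integrable_add integrable_mult_right) auto
  show "AE x in lborel. (norm (f x + g x))\<^sup>2
      \<le> (1 + 1 / 1) * (norm (f x))\<^sup>2 + (1 + 1 / 1) * (norm (g x))\<^sup>2"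
    by (intro AE_I2 norm_add_power2_le) auto
qed

lemma sq_integrable_cmult:
  assumes "sq_integrable f"
  shows "sq_integrable (\<lambda>x. c * f x)"
  using assms unfolding sq_integrable_def
  by (auto simp: norm_mult power_mult_distrib)

lemma sq_integrable_scaleR:
  assumes "sq_integrable f"
  shows "sq_integrable (\<lambda>x. r *\<^sub>R f x)"
  using assms unfolding sq_integrable_def
  by (auto simp: power_mult_distrib)

lemma sq_integrable_uminus: "sq_integrable f \<Longrightarrow> sq_integrable (\<lambda>x. - f x)"
  unfolding sq_integrable_def by auto

lemma sq_integrable_diff:
  "sq_integrable f \<Longrightarrow> sq_integrable g \<Longrightarrow> sq_integrable (\<lambda>x. f x - g x)"
  using sq_integrable_add[of f "\<lambda>x. - g x"] sq_integrable_uminus[of g] by simp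

quotient_type (overloaded) ('a, 'k) L2 =
  "'a::euclidean_space \<Rightarrow> 'k::{real_normed_field,banach,second_countable_topology}"
  / partial: L2_rel
proof (rule part_equivpI)
  show "\<exists>f::'a \<Rightarrow> 'k. L2_rel f f"
    by (rule exI[of _ "\<lambda>x. 0"]) (simp add: L2_rel_def)
  show "symp (L2_rel :: ('a \<Rightarrow> 'k) \<Rightarrow> _)"
    unfolding symp_def L2_rel_def by (auto elim: eventually_mono)
  show "transp (L2_rel :: ('a \<Rightarrow> 'k) \<Rightarrow> _)"
    unfolding transp_def L2_rel_def by (auto elim: eventually_elim2)
qed

instantiation L2 :: (euclidean_space, "{real_normed_field,banach,second_countable_topology}")
  real_normed_vector
begin

lift_definition zero_L2 :: "('a, 'b) L2" is "\<lambda>x. 0"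
  by (simp add: L2_rel_def)

lift_definition plus_L2 :: "('a, 'b) L2 \<Rightarrow> ('a, 'b) L2 \<Rightarrow> ('a, 'b) L2"
  is "\<lambda>f g x. f x + g x"
  unfolding L2_rel_def by (auto intro: sq_integrable_add)

lift_definition minus_L2 :: "('a, 'b) L2 \<Rightarrow> ('a, 'b) L2 \<Rightarrow> ('a, 'b) L2"
  is "\<lambda>f g x. f x - g x"
  unfolding L2_rel_def by (auto intro: sq_integrable_diff)

lift_definition uminus_L2 :: "('a, 'b) L2 \<Rightarrow> ('a, 'b) L2"
  is "\<lambda>f x. - f x"
  unfolding L2_rel_def by (auto intro: sq_integrable_uminus)

lift_definition scaleR_L2 :: "real \<Rightarrow> ('a, 'b) L2 \<Rightarrow> ('a, 'b) L2"
  is "\<lambda>r f x. r *\<^sub>R f x"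
  unfolding L2_rel_def by (auto intro: sq_integrable_scaleR)

lift_definition norm_L2 :: "('a, 'b) L2 \<Rightarrow> real"
  is "\<lambda>f. sqrt (\<integral>x. (norm (f x))\<^sup>2 \<partial>lborel)"
  unfolding L2_rel_def sq_integrable_def
  by (intro arg_cong[where f = sqrt] integral_cong_AE) auto

definition dist_L2 :: "('a, 'b) L2 \<Rightarrow> ('a, 'b) L2 \<Rightarrow> real"
  where "dist_L2 f g = norm (f - g)"

definition sgn_L2 :: "('a, 'b) L2 \<Rightarrow> ('a, 'b) L2"
  where "sgn_L2 f = scaleR (inverse (norm f)) f"

definition uniformity_L2 :: "(('a, 'b) L2 \<times> ('a, 'b) L2) filter"
  where "uniformity_L2 = (INF e\<in>{0 <..}. principal {(x, y). dist x y < e})"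

definition open_L2 :: "('a, 'b) L2 set \<Rightarrow> bool"
  where "open_L2 S = (\<forall>x\<in>S. \<forall>\<^sub>F (x', y) in uniformity. x' = x \<longrightarrow> y \<in> S)"

instance
proof
  fix f g h :: "('a, 'b) L2" and r s :: real
  show "f + g + h = f + (g + h)"
    by transfer (auto simp: L2_rel_def ac_simps intro!: sq_integrable_add)
  show "f + g = g + f"
    by transfer (auto simp: L2_rel_def ac_simps intro!: sq_integrable_add)
  show "0 + f = f"
    by transfer (auto simp: L2_rel_def)
  show "- f + f = 0"
    by transfer (auto simp: L2_rel_def)
  show "f - g = f + - g"
    by transfer (auto simp: L2_rel_def intro!: sq_integrable_diff)
  show "r *\<^sub>R (f + g) = r *\<^sub>R f + r *\<^sub>R g"
    by transfer (auto simp: L2_rel_def scaleR_add_right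
        intro!: sq_integrable_scaleR sq_integrable_add)
  show "(r + s) *\<^sub>R f = r *\<^sub>R f + s *\<^sub>R f"
    by transfer (auto simp: L2_rel_def scaleR_add_left
        intro!: sq_integrable_scaleR sq_integrable_add)
  show "r *\<^sub>R s *\<^sub>R f = (r * s) *\<^sub>R f"
    by transfer (auto simp: L2_rel_def intro!: sq_integrable_scaleR)
  show "1 *\<^sub>R f = f"
    by transfer (auto simp: L2_rel_def)
  show "norm f = 0 \<longleftrightarrow> f = 0"
  proof transfer
    fix f :: "'a \<Rightarrow> 'b"
    assume f: "L2_rel f f"
    then have "sqrt (\<integral>x. (norm (f x))\<^sup>2 \<partial>lborel) = 0
        \<longleftrightarrow> (AE x in lborel. (norm (f x))\<^sup>2 = 0)"
      by (subst real_sqrt_eq_0_iff, intro integral_nonneg_eq_0_iff_AE)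
         (auto simp: L2_rel_def sq_integrable_def)
    then show "sqrt (\<integral>x. (norm (f x))\<^sup>2 \<partial>lborel) = 0 \<longleftrightarrow> L2_rel f (\<lambda>x. 0)"
      using f by (simp add: L2_rel_def)
  qed
  show "norm (f + g) \<le> norm f + norm g"
  proof transfer
    fix f g :: "'a \<Rightarrow> 'b"
    assume "L2_rel f f" "L2_rel g g"
    then have f: "sq_integrable f" and g: "sq_integrable g" by (auto simp: L2_rel_def)
    define A where "A = sqrt (\<integral>x. (norm (f x))\<^sup>2 \<partial>lborel)"
    define B where "B = sqrt (\<integral>x. (norm (g x))\<^sup>2 \<partial>lborel)"
    have A: "0 \<le> A" "A\<^sup>2 = (\<integral>x. (norm (f x))\<^sup>2 \<partial>lborel)"
      and B: "0 \<le> B" "B\<^sup>2 = (\<integral>x. (norm (g x))\<^sup>2 \<partial>lborel)"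
      by (simp_all add: A_def B_def)
    have le: "sqrt (\<integral>x. (norm (f x + g x))\<^sup>2 \<partial>lborel) \<le> A + B + e" if e: "0 < e" for e
    proof -
      define A' where "A' = A + e / 2"
      define B' where "B' = B + e / 2"
      have pos: "0 < A'" "0 < B'" using A(1) B(1) e by (auto simp: A'_def B'_def)
      have int: "integrable lborel (\<lambda>x. (norm (f x))\<^sup>2)" "integrable lborel (\<lambda>x. (norm (g x))\<^sup>2)"
        using f g by (auto simp: sq_integrable_def)
      have "(\<integral>x. (norm (f x + g x))\<^sup>2 \<partial>lborel)
          \<le> (\<integral>x. (1 + B' / A') * (norm (f x))\<^sup>2 + (1 + A' / B') * (norm (g x))\<^sup>2 \<partial>lborel)"
        using sq_integrable_add[OF f g] norm_add_power2_le[OF pos]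
        by (intro integral_mono Bochner_Integration.integrable_add integrable_mult_right int)
           (auto simp: sq_integrable_def)
      also have "\<dots> = (1 + B' / A') * A\<^sup>2 + (1 + A' / B') * B\<^sup>2"
        using int by (simp add: A B)
      also have "\<dots> \<le> (1 + B' / A') * A'\<^sup>2 + (1 + A' / B') * B'\<^sup>2"
        using pos A(1) B(1) e
        by (intro add_mono mult_left_mono power_mono) (auto simp: A'_def B'_def)
      also have "\<dots> = (A' + B')\<^sup>2"
        using pos by (simp add: field_simps power2_eq_square)
      finally have "sqrt (\<integral>x. (norm (f x + g x))\<^sup>2 \<partial>lborel) \<le> A' + B'"
        using pos by (simp add: real_le_lsqrt)
      then show ?thesis by (simp add: A'_def B'_def)
    qed
    show "sqrt (\<integral>x. (norm (f x + g x))\<^sup>2 \<partial>lborel)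
        \<le> sqrt (\<integral>x. (norm (f x))\<^sup>2 \<partial>lborel) + sqrt (\<integral>x. (norm (g x))\<^sup>2 \<partial>lborel)"
      unfolding A_def[symmetric] B_def[symmetric] by (rule field_le_epsilon, rule le)
  qed
  show "norm (r *\<^sub>R f) = \<bar>r\<bar> * norm f"
    by transfer (auto simp: power_mult_distrib real_sqrt_mult)
qed (rule dist_L2_def sgn_L2_def uniformity_L2_def open_L2_def)+

end

text \<open>Scalar multiplication by the full scalar field, not only by reals.\<close>

lift_definition scale_L2 ::
  "'k::{real_normed_field,banach,second_countable_topology} \<Rightarrow> ('a::euclidean_space, 'k) L2
   \<Rightarrow> ('a, 'k) L2"
  is "\<lambda>c f x. c * f x"
  unfolding L2_rel_def by (auto intro: sq_integrable_cmult)

lemma L2_cases: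
  obtains f where "sq_integrable f" "F = abs_L2 f"
proof -
  have "L2_rel (rep_L2 F) (rep_L2 F)" and "abs_L2 (rep_L2 F) = F"
    using Quotient_L2 unfolding Quotient_def by blast+
  then show ?thesis using that by (metis L2_rel_def)
qed

lemma L2_rel_refl: "sq_integrable f \<Longrightarrow> L2_rel f f"
  by (simp add: L2_rel_def)

lemma norm_abs_L2: "sq_integrable f \<Longrightarrow> (norm (abs_L2 f))\<^sup>2 = (\<integral>x. (norm (f x))\<^sup>2 \<partial>lborel)"
  by (simp add: norm_L2.abs_eq L2_rel_refl)

lemma norm_abs_L2_nn:
  assumes "sq_integrable f"
  shows "ennreal ((norm (abs_L2 f))\<^sup>2) = (\<integral>\<^sup>+x. ennreal ((norm (f x))\<^sup>2) \<partial>lborel)"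
  using assms
  by (subst nn_integral_eq_integral) (auto simp: norm_abs_L2 sq_integrable_def)

lemma abs_L2_diff:
  "sq_integrable f \<Longrightarrow> sq_integrable g \<Longrightarrow> abs_L2 f - abs_L2 g = abs_L2 (\<lambda>x. f x - g x)"
  by (simp add: minus_L2.abs_eq L2_rel_refl)

lemma abs_L2_add:
  "sq_integrable f \<Longrightarrow> sq_integrable g \<Longrightarrow> abs_L2 f + abs_L2 g = abs_L2 (\<lambda>x. f x + g x)"
  by (simp add: plus_L2.abs_eq L2_rel_refl)

lemma sq_integrable_nn:
  assumes "f \<in> borel_measurable lborel" "(\<integral>\<^sup>+x. ennreal ((norm (f x))\<^sup>2) \<partial>lborel) < \<infinity>"
  shows "sq_integrable f"
  using assms by (auto simp: sq_integrable_def intro!: integrableI_bounded)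

lemma L2_fast_Cauchy_convergent:
  fixes X :: "nat \<Rightarrow> ('a::euclidean_space, 'k::{real_normed_field,banach,second_countable_topology}) L2"
  assumes fast: "\<And>n. norm (X (Suc n) - X n) \<le> (1 / 2) ^ n" and "Cauchy X"
  shows "convergent X"
proof -
  have "\<exists>f. sq_integrable f \<and> X n = abs_L2 f" for n
    by (meson L2_cases)
  then obtain f where f: "\<And>n. sq_integrable (f n)" "\<And>n. X n = abs_L2 (f n)"
    by metis
  have [measurable]: "f n \<in> borel_measurable lborel" for n
    using f(1)[of n] by (simp add: sq_integrable_def)
  have nrm: "(\<integral>\<^sup>+x. ennreal ((norm (f m x - f n x))\<^sup>2) \<partial>lborel) = ennreal ((norm (X m - X n))\<^sup>2)"
    for m n
    using f sq_integrable_diff[OF f(1) f(1)] by (simp add: norm_abs_L2_nn abs_L2_diff)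
  have "(\<integral>\<^sup>+x. (suminf (\<lambda>n. ennreal (2 ^ n * (norm (f (Suc n) x - f n x))\<^sup>2))) \<partial>lborel)
      = suminf (\<lambda>n. \<integral>\<^sup>+x. ennreal (2 ^ n * (norm (f (Suc n) x - f n x))\<^sup>2) \<partial>lborel)"
    by (rule nn_integral_suminf) auto
  also have "\<dots> = suminf (\<lambda>n. ennreal (2 ^ n) * ennreal ((norm (X (Suc n) - X n))\<^sup>2))"
    by (intro suminf_cong, subst nrm[symmetric], subst nn_integral_cmult[symmetric])
       (auto simp: ennreal_mult)
  also have "\<dots> \<le> suminf (\<lambda>n. ennreal ((1 / 2) ^ n))"
  proof (rule suminf_le)
    fix n
    have "(norm (X (Suc n) - X n))\<^sup>2 \<le> ((1 / 2) ^ n)\<^sup>2"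
      using fast by (intro power_mono) auto
    then have "2 ^ n * (norm (X (Suc n) - X n))\<^sup>2 \<le> 2 ^ n * ((1 / 2) ^ n)\<^sup>2"
      by (intro mult_left_mono) auto
    also have "\<dots> = (1 / 2 :: real) ^ n"
      by (simp add: power2_eq_square field_simps)
    finally show "ennreal (2 ^ n) * ennreal ((norm (X (Suc n) - X n))\<^sup>2) \<le> ennreal ((1 / 2) ^ n)"
      by (subst ennreal_mult[symmetric]) (auto intro: ennreal_leI)
  qed auto
  also have "\<dots> < \<infinity>"
    by (subst suminf_ennreal2) (auto intro: summable_geometric)
  finally have "AE x in lborel. suminf (\<lambda>n. ennreal (2 ^ n * (norm (f (Suc n) x - f n x))\<^sup>2)) \<noteq> \<infinity>"
    by (intro nn_integral_PInf_AE) auto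
  then have conv: "AE x in lborel. convergent (\<lambda>n. f n x)"
  proof (eventually_elim)
    case (elim x)
    have "summable (\<lambda>n. 2 ^ n * (norm (f (Suc n) x - f n x))\<^sup>2)"
      using elim by (intro summable_suminf_not_top) auto
    then have "(\<lambda>n. 2 ^ n * (norm (f (Suc n) x - f n x))\<^sup>2) \<longlonglongrightarrow> 0"
      by (rule summable_LIMSEQ_zero)
    then have ev: "\<forall>\<^sub>F n in sequentially. 2 ^ n * (norm (f (Suc n) x - f n x))\<^sup>2 < 1"
      by (rule order_tendstoD) auto
    have "\<forall>\<^sub>F n in sequentially. norm (f (Suc n) x - f n x) \<le> (1 / sqrt 2) ^ n"
      using ev
    proof eventually_elim
      case (elim n)
      have "(norm (f (Suc n) x - f n x))\<^sup>2 \<le> ((1 / sqrt 2) ^ n)\<^sup>2"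
      proof -
        have "((1 / sqrt 2) ^ n)\<^sup>2 = ((1 / sqrt 2)\<^sup>2) ^ n"
          by (simp flip: power_mult add: mult.commute)
        also have "\<dots> = 1 / 2 ^ n"
          by (simp add: power_divide)
        finally show ?thesis using elim by (simp add: field_simps)
      qed
      then show ?case
        by (rule power2_le_imp_le) auto
    qed
    then have "summable (\<lambda>n. f (Suc n) x - f n x)"
      by (rule summable_comparison_test_ev) (auto intro!: summable_geometric)
    then have "(\<lambda>n. \<Sum>i<n. f (Suc i) x - f i x) \<longlonglongrightarrow> suminf (\<lambda>i. f (Suc i) x - f i x)"
      by (rule summable_LIMSEQ)
    then have "(\<lambda>n. f n x - f 0 x) \<longlonglongrightarrow> suminf (\<lambda>i. f (Suc i) x - f i x)"
      by (subst (asm) sum_lessThan_telescope[of "\<lambda>n. f n x"])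
    then have "(\<lambda>n. (f n x - f 0 x) + f 0 x) \<longlonglongrightarrow> suminf (\<lambda>i. f (Suc i) x - f i x) + f 0 x"
      by (rule tendsto_add[OF _ tendsto_const])
    then show ?case by (auto simp: convergent_def)
  qed
  define h where "h x = lim (\<lambda>n. f n x)" for x
  have [measurable]: "h \<in> borel_measurable lborel"
    unfolding h_def by measurable
  have h: "AE x in lborel. (\<lambda>n. f n x) \<longlonglongrightarrow> h x"
    using conv by eventually_elim (simp add: h_def convergent_LIMSEQ_iff)
  have est: "(\<integral>\<^sup>+x. ennreal ((norm (h x - f n x))\<^sup>2) \<partial>lborel) \<le> ennreal (e\<^sup>2)"
    if e: "0 \<le> e" "\<And>m. m \<ge> n \<Longrightarrow> norm (X m - X n) \<le> e" for n e
  proof -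
    have "(\<integral>\<^sup>+x. ennreal ((norm (h x - f n x))\<^sup>2) \<partial>lborel)
        = (\<integral>\<^sup>+x. liminf (\<lambda>m. ennreal ((norm (f m x - f n x))\<^sup>2)) \<partial>lborel)"
    proof (rule nn_integral_cong_AE, use h in eventually_elim)
      case (elim x)
      then have "(\<lambda>m. ennreal ((norm (f m x - f n x))\<^sup>2)) \<longlonglongrightarrow> ennreal ((norm (h x - f n x))\<^sup>2)"
        by (intro tendsto_ennrealI tendsto_intros)
      from lim_imp_Liminf[OF sequentially_bot this] show ?case by (rule sym)
    qed
    also have "\<dots> \<le> liminf (\<lambda>m. \<integral>\<^sup>+x. ennreal ((norm (f m x - f n x))\<^sup>2) \<partial>lborel)"
      by (rule nn_integral_liminf) auto
    also have "\<dots> = liminf (\<lambda>m. ennreal ((norm (X m - X n))\<^sup>2))"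
      by (simp add: nrm)
    also have "\<dots> \<le> liminf (\<lambda>m::nat. ennreal (e\<^sup>2))"
      using e by (intro Liminf_mono eventually_sequentiallyI[of n] ennreal_leI power_mono) auto
    also have "\<dots> = ennreal (e\<^sup>2)"
      by (simp add: Liminf_const)
    finally show ?thesis .
  qed
  obtain n0 where n0: "\<And>m. m \<ge> n0 \<Longrightarrow> norm (X m - X n0) < 1"
    using \<open>Cauchy X\<close>[THEN CauchyD, of 1] by auto
  have "sq_integrable (\<lambda>x. h x - f n0 x)"
    using est[of 1 n0] n0 by (intro sq_integrable_nn) (auto simp: less_imp_le intro: le_less_trans)
  from sq_integrable_add[OF this f(1)[of n0]] have sqh: "sq_integrable h"
    by simp
  have "X \<longlonglongrightarrow> abs_L2 h"
  proof (rule LIMSEQ_I)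
    fix r :: real
    assume r: "0 < r"
    then obtain N where N: "\<And>m n. m \<ge> N \<Longrightarrow> n \<ge> N \<Longrightarrow> norm (X m - X n) < r / 2"
      using \<open>Cauchy X\<close>[THEN CauchyD, of "r / 2"] by auto
    have "norm (X n - abs_L2 h) < r" if "n \<ge> N" for n
    proof -
      have "(\<integral>\<^sup>+x. ennreal ((norm (h x - f n x))\<^sup>2) \<partial>lborel) \<le> ennreal ((r / 2)\<^sup>2)"
        using r N that by (intro est) (auto intro: less_imp_le)
      then have "ennreal ((norm (abs_L2 h - X n))\<^sup>2) \<le> ennreal ((r / 2)\<^sup>2)"
        using sqh f sq_integrable_diff[OF sqh f(1)] by (simp add: norm_abs_L2_nn abs_L2_diff)
      then have "(norm (abs_L2 h - X n))\<^sup>2 \<le> (r / 2)\<^sup>2"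
        by (subst (asm) ennreal_le_iff) auto
      then have "norm (abs_L2 h - X n) \<le> r / 2"
        by (rule power2_le_imp_le) (use r in auto)
      then show ?thesis
        using r by (simp add: norm_minus_commute)
    qed
    then show "\<exists>no. \<forall>n\<ge>no. norm (X n - abs_L2 h) < r" by blast
  qed
  then show ?thesis by (auto simp: convergent_def)
qed

instance L2 :: (euclidean_space, "{real_normed_field,banach,second_countable_topology}") banach
proof
  fix X :: "nat \<Rightarrow> ('a, 'b) L2"
  assume X: "Cauchy X"
  have "\<exists>N. \<forall>m\<ge>N. \<forall>n\<ge>N. norm (X m - X n) < (1 / 2) ^ k" for k :: nat
    using CauchyD[OF X, of "(1 / 2) ^ k"] by auto
  then obtain N where N: "\<And>k m n. m \<ge> N k \<Longrightarrow> n \<ge> N k \<Longrightarrow> norm (X m - X n) < (1 / 2) ^ k"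
    by metis
  define s where "s k = (\<Sum>i\<le>k. Suc (N i))" for k
  have sm: "strict_mono s"
    unfolding strict_mono_Suc_iff by (simp add: s_def)
  have sN: "N k \<le> s k" for k
    unfolding s_def by (cases k) auto
  have "convergent (X \<circ> s)"
  proof (rule L2_fast_Cauchy_convergent)
    show "norm ((X \<circ> s) (Suc n) - (X \<circ> s) n) \<le> (1 / 2) ^ n" for n
      using N[of n "s (Suc n)" "s n"] sN[of n] strict_monoD[OF sm, of n "Suc n"] by simp
    show "Cauchy (X \<circ> s)"
      using X sm by (rule Cauchy_subseq_Cauchy)
  qed
  then obtain l where "(X \<circ> s) \<longlonglongrightarrow> l"
    by (auto simp: convergent_def)
  then have "X \<longlonglongrightarrow> l"
    using Cauchy_converges_subseq X sm by blast
  then show "convergent X" by (auto simp: convergent_def)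
qed

definition L2_ind :: "'a set \<Rightarrow> 'k \<Rightarrow>
    ('a::euclidean_space, 'k::{real_normed_field,banach,second_countable_topology}) L2" where
  "L2_ind A c = abs_L2 (\<lambda>x. indicator A x *\<^sub>R c)"

lemma nn_integral_ind:
  assumes "A \<in> sets borel"
  shows "(\<integral>\<^sup>+x. ennreal ((norm (indicator A x *\<^sub>R (c::'k::real_normed_vector)))\<^sup>2) \<partial>lborel)
    = ennreal ((norm c)\<^sup>2) * emeasure lborel (A :: 'a::euclidean_space set)"
proof -
  have "(\<integral>\<^sup>+x. ennreal ((norm (indicator A x *\<^sub>R c))\<^sup>2) \<partial>lborel)
      = (\<integral>\<^sup>+x. ennreal ((norm c)\<^sup>2) * indicator A x \<partial>lborel)"
    by (intro nn_integral_cong) (auto split: split_indicator)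
  also have "\<dots> = ennreal ((norm c)\<^sup>2) * emeasure lborel A"
    using assms by (intro nn_integral_cmult_indicator) auto
  finally show ?thesis .
qed

lemma sq_integrable_ind:
  fixes A :: "'a::euclidean_space set"
    and c :: "'k::{real_normed_field,banach,second_countable_topology}"
  assumes [measurable]: "A \<in> sets borel" and "emeasure lborel A < \<infinity>"
  shows "sq_integrable (\<lambda>x. indicator A x *\<^sub>R c)"
proof (rule sq_integrable_nn)
  show "(\<lambda>x. indicator A x *\<^sub>R c) \<in> borel_measurable lborel" by measurable
  show "(\<integral>\<^sup>+x. ennreal ((norm (indicator A x *\<^sub>R c))\<^sup>2) \<partial>lborel) < \<infinity>"
    using assms by (subst nn_integral_ind) (simp_all add: ennreal_mult_less_top)
qed

lemma L2_ind_diff_right: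
  fixes A :: "'a::euclidean_space set"
    and c :: "'k::{real_normed_field,banach,second_countable_topology}"
  assumes A: "A \<in> sets borel" "emeasure lborel A < \<infinity>"
  shows "norm (L2_ind A c - L2_ind A d) = sqrt (measure lborel A) * norm (c - d)"
proof -
  have eq: "L2_ind A c - L2_ind A d = abs_L2 (\<lambda>x. indicator A x *\<^sub>R (c - d))"
    using A by (simp add: L2_ind_def abs_L2_diff sq_integrable_ind scaleR_diff_right)
  have "ennreal ((norm (L2_ind A c - L2_ind A d))\<^sup>2)
      = ennreal ((norm (c - d))\<^sup>2) * ennreal (measure lborel A)"
    unfolding eq
    by (subst norm_abs_L2_nn, rule sq_integrable_ind[OF A], subst nn_integral_ind[OF A(1)])
       (use A in \<open>simp add: emeasure_eq_ennreal_measure\<close>)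
  then have "(norm (L2_ind A c - L2_ind A d))\<^sup>2 = (norm (c - d))\<^sup>2 * measure lborel A"
    by (simp flip: ennreal_mult)
  then have "sqrt ((norm (L2_ind A c - L2_ind A d))\<^sup>2) = sqrt ((norm (c - d))\<^sup>2 * measure lborel A)"
    by simp
  then show ?thesis by (simp add: real_sqrt_mult mult.commute)
qed

lemma L2_ind_approx:
  fixes A :: "'a::euclidean_space set"
    and c :: "'k::{real_normed_field,banach,second_countable_topology}"
  assumes B: "countable B" "topological_basis B"
    and A [measurable]: "A \<in> sets borel" and finA: "emeasure lborel A < \<infinity>" and e: "0 < e"
  obtains F where "finite F" "F \<subseteq> B" "emeasure lborel (\<Union>F) < \<infinity>"
    "norm (L2_ind A c - L2_ind (\<Union>F) c) < e"
proof -
  define \<delta> where "\<delta> = e\<^sup>2 / (4 * ((norm c)\<^sup>2 + 1))"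
  have \<delta>: "0 < \<delta>" using e by (auto simp: \<delta>_def intro!: divide_pos_pos add_nonneg_pos)
  obtain U where U: "open U" "A \<subseteq> U" "emeasure lborel (U - A) < ennreal \<delta>"
    using outer_regular_lborel[OF A \<delta>] by metis
  have [measurable]: "U \<in> sets borel" using U by simp
  obtain B' where B': "B' \<subseteq> B" "U = \<Union>B'"
    using B(2) U(1) unfolding topological_basis_def by metis
  have bopen: "open b" if "b \<in> B" for b
    using B(2) that topological_basis_open by blast
  have finU: "emeasure lborel U < \<infinity>"
  proof -
    have "emeasure lborel U = emeasure lborel (A \<union> (U - A))"
      using U by (auto intro: arg_cong[where f = "emeasure lborel"])
    also have "\<dots> \<le> emeasure lborel A + emeasure lborel (U - A)"
      by (rule emeasure_subadditive) auto
    also have "\<dots> < \<infinity>"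
      using finA U(3) by (auto simp: ennreal_add_eq_top top.not_eq_extremum intro: order_less_trans)
    finally show ?thesis .
  qed
  define W where "W n = \<Union>{b \<in> B'. to_nat_on B' b \<le> n}" for n
  have cB': "countable B'" using B' B(1) countable_subset by blast
  have fin: "finite {b \<in> B'. to_nat_on B' b \<le> n}" for n
    by (rule inj_on_finite[of "to_nat_on B'" _ "{..n}"])
       (auto intro: inj_on_subset[OF inj_on_to_nat_on[OF cB']])
  have Wopen: "open (W n)" for n
    unfolding W_def using B' bopen by (intro open_Union) auto
  then have [measurable]: "W n \<in> sets borel" for n by simp
  have WU: "W n \<subseteq> U" for n unfolding W_def B' by auto
  have "(\<lambda>n. emeasure lborel (U - W n)) \<longlonglongrightarrow> emeasure lborel (\<Inter>n. U - W n)"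
  proof (rule Lim_emeasure_decseq)
    show "decseq (\<lambda>n. U - W n)"
      unfolding decseq_def W_def by (auto intro: order_trans)
    show "emeasure lborel (U - W n) \<noteq> \<infinity>" for n
      using finU emeasure_mono[of "U - W n" U lborel] by (auto simp: top_unique)
  qed auto
  also have "(\<Inter>n. U - W n) = {}"
    unfolding W_def B' by auto
  finally have "(\<lambda>n. emeasure lborel (U - W n)) \<longlonglongrightarrow> 0" by simp
  then have "\<forall>\<^sub>F n in sequentially. emeasure lborel (U - W n) < ennreal \<delta>"
    by (rule order_tendstoD) (use \<delta> in auto)
  then obtain n where n: "emeasure lborel (U - W n) < ennreal \<delta>"
    by (auto simp: eventually_sequentially)
  let ?F = "{b \<in> B'. to_nat_on B' b \<le> n}"
  have finW: "emeasure lborel (W n) < \<infinity>"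
    using finU emeasure_mono[OF WU[of n], of lborel] by (auto intro: le_less_trans)
  let ?d = "\<lambda>x. indicator A x *\<^sub>R c - indicator (W n) x *\<^sub>R c"
  let ?V = "(U - A) \<union> (U - W n)"
  have "ennreal ((norm (L2_ind A c - L2_ind (W n) c))\<^sup>2) = (\<integral>\<^sup>+x. ennreal ((norm (?d x))\<^sup>2) \<partial>lborel)"
    unfolding L2_ind_def using finA finW
    by (subst abs_L2_diff; (subst norm_abs_L2_nn)?)
       (auto intro!: sq_integrable_ind sq_integrable_diff)
  also have "\<dots> \<le> (\<integral>\<^sup>+x. ennreal ((norm (indicator ?V x *\<^sub>R c))\<^sup>2) \<partial>lborel)"
    using U(2) WU[of n]
    by (intro nn_integral_mono) (auto split: split_indicator)
  also have "\<dots> = ennreal ((norm c)\<^sup>2) * emeasure lborel ?V"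
    by (rule nn_integral_ind) auto
  also have "\<dots> \<le> ennreal ((norm c)\<^sup>2) * ennreal (2 * \<delta>)"
  proof (rule mult_left_mono)
    have "emeasure lborel ?V \<le> emeasure lborel (U - A) + emeasure lborel (U - W n)"
      by (rule emeasure_subadditive) auto
    also have "\<dots> \<le> ennreal \<delta> + ennreal \<delta>"
      using U(3) n by (intro add_mono) auto
    also have "\<dots> = ennreal (2 * \<delta>)"
      using \<delta> by (simp flip: ennreal_plus)
    finally show "emeasure lborel ?V \<le> ennreal (2 * \<delta>)" .
  qed auto
  also have "\<dots> = ennreal ((norm c)\<^sup>2 * (2 * \<delta>))"
    using \<delta> by (simp add: ennreal_mult)
  finally have "(norm (L2_ind A c - L2_ind (W n) c))\<^sup>2 \<le> (norm c)\<^sup>2 * (2 * \<delta>)"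
    using \<delta> by (subst (asm) ennreal_le_iff) auto
  also have "\<dots> \<le> ((norm c)\<^sup>2 + 1) * (2 * \<delta>)"
    using \<delta> by (intro mult_right_mono) auto
  also have "\<dots> = e\<^sup>2 / 2"
    by (simp add: \<delta>_def field_simps add_nonneg_eq_0_iff)
  also have "\<dots> < e\<^sup>2" using e by simp
  finally have "norm (L2_ind A c - L2_ind (W n) c) < e"
    using e by (auto intro: power2_less_imp_less)
  then show thesis
    using that[of ?F] fin B'(1) finW by (auto simp: W_def)
qed

lemma abs_L2_sum_ind:
  fixes a :: "'i \<Rightarrow> 'a::euclidean_space set"
    and c :: "'i \<Rightarrow> 'k::{real_normed_field,banach,second_countable_topology}"
  assumes "finite Y" "\<And>y. y \<in> Y \<Longrightarrow> a y \<in> sets borel" "\<And>y. y \<in> Y \<Longrightarrow> emeasure lborel (a y) < \<infinity>"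
  shows "sq_integrable (\<lambda>x. \<Sum>y\<in>Y. indicator (a y) x *\<^sub>R c y)
    \<and> abs_L2 (\<lambda>x. \<Sum>y\<in>Y. indicator (a y) x *\<^sub>R c y) = (\<Sum>y\<in>Y. L2_ind (a y) (c y))"
  using assms
proof (induction Y rule: finite_induct)
  case empty
  show ?case by (simp add: zero_L2.abs_eq)
next
  case (insert y Y)
  let ?h = "\<lambda>x. \<Sum>y\<in>Y. indicator (a y) x *\<^sub>R c y"
  have IH: "sq_integrable ?h" "abs_L2 ?h = (\<Sum>y\<in>Y. L2_ind (a y) (c y))"
    using insert.IH insert.prems by simp_all
  have y: "sq_integrable (\<lambda>x. indicator (a y) x *\<^sub>R c y)"
    using insert.prems by (intro sq_integrable_ind) auto
  have eq: "(\<lambda>x. \<Sum>y\<in>insert y Y. indicator (a y) x *\<^sub>R c y)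
      = (\<lambda>x. indicator (a y) x *\<^sub>R c y + ?h x)"
    using insert.hyps by (intro ext sum.insert)
  show ?case
    unfolding eq sum.insert[OF insert.hyps] abs_L2_add[OF y IH(1), symmetric] IH(2)
    using sq_integrable_add[OF y IH(1)] by (simp only: L2_ind_def simp_thms)
qed

lemma L2_separable:
  "\<exists>S :: ('a::euclidean_space, 'k::{real_normed_field,banach,second_countable_topology}) L2 set.
     countable S \<and> closure S = UNIV"
proof -
  obtain B :: "'a set set" where B: "countable B" "topological_basis B"
    using ex_countable_basis by blast
  obtain C :: "'k set" where C: "countable C" "\<And>X. open X \<Longrightarrow> X \<noteq> {} \<Longrightarrow> \<exists>d\<in>C. d \<in> X"
    by (erule countable_dense_setE)
  define P where "P = {F. finite F \<and> F \<subseteq> B \<and> emeasure lborel (\<Union>F) < \<infinity>} \<times> C"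
  define S :: "('a, 'k) L2 set"
    where "S = (\<lambda>xs. sum_list (map (\<lambda>(F, c). L2_ind (\<Union>F) c) xs)) ` lists P"
  have "countable P"
    unfolding P_def
    by (intro countable_SIGMA C countable_subset[OF _ countable_Collect_finite_subset[OF B(1)]]) auto
  then have cS: "countable S" unfolding S_def by auto
  have S_add: "x + y \<in> S" if "x \<in> S" "y \<in> S" for x y
  proof -
    obtain xs ys where "xs \<in> lists P" "ys \<in> lists P"
      "x = sum_list (map (\<lambda>(F, c). L2_ind (\<Union>F) c) xs)"
      "y = sum_list (map (\<lambda>(F, c). L2_ind (\<Union>F) c) ys)"
      using \<open>x \<in> S\<close> \<open>y \<in> S\<close> unfolding S_def by blast
    then show ?thesis
      unfolding S_def by (intro image_eqI[of _ _ "xs @ ys"]) auto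
  qed
  have S_0: "0 \<in> S" unfolding S_def by (intro image_eqI[of _ _ "[]"]) auto
  have cl_add: "x + y \<in> closure S" if "x \<in> closure S" "y \<in> closure S" for x y
  proof -
    obtain X Y where "\<And>n. X n \<in> S" "X \<longlonglongrightarrow> x" "\<And>n. Y n \<in> S" "Y \<longlonglongrightarrow> y"
      using \<open>x \<in> closure S\<close> \<open>y \<in> closure S\<close> unfolding closure_sequential by blast
    then show ?thesis
      unfolding closure_sequential by (intro exI[of _ "\<lambda>n. X n + Y n"]) (auto intro: S_add tendsto_add)
  qed
  have cl_sum: "(\<Sum>y\<in>Y. h y) \<in> closure S" if "finite Y" "\<And>y. y \<in> Y \<Longrightarrow> h y \<in> closure S" for Y :: "'k set" and h
    using that
  proof (induction Y rule: finite_induct)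
    case empty
    show ?case using S_0 closure_subset by auto
  next
    case (insert y Y)
    then show ?case by (auto intro: cl_add)
  qed
  have cl_ind: "L2_ind A c \<in> closure S" if A: "A \<in> sets borel" "emeasure lborel A < \<infinity>" for A c
    unfolding closure_approachable
  proof (intro allI impI)
    fix e :: real
    assume e: "0 < e"
    obtain F where F: "finite F" "F \<subseteq> B" "emeasure lborel (\<Union>F) < \<infinity>"
      "norm (L2_ind A c - L2_ind (\<Union>F) c) < e / 2"
      using L2_ind_approx[OF B A, of "e / 2"] e by auto
    define m where "m = sqrt (measure lborel (\<Union>F))"
    have m: "0 \<le> m" by (simp add: m_def)
    have "0 < e / 2 / (m + 1)" using e m by simp
    then have "c \<in> ball c (e / 2 / (m + 1))" by (simp only: centre_in_ball)
    then obtain d where d: "d \<in> C" "d \<in> ball c (e / 2 / (m + 1))"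
      using C(2)[OF open_ball] by blast
    have Fb: "\<Union>F \<in> sets borel"
      using F B(2) by (auto intro!: borel_open open_Union dest: topological_basis_open)
    have "norm (L2_ind (\<Union>F) c - L2_ind (\<Union>F) d) = m * norm (c - d)"
      using L2_ind_diff_right[OF Fb F(3)] by (simp add: m_def)
    also have "\<dots> \<le> (m + 1) * (e / 2 / (m + 1))"
      using d m by (intro mult_mono) (auto simp: dist_norm)
    also have "\<dots> = e / 2"
    proof -
      have "m + 1 \<noteq> 0" using m by linarith
      then show ?thesis
        by (subst times_divide_eq_right) (rule nonzero_mult_div_cancel_left)
    qed
    finally have "norm (L2_ind (\<Union>F) c - L2_ind (\<Union>F) d) \<le> e / 2" .
    then have "norm ((L2_ind A c - L2_ind (\<Union>F) c) + (L2_ind (\<Union>F) c - L2_ind (\<Union>F) d)) < e"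
      using F(4) by (intro le_less_trans[OF norm_triangle_ineq]) auto
    moreover have "L2_ind (\<Union>F) d \<in> S"
      unfolding S_def using F d by (intro image_eqI[of _ _ "[(F, d)]"]) (auto simp: P_def)
    ultimately show "\<exists>y\<in>S. dist y (L2_ind A c) < e"
      by (intro bexI[of _ "L2_ind (\<Union>F) d"]) (auto simp: dist_norm norm_minus_commute)
  qed
  have "F \<in> closure S" for F
  proof -
    obtain f where f: "sq_integrable f" "F = abs_L2 f"
      by (rule L2_cases)
    have fm [measurable]: "f \<in> borel_measurable lborel"
      and fi: "integrable lborel (\<lambda>x. (norm (f x))\<^sup>2)"
      using f(1) by (auto simp: sq_integrable_def)
    obtain s where s: "\<And>i. simple_function lborel (s i)" "\<And>x. (\<lambda>i. s i x) \<longlonglongrightarrow> f x"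
      "\<And>i x. norm (s i x) \<le> 2 * norm (f x)"
      using borel_measurable_implies_sequence_metric[OF fm, of 0] by auto
    have sm [measurable]: "s i \<in> borel_measurable lborel" for i
      using s(1) by (rule borel_measurable_simple_function)
    have s_sq: "(norm (s i x))\<^sup>2 \<le> 4 * (norm (f x))\<^sup>2" for i x
      using power_mono[OF s(3), of i x 2] by (simp add: power_mult_distrib)
    have sqs: "sq_integrable (s i)" for i
      by (rule sq_integrable_bound[OF sm integrable_mult_right[OF fi]]) (use s_sq in auto)
    have scl: "abs_L2 (s i) \<in> closure S" for i
    proof -
      let ?Y = "range (s i) - {0}"
      let ?a = "\<lambda>y. s i -` {y}"
      have finY: "finite ?Y"
        using s(1)[of i] by (auto simp: simple_function_def)
      have a_b: "?a y \<in> sets borel" for y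
        using measurable_sets[OF sm[of i], of "{y}"] by simp
      have a_fin: "emeasure lborel (?a y) < \<infinity>" if "y \<in> ?Y" for y
      proof -
        have "ennreal ((norm y)\<^sup>2) * emeasure lborel (?a y)
            = (\<integral>\<^sup>+x. ennreal ((norm (indicator (?a y) x *\<^sub>R y))\<^sup>2) \<partial>lborel)"
          by (rule nn_integral_ind[symmetric]) (rule a_b)
        also have "\<dots> \<le> (\<integral>\<^sup>+x. ennreal ((norm (s i x))\<^sup>2) \<partial>lborel)"
          by (intro nn_integral_mono) (auto split: split_indicator)
        also have "\<dots> < \<infinity>"
          using sqs[of i] by (simp flip: norm_abs_L2_nn)
        finally show ?thesis
          using that by (auto simp: ennreal_mult_less_top ennreal_eq_0_iff not_le)
      qed
      have "s i x = (\<Sum>y\<in>?Y. indicator (?a y) x *\<^sub>R y)" for x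
      proof -
        have "(\<Sum>y\<in>?Y. indicator (?a y) x *\<^sub>R y) = (\<Sum>y\<in>?Y. if y = s i x then y else 0)"
          by (intro sum.cong) (auto split: split_indicator)
        then show ?thesis using finY by simp
      qed
      then have "s i = (\<lambda>x. \<Sum>y\<in>?Y. indicator (?a y) x *\<^sub>R y)" by blast
      then have "abs_L2 (s i) = abs_L2 (\<lambda>x. \<Sum>y\<in>?Y. indicator (?a y) x *\<^sub>R y)"
        by (rule arg_cong)
      also have "\<dots> = (\<Sum>y\<in>?Y. L2_ind (?a y) y)"
        by (rule abs_L2_sum_ind[OF finY a_b a_fin, THEN conjunct2])
      finally have "abs_L2 (s i) = (\<Sum>y\<in>?Y. L2_ind (?a y) y)" .
      then show ?thesis
        using cl_sum[OF finY] cl_ind a_b a_fin by simp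
    qed
    have "(\<lambda>i. \<integral>x. (norm (s i x - f x))\<^sup>2 \<partial>lborel) \<longlonglongrightarrow> (\<integral>x. 0 \<partial>(lborel :: 'a measure))"
    proof (rule integral_dominated_convergence)
      show "integrable lborel (\<lambda>x. 9 * (norm (f x))\<^sup>2)"
        using fi by (rule integrable_mult_right)
      show "AE x in lborel. (\<lambda>i. (norm (s i x - f x))\<^sup>2) \<longlonglongrightarrow> 0"
        using s(2) by (auto intro!: tendsto_null_power tendsto_norm_zero LIM_zero)
      have "(norm (s i x - f x))\<^sup>2 \<le> 9 * (norm (f x))\<^sup>2" for i x
      proof -
        have "norm (s i x - f x) \<le> 3 * norm (f x)"
          using norm_triangle_ineq4[of "s i x" "f x"] s(3)[of i x] by simp
        from power_mono[OF this, of 2] show ?thesis by (simp add: power_mult_distrib)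
      qed
      then show "AE x in lborel. norm ((norm (s i x - f x))\<^sup>2) \<le> 9 * (norm (f x))\<^sup>2" for i
        by simp
    qed auto
    moreover have "(norm (abs_L2 (s i) - F))\<^sup>2 = (\<integral>x. (norm (s i x - f x))\<^sup>2 \<partial>lborel)" for i
      using f sqs sq_integrable_diff[OF sqs f(1)] by (simp add: abs_L2_diff norm_abs_L2)
    ultimately have "(\<lambda>i. (norm (abs_L2 (s i) - F))\<^sup>2) \<longlonglongrightarrow> 0" by simp
    from tendsto_real_sqrt[OF this] have "(\<lambda>i. norm (abs_L2 (s i) - F)) \<longlonglongrightarrow> 0" by simp
    then have "(\<lambda>i. abs_L2 (s i)) \<longlonglongrightarrow> F"
      by (simp add: tendsto_norm_zero_iff LIM_zero_iff)
    then have "F \<in> closure (closure S)"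
      using scl unfolding closure_sequential[of F]
      by (intro exI[of _ "\<lambda>i. abs_L2 (s i)"]) simp
    then show ?thesis by simp
  qed
  then show ?thesis using cS by blast
qed

instance L2 :: (euclidean_space, "{real_normed_field,banach,second_countable_topology}")
  second_countable_topology
proof
  obtain S :: "('a, 'b) L2 set" where S: "countable S" "closure S = UNIV"
    using L2_separable by blast
  define B where "B = (\<lambda>(x, n). ball x (1 / Suc n)) ` (S \<times> (UNIV :: nat set))"
  have "topological_basis B"
  proof (rule topological_basisI)
    show "open U" if "U \<in> B" for U
      using that by (auto simp: B_def)
    fix U :: "('a, 'b) L2 set" and x
    assume "open U" "x \<in> U"
    then obtain e where e: "0 < e" "ball x e \<subseteq> U"
      using open_contains_ball by blast
    obtain n where n: "1 / Suc n < e / 2"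
      using nat_approx_posE[of "e / 2"] e by auto
    have "x \<in> closure S" using S by simp
    then obtain y where y: "y \<in> S" "dist y x < 1 / Suc n"
      unfolding closure_approachable by (metis divide_pos_pos of_nat_0_less_iff zero_less_Suc zero_less_one)
    have "ball y (1 / Suc n) \<subseteq> ball x e"
    proof
      fix z
      assume "z \<in> ball y (1 / Suc n)"
      then show "z \<in> ball x e"
        using y(2) n dist_triangle[of x z y] by (simp add: dist_commute)
    qed
    then show "\<exists>B'\<in>B. x \<in> B' \<and> B' \<subseteq> U"
      using y e unfolding B_def by (intro bexI[of _ "ball y (1 / Suc n)"]) auto
  qed
  moreover have "countable B"
    using S unfolding B_def by auto
  ultimately show "\<exists>B :: ('a, 'b) L2 set set. countable B \<and> open = generate_topology B"
    using topological_basis_imp_subbasis by blast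
qed


section \<open>The space of essentially bounded functions\<close>

definition ess_bounded ::
  "('a::euclidean_space \<Rightarrow> 'k::{real_normed_field,banach,second_countable_topology}) \<Rightarrow> bool" where
  "ess_bounded f \<longleftrightarrow> f \<in> borel_measurable lborel \<and> (\<exists>C. AE x in lborel. norm (f x) \<le> C)"

definition ess_norm ::
  "('a::euclidean_space \<Rightarrow> 'k::{real_normed_field,banach,second_countable_topology}) \<Rightarrow> real" where
  "ess_norm f = real_of_ereal (esssup lborel (\<lambda>x. ereal (norm (f x))))"

definition Linf_rel ::
  "('a::euclidean_space \<Rightarrow> 'k::{real_normed_field,banach,second_countable_topology})
   \<Rightarrow> ('a \<Rightarrow> 'k) \<Rightarrow> bool" where
  "Linf_rel f g \<longleftrightarrow> ess_bounded f \<and> ess_bounded g \<and> (AE x in lborel. f x = g x)"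

lemma ess_norm_props:
  fixes f :: "'a::euclidean_space \<Rightarrow> 'k::{real_normed_field,banach,second_countable_topology}"
  assumes "ess_bounded f"
  shows ess_norm_nonneg: "0 \<le> ess_norm f"
    and ess_norm_AE: "AE x in lborel. norm (f x) \<le> ess_norm f"
    and ess_norm_least: "\<And>C. AE x in lborel. norm (f x) \<le> C \<Longrightarrow> ess_norm f \<le> C"
proof -
  let ?E = "esssup lborel (\<lambda>x. ereal (norm (f x)))"
  have f [measurable]: "f \<in> borel_measurable lborel"
    using assms by (simp add: ess_bounded_def)
  obtain C where C: "AE x in lborel. norm (f x) \<le> C"
    using assms by (auto simp: ess_bounded_def)
  have E_le: "?E \<le> ereal B" if "AE x in lborel. norm (f x) \<le> B" for B
    using that by (intro esssup_I) auto
  have "(0::ereal) = esssup (lborel :: 'a measure) (\<lambda>x. 0)"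
    by (rule esssup_const[symmetric]) simp
  also have "\<dots> \<le> ?E"
    by (rule esssup_mono) auto
  finally have E0: "0 \<le> ?E" .
  then obtain r where r: "?E = ereal r"
    using E_le[OF C] by (cases ?E) auto
  then have en: "ess_norm f = r" by (simp add: ess_norm_def)
  show "0 \<le> ess_norm f" using E0 r en by simp
  show "AE x in lborel. norm (f x) \<le> ess_norm f"
    using esssup_AE[of "\<lambda>x. ereal (norm (f x))" lborel] by (simp add: r en)
  show "ess_norm f \<le> C" if "AE x in lborel. norm (f x) \<le> C" for C
    using E_le[OF that] by (simp add: r en)
qed

lemma ess_bounded_0 [simp]: "ess_bounded (\<lambda>x. 0)"
  by (auto simp: ess_bounded_def intro!: exI[of _ 0])

lemma ess_bounded_add:
  assumes "ess_bounded f" "ess_bounded g"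
  shows "ess_bounded (\<lambda>x. f x + g x)"
    and "AE x in lborel. norm (f x + g x) \<le> ess_norm f + ess_norm g"
proof -
  show *: "AE x in lborel. norm (f x + g x) \<le> ess_norm f + ess_norm g"
    using ess_norm_AE[OF assms(1)] ess_norm_AE[OF assms(2)]
    by eventually_elim (rule norm_triangle_mono)
  then show "ess_bounded (\<lambda>x. f x + g x)"
    using assms by (auto simp: ess_bounded_def intro: borel_measurable_add)
qed

lemma ess_bounded_scaleR:
  assumes "ess_bounded f"
  shows "ess_bounded (\<lambda>x. r *\<^sub>R f x)"
    and "AE x in lborel. norm (r *\<^sub>R f x) \<le> \<bar>r\<bar> * ess_norm f"
proof -
  show *: "AE x in lborel. norm (r *\<^sub>R f x) \<le> \<bar>r\<bar> * ess_norm f"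
    using ess_norm_AE[OF assms] by eventually_elim (simp add: mult_left_mono)
  then show "ess_bounded (\<lambda>x. r *\<^sub>R f x)"
    unfolding ess_bounded_def using assms
    by (intro conjI exI[of _ "\<bar>r\<bar> * ess_norm f"]) (auto simp: ess_bounded_def)
qed

lemma ess_bounded_uminus: "ess_bounded f \<Longrightarrow> ess_bounded (\<lambda>x. - f x)"
  by (auto simp: ess_bounded_def)

lemma ess_bounded_diff:
  "ess_bounded f \<Longrightarrow> ess_bounded g \<Longrightarrow> ess_bounded (\<lambda>x. f x - g x)"
  using ess_bounded_add(1)[of f "\<lambda>x. - g x"] ess_bounded_uminus[of g] by simp

lemma ess_norm_cong:
  assumes "Linf_rel f g"
  shows "ess_norm f = ess_norm g"
  unfolding ess_norm_def using assms
  by (intro arg_cong[where f = real_of_ereal] esssup_AE_cong)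
     (auto simp: Linf_rel_def ess_bounded_def elim: eventually_mono)

quotient_type (overloaded) ('a, 'k) Linf =
  "'a::euclidean_space \<Rightarrow> 'k::{real_normed_field,banach,second_countable_topology}"
  / partial: Linf_rel
proof (rule part_equivpI)
  show "\<exists>f::'a \<Rightarrow> 'k. Linf_rel f f"
    by (rule exI[of _ "\<lambda>x. 0"]) (simp add: Linf_rel_def)
  show "symp (Linf_rel :: ('a \<Rightarrow> 'k) \<Rightarrow> _)"
    unfolding symp_def Linf_rel_def by (auto elim: eventually_mono)
  show "transp (Linf_rel :: ('a \<Rightarrow> 'k) \<Rightarrow> _)"
    unfolding transp_def Linf_rel_def by (auto elim: eventually_elim2)
qed

instantiation Linf :: (euclidean_space, "{real_normed_field,banach,second_countable_topology}")
  real_normed_vector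
begin

lift_definition zero_Linf :: "('a, 'b) Linf" is "\<lambda>x. 0"
  by (simp add: Linf_rel_def)

lift_definition plus_Linf :: "('a, 'b) Linf \<Rightarrow> ('a, 'b) Linf \<Rightarrow> ('a, 'b) Linf"
  is "\<lambda>f g x. f x + g x"
  unfolding Linf_rel_def by (auto intro: ess_bounded_add)

lift_definition minus_Linf :: "('a, 'b) Linf \<Rightarrow> ('a, 'b) Linf \<Rightarrow> ('a, 'b) Linf"
  is "\<lambda>f g x. f x - g x"
  unfolding Linf_rel_def by (auto intro: ess_bounded_diff)

lift_definition uminus_Linf :: "('a, 'b) Linf \<Rightarrow> ('a, 'b) Linf"
  is "\<lambda>f x. - f x"
  unfolding Linf_rel_def by (auto intro: ess_bounded_uminus)

lift_definition scaleR_Linf :: "real \<Rightarrow> ('a, 'b) Linf \<Rightarrow> ('a, 'b) Linf"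
  is "\<lambda>r f x. r *\<^sub>R f x"
  unfolding Linf_rel_def by (auto intro: ess_bounded_scaleR)

lift_definition norm_Linf :: "('a, 'b) Linf \<Rightarrow> real" is ess_norm
  by (rule ess_norm_cong)

definition dist_Linf :: "('a, 'b) Linf \<Rightarrow> ('a, 'b) Linf \<Rightarrow> real"
  where "dist_Linf f g = norm (f - g)"

definition sgn_Linf :: "('a, 'b) Linf \<Rightarrow> ('a, 'b) Linf"
  where "sgn_Linf f = scaleR (inverse (norm f)) f"

definition uniformity_Linf :: "(('a, 'b) Linf \<times> ('a, 'b) Linf) filter"
  where "uniformity_Linf = (INF e\<in>{0 <..}. principal {(x, y). dist x y < e})"

definition open_Linf :: "('a, 'b) Linf set \<Rightarrow> bool"
  where "open_Linf S = (\<forall>x\<in>S. \<forall>\<^sub>F (x', y) in uniformity. x' = x \<longrightarrow> y \<in> S)"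

instance
proof
  fix f g h :: "('a, 'b) Linf" and r s :: real
  show "f + g + h = f + (g + h)"
    by transfer (auto simp: Linf_rel_def ac_simps intro!: ess_bounded_add)
  show "f + g = g + f"
    by transfer (auto simp: Linf_rel_def ac_simps intro!: ess_bounded_add)
  show "0 + f = f"
    by transfer (auto simp: Linf_rel_def)
  show "- f + f = 0"
    by transfer (auto simp: Linf_rel_def)
  show "f - g = f + - g"
    by transfer (auto simp: Linf_rel_def intro!: ess_bounded_diff)
  show "r *\<^sub>R (f + g) = r *\<^sub>R f + r *\<^sub>R g"
    by transfer (auto simp: Linf_rel_def scaleR_add_right
        intro!: ess_bounded_scaleR ess_bounded_add)
  show "(r + s) *\<^sub>R f = r *\<^sub>R f + s *\<^sub>R f"
    by transfer (auto simp: Linf_rel_def scaleR_add_left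
        intro!: ess_bounded_scaleR ess_bounded_add)
  show "r *\<^sub>R s *\<^sub>R f = (r * s) *\<^sub>R f"
    by transfer (auto simp: Linf_rel_def intro!: ess_bounded_scaleR)
  show "1 *\<^sub>R f = f"
    by transfer (auto simp: Linf_rel_def)
  show "norm f = 0 \<longleftrightarrow> f = 0"
  proof transfer
    fix f :: "'a \<Rightarrow> 'b"
    assume f: "Linf_rel f f"
    then have fb: "ess_bounded f" by (simp add: Linf_rel_def)
    show "ess_norm f = 0 \<longleftrightarrow> Linf_rel f (\<lambda>x. 0)"
    proof
      assume "ess_norm f = 0"
      then show "Linf_rel f (\<lambda>x. 0)"
        using ess_norm_AE[OF fb] fb by (simp add: Linf_rel_def)
    next
      assume "Linf_rel f (\<lambda>x. 0)"
      then have "ess_norm f \<le> 0"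
        by (intro ess_norm_least[OF fb]) (auto simp: Linf_rel_def)
      then show "ess_norm f = 0"
        using ess_norm_nonneg[OF fb] by simp
    qed
  qed
  show "norm (f + g) \<le> norm f + norm g"
    by transfer (auto simp: Linf_rel_def intro!: ess_norm_least ess_bounded_add)
  have le: "norm (r *\<^sub>R f) \<le> \<bar>r\<bar> * norm f" for r and f :: "('a, 'b) Linf"
    by transfer (auto simp: Linf_rel_def
        intro!: ess_norm_least ess_bounded_scaleR ess_bounded_scaleR(2)[simplified])
  show "norm (r *\<^sub>R f) = \<bar>r\<bar> * norm f"
  proof (cases "r = 0")
    case True
    have "norm (0 *\<^sub>R f) \<le> 0" using le[of 0 f] by simp
    moreover have "0 \<le> norm (0 *\<^sub>R f)"
      by transfer (auto simp: Linf_rel_def intro!: ess_norm_nonneg)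
    ultimately show ?thesis using True by simp
  next
    case False
    have "inverse r *\<^sub>R r *\<^sub>R f = f"
      using False by transfer (auto simp: Linf_rel_def)
    then have "\<bar>r\<bar> * norm f \<le> \<bar>r\<bar> * (\<bar>inverse r\<bar> * norm (r *\<^sub>R f))"
      using le[of "inverse r" "r *\<^sub>R f"] by (intro mult_left_mono) auto
    also have "\<dots> = norm (r *\<^sub>R f)"
      using False by (simp add: abs_inverse)
    finally show ?thesis using le[of r f] by simp
  qed
qed (rule dist_Linf_def sgn_Linf_def uniformity_Linf_def open_Linf_def)+

end

lemma sq_integrable_mult:
  assumes q: "ess_bounded q" and f: "sq_integrable f"
  shows "sq_integrable (\<lambda>x. q x * f x)"
proof (rule sq_integrable_bound)
  show "(\<lambda>x. q x * f x) \<in> borel_measurable lborel"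
    using q f by (auto simp: ess_bounded_def sq_integrable_def intro: borel_measurable_times)
  show "integrable lborel (\<lambda>x. (ess_norm q)\<^sup>2 * (norm (f x))\<^sup>2)"
    using f by (auto simp: sq_integrable_def)
  show "AE x in lborel. (norm (q x * f x))\<^sup>2 \<le> (ess_norm q)\<^sup>2 * (norm (f x))\<^sup>2"
    using ess_norm_AE[OF q]
    by eventually_elim (auto simp: norm_mult power_mult_distrib intro!: mult_right_mono power_mono)
qed

lift_definition Linf_mult ::
  "('a::euclidean_space, 'k::{real_normed_field,banach,second_countable_topology}) Linf
   \<Rightarrow> ('a, 'k) L2 \<Rightarrow> ('a, 'k) L2"
  is "\<lambda>q f x. q x * f x"
  unfolding Linf_rel_def L2_rel_def by (auto intro: sq_integrable_mult elim: eventually_elim2)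


section \<open>Semigroups of operators\<close>

definition bounded_op ::
  "(('a::euclidean_space, 'k::{real_normed_field,banach,second_countable_topology}) L2
    \<Rightarrow> ('a, 'k) L2) \<Rightarrow> bool" where
  "bounded_op B \<longleftrightarrow> bounded_linear B \<and> (\<forall>c f. B (scale_L2 c f) = scale_L2 c (B f))"

definition C0_semigroup ::
  "(real \<Rightarrow> ('a::euclidean_space, 'k::{real_normed_field,banach,second_countable_topology}) L2
    \<Rightarrow> ('a, 'k) L2) \<Rightarrow> bool" where
  "C0_semigroup S \<longleftrightarrow>
     (\<forall>t\<ge>0. bounded_op (S t)) \<and> (\<forall>f. S 0 f = f) \<and>
     (\<forall>s\<ge>0. \<forall>t\<ge>0. \<forall>f. S (s + t) f = S s (S t f)) \<and>
     (\<forall>f. ((\<lambda>t. S t f) \<longlongrightarrow> f) (at_right 0))"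

definition closed_densely_defined ::
  "('a::euclidean_space, 'k::{real_normed_field,banach,second_countable_topology}) L2 set
   \<Rightarrow> (('a, 'k) L2 \<Rightarrow> ('a, 'k) L2) \<Rightarrow> bool" where
  "closed_densely_defined D L \<longleftrightarrow>
     0 \<in> D \<and>
     (\<forall>f\<in>D. \<forall>g\<in>D. f + g \<in> D \<and> L (f + g) = L f + L g) \<and>
     (\<forall>c. \<forall>f\<in>D. scale_L2 c f \<in> D \<and> L (scale_L2 c f) = scale_L2 c (L f)) \<and>
     closure D = UNIV \<and>
     closed {(f, L f) | f. f \<in> D}"

definition generates ::
  "('a::euclidean_space, 'k::{real_normed_field,banach,second_countable_topology}) L2 set
   \<Rightarrow> (('a, 'k) L2 \<Rightarrow> ('a, 'k) L2) \<Rightarrow> (real \<Rightarrow> ('a, 'k) L2 \<Rightarrow> ('a, 'k) L2) \<Rightarrow> bool" where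
  "generates D L S \<longleftrightarrow>
     D = {f. \<exists>g. ((\<lambda>h. (S h f - f) /\<^sub>R h) \<longlongrightarrow> g) (at_right 0)} \<and>
     (\<forall>f\<in>D. ((\<lambda>h. (S h f - f) /\<^sub>R h) \<longlongrightarrow> L f) (at_right 0))"


section \<open>Absolutely continuous functions\<close>

text \<open>Elements are made \<open>undefined\<close> outside \<open>[0,T]\<close>, so that equality in the space is
  equality on \<open>[0,T]\<close>.\<close>

definition AC :: "real \<Rightarrow> 'x set \<Rightarrow> (real \<Rightarrow> 'x::{banach,second_countable_topology}) set" where
  "AC T X = {f \<in> {0..T} \<rightarrow>\<^sub>E X. \<exists>f'.
     set_integrable lborel {0..T} f' \<and>
     (AE t in lborel. t \<in> {0..T} \<longrightarrow> (f has_vector_derivative f' t) (at t within {0..T})) \<and>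
     (\<forall>t\<in>{0..T}. f t = f 0 + (LINT s:{0..t}|lborel. f' s))}"

definition sup_norm :: "real \<Rightarrow> (real \<Rightarrow> 'x::real_normed_vector) \<Rightarrow> real" where
  "sup_norm T f = (SUP t\<in>{0..T}. norm (f t))"


section \<open>Multi-indices\<close>

text \<open>Positions are counted from \<open>0\<close>: the component of \<open>\<alpha>\<close> at \<open>i\<close> is the one usually
  written with index \<open>i + 1\<close>. The order that \<^theory>\<open>HOL-Library.Poly_Mapping\<close> puts on
  \<open>nat \<Rightarrow>\<^sub>0 nat\<close> is not the componentwise one.\<close>

type_synonym multi_index = "nat \<Rightarrow>\<^sub>0 nat"

definition mi_abs :: "multi_index \<Rightarrow> nat" where
  "mi_abs \<alpha> = (\<Sum>i\<in>Poly_Mapping.keys \<alpha>. Poly_Mapping.lookup \<alpha> i)"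

definition mi_le :: "multi_index \<Rightarrow> multi_index \<Rightarrow> bool" where
  "mi_le \<alpha> \<beta> \<longleftrightarrow> (\<forall>k. Poly_Mapping.lookup \<alpha> k \<le> Poly_Mapping.lookup \<beta> k)"

definition mi_less :: "multi_index \<Rightarrow> multi_index \<Rightarrow> bool" where
  "mi_less \<alpha> \<beta> \<longleftrightarrow> mi_le \<alpha> \<beta> \<and> \<alpha> \<noteq> \<beta>"

text \<open>The weight \<open>(2\<nat>)\<^bsup>p\<alpha>\<^esup>\<close>.\<close>

definition mi_weight :: "real \<Rightarrow> multi_index \<Rightarrow> real" where
  "mi_weight p \<alpha> =
     (\<Prod>i\<in>Poly_Mapping.keys \<alpha>. (2 * real (Suc i)) powr (p * real (Poly_Mapping.lookup \<alpha> i)))"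

text \<open>Ordered tuples of nonzero multi-indices with prescribed sum.\<close>

definition decompositions :: "nat \<Rightarrow> multi_index \<Rightarrow> multi_index list set" where
  "decompositions k \<gamma> = {\<theta>. length \<theta> = k \<and> sum_list \<theta> = \<gamma> \<and> (\<forall>\<eta>\<in>set \<theta>. \<eta> \<noteq> 0)}"

text \<open>The index sets of the finite sums below are indeed finite.\<close>

lemma finite_mi_le: "finite {\<beta>. mi_le \<beta> \<gamma>}"
proof (rule finite_imageD)
  let ?r = "\<lambda>\<beta>::multi_index. restrict (Poly_Mapping.lookup \<beta>) (Poly_Mapping.keys \<gamma>)"
  have "?r ` {\<beta>. mi_le \<beta> \<gamma>} \<subseteq> (\<Pi>\<^sub>E k\<in>Poly_Mapping.keys \<gamma>. {..Poly_Mapping.lookup \<gamma> k})"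
    by (auto simp: mi_le_def)
  moreover have "finite (\<Pi>\<^sub>E k\<in>Poly_Mapping.keys \<gamma>. {..Poly_Mapping.lookup \<gamma> k})"
    by (intro finite_PiE) auto
  ultimately show "finite (?r ` {\<beta>. mi_le \<beta> \<gamma>})"
    by (rule finite_subset)
  show "inj_on ?r {\<beta>. mi_le \<beta> \<gamma>}"
  proof (rule inj_onI)
    fix \<alpha> \<beta> assume \<alpha>: "\<alpha> \<in> {\<beta>. mi_le \<beta> \<gamma>}" and \<beta>: "\<beta> \<in> {\<beta>. mi_le \<beta> \<gamma>}" and eq: "?r \<alpha> = ?r \<beta>"
    show "\<alpha> = \<beta>"
    proof (rule poly_mapping_eqI)
      fix k
      show "Poly_Mapping.lookup \<alpha> k = Poly_Mapping.lookup \<beta> k"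
      proof (cases "k \<in> Poly_Mapping.keys \<gamma>")
        case True
        then show ?thesis using fun_cong[OF eq, of k] by simp
      next
        case False
        then have "Poly_Mapping.lookup \<gamma> k = 0" by (simp add: in_keys_iff)
        then have "Poly_Mapping.lookup \<alpha> k = 0" "Poly_Mapping.lookup \<beta> k = 0"
          using \<alpha> \<beta> by (auto simp: mi_le_def) (metis le_zero_eq)+
        then show ?thesis by simp
      qed
    qed
  qed
qed

lemma finite_mi_add: "finite {(\<alpha>, \<beta>). \<alpha> + \<beta> = (\<gamma>::multi_index)}"
  by (rule finite_subset[of _ "{\<alpha>. mi_le \<alpha> \<gamma>} \<times> {\<beta>. mi_le \<beta> \<gamma>}"])
     (auto simp: mi_le_def lookup_add
       intro: finite_cartesian_product[OF finite_mi_le finite_mi_le, unfolded mi_le_def])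

lemma mi_le_sum_list: "\<eta> \<in> set \<theta> \<Longrightarrow> mi_le \<eta> (sum_list \<theta>)"
  by (induction \<theta>) (auto simp: mi_le_def lookup_add trans_le_add1 trans_le_add2)

lemma finite_decompositions: "finite (decompositions k \<gamma>)"
  by (rule finite_subset[OF _ finite_lists_length_eq[OF finite_mi_le[of \<gamma>], of k]])
     (auto simp: decompositions_def dest: mi_le_sum_list)


section \<open>Generalized stochastic processes\<close>

text \<open>A formal chaos expansion is identified with its family of coefficients. The
  coefficient space is given by a carrier \<open>X\<close> and a norm \<open>N\<close> on it.\<close>

definition kondratiev_finite :: "('x \<Rightarrow> real) \<Rightarrow> (multi_index \<Rightarrow> 'x) \<Rightarrow> real \<Rightarrow> bool" where
  "kondratiev_finite N F p \<longleftrightarrow> (\<lambda>\<gamma>. (N (F \<gamma>))\<^sup>2 * mi_weight (- p) \<gamma>) summable_on UNIV"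

definition kondratiev_space :: "'x set \<Rightarrow> ('x \<Rightarrow> real) \<Rightarrow> real \<Rightarrow> (multi_index \<Rightarrow> 'x) set" where
  "kondratiev_space X N p = {F. (\<forall>\<gamma>. F \<gamma> \<in> X) \<and> kondratiev_finite N F p}"

definition kondratiev :: "'x set \<Rightarrow> ('x \<Rightarrow> real) \<Rightarrow> (multi_index \<Rightarrow> 'x) set" where
  "kondratiev X N = (\<Union>p\<in>{0..}. kondratiev_space X N p)"

text \<open>The infimum rather than the minimum, because the minimum need not be attained.\<close>

definition critical_exponent :: "('x \<Rightarrow> real) \<Rightarrow> (multi_index \<Rightarrow> 'x) \<Rightarrow> real" where
  "critical_exponent N F = Inf {p. 0 \<le> p \<and> kondratiev_finite N F p}"

text \<open>The Wick product, for coefficients multiplied by \<open>m\<close>.\<close>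

definition wick_product ::
  "('q \<Rightarrow> 'x \<Rightarrow> 'y::comm_monoid_add) \<Rightarrow> (multi_index \<Rightarrow> 'q) \<Rightarrow> (multi_index \<Rightarrow> 'x)
   \<Rightarrow> multi_index \<Rightarrow> 'y" where
  "wick_product m q u \<gamma> = (\<Sum>(\<alpha>, \<beta>)\<in>{(\<alpha>, \<beta>). \<alpha> + \<beta> = \<gamma>}. m (q \<alpha>) (u \<beta>))"

text \<open>At the end point \<open>t = T\<close> the time derivative is the left derivative.\<close>

definition solves_wick_ivp ::
  "(('a::euclidean_space, 'k::{real_normed_field,banach,second_countable_topology}) L2
      \<Rightarrow> ('a, 'k) L2) \<Rightarrow> real \<Rightarrow> (multi_index \<Rightarrow> ('a, 'k) Linf)
   \<Rightarrow> (multi_index \<Rightarrow> real \<Rightarrow> ('a, 'k) L2) \<Rightarrow> (multi_index \<Rightarrow> ('a, 'k) L2)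
   \<Rightarrow> (multi_index \<Rightarrow> real \<Rightarrow> ('a, 'k) L2) \<Rightarrow> bool" where
  "solves_wick_ivp L T q f g u \<longleftrightarrow>
     (\<forall>\<gamma>. (\<forall>t\<in>{0<..T}. \<exists>u'. (u \<gamma> has_vector_derivative u') (at t within {0..T}) \<and>
              (u' - L (u \<gamma> t)) + wick_product Linf_mult q (\<lambda>\<beta>. u \<beta> t) \<gamma> = f \<gamma> t) \<and>
          u \<gamma> 0 = g \<gamma>)"

end

theory Submission
  imports Defs
begin

text \<open>The coefficients of the solution form a system that is triangular in the order of the
  multi-index. In the equation for \<open>u \<gamma>\<close> the Wick product contributes \<open>q 0 * u \<gamma>\<close>, a bounded
  perturbation of the generator, and products \<open>q \<alpha> * u \<beta>\<close> with \<open>\<alpha> \<noteq> 0\<close>, in which \<open>\<beta>\<close> has smaller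
  order. So each coefficient solves one linear evolution equation with a known source, and existence
  and uniqueness of the whole family follow by recursion on the order
  (\<open>wick_solution_exists\<close>, \<open>wick_solution_unique\<close>). What remains is the theory of that one equation
  and the summability of the family.

  The equation \<open>u' = A u - B u + f\<close>, with \<open>A\<close> the generator, \<open>B\<close> bounded, \<open>f\<close> absolutely
  continuous and \<open>u 0\<close> in the domain of \<open>A\<close>, has a continuously differentiable solution
  (\<open>classical_solution_exists\<close>): the mild form of the differentiated equation is solved by a
  contraction argument, and its solution is integrated. In particular the solution is absolutely
  continuous, so it is an admissible part of the source of the later equations. Duhamel's formula and
  Gronwall's inequality bound every solution by the semigroup growth with the rate \<open>w\<close> replaced by
  \<open>w + M * norm B\<close> (\<open>classical_solution_bound\<close>). Uniqueness, summability and the explicit estimate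
  are all consequences of this one bound.

  For summability, the bound gives \<open>U \<gamma> \<le> b \<gamma> + c * (\<Sum> U \<beta>)\<close> for the sup norms \<open>U \<gamma>\<close> of the
  coefficients, the sum being over all \<open>\<beta>\<close> below \<open>\<gamma>\<close> and different from it. Multiplied by the weight
  of exponent \<open>- s\<close>, this is a convolution inequality with factor \<open>c\<close> times the total weight of the
  nonzero multi-indices. That total weight tends to \<open>0\<close> as \<open>s\<close> grows, so for large \<open>s\<close> the
  convolution term can be absorbed into the left-hand side (\<open>convolution_bound_summable\<close>). This
  works for every \<open>c\<close>, at the price of a larger exponent, which the union over all exponents in
  the Kondratiev space allows.

  For the explicit estimate, the bound is iterated. Expanding the recursion
  \<open>E \<gamma> = a \<gamma> + m * (\<Sum> norm (q \<alpha>) * E \<beta>)\<close> over the splittings of \<open>\<gamma>\<close> produces the sum over ordered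
  decompositions into \<open>k\<close> nonzero parts with the factor \<open>m ^ k\<close> (\<open>chaos_bound_recursion\<close>).\<close>

section \<open>Differentiation and limits of Bochner integrals\<close>

text \<open>Dominated convergence applies to difference quotients, not to the
  normalised remainder that defines the derivative.\<close>

lemma has_vector_derivative_iff_quotient:
  "(f has_vector_derivative d) (at x within A) \<longleftrightarrow>
     ((\<lambda>y. (f y - f x) /\<^sub>R (y - x)) \<longlongrightarrow> d) (at x within A)"
proof -
  have "norm ((1 / norm (y - x)) *\<^sub>R (f y - (f x + (y - x) *\<^sub>R d)))
      = norm ((f y - f x) /\<^sub>R (y - x) - d)" if "y \<noteq> x" for y
  proof -
    have "(f y - f x) /\<^sub>R (y - x) - d = inverse (y - x) *\<^sub>R (f y - (f x + (y - x) *\<^sub>R d))"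
      using that by (simp add: scaleR_diff_right scaleR_add_right)
    then show ?thesis by (simp add: divide_inverse)
  qed
  then have ev: "\<forall>\<^sub>F y in at x within A. norm ((1 / norm (y - x)) *\<^sub>R (f y - (f x + (y - x) *\<^sub>R d)))
      = norm ((f y - f x) /\<^sub>R (y - x) - d)"
    by (auto simp: eventually_at_filter)
  show ?thesis
    unfolding has_vector_derivative_def has_derivative_within
    by (subst tendsto_norm_zero_iff[symmetric], subst tendsto_cong[OF ev],
        simp add: tendsto_norm_zero_iff LIM_zero_iff bounded_linear_scaleR_left)
qed

lemma difference_quotient_swap:
  fixes p q :: "'a::real_vector"
  shows "(p - q) /\<^sub>R (y - t) = (q - p) /\<^sub>R (t - y)"
proof -
  have "(q - p) /\<^sub>R (t - y) = (- (p - q)) /\<^sub>R (- (y - t))" by simp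
  also have "\<dots> = (p - q) /\<^sub>R (y - t)"
    by (simp only: inverse_minus_eq scaleR_minus_left scaleR_minus_right minus_minus)
  finally show ?thesis by (rule sym)
qed

lemma tendsto_integral_at_within:
  fixes s :: "'t::first_countable_topology \<Rightarrow> 'a \<Rightarrow> 'b::{banach,second_countable_topology}"
  assumes f: "f \<in> borel_measurable N" and s: "\<And>y. s y \<in> borel_measurable N"
    and w: "integrable N w"
    and lim: "AE x in N. ((\<lambda>y. s y x) \<longlongrightarrow> f x) (at t within A)"
    and bound: "\<And>y. y \<in> A \<Longrightarrow> y \<noteq> t \<Longrightarrow> AE x in N. norm (s y x) \<le> w x"
  shows "((\<lambda>y. integral\<^sup>L N (s y)) \<longlongrightarrow> integral\<^sup>L N f) (at t within A)"
  unfolding tendsto_at_iff_sequentially comp_def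
proof (intro allI impI)
  fix X assume X: "\<forall>i. X i \<in> A - {t}" "X \<longlonglongrightarrow> t"
  show "(\<lambda>i. integral\<^sup>L N (s (X i))) \<longlonglongrightarrow> integral\<^sup>L N f"
  proof (rule integral_dominated_convergence[OF f s w])
    show "AE x in N. (\<lambda>i. s (X i) x) \<longlonglongrightarrow> f x"
      using lim by eventually_elim (use X in \<open>simp add: tendsto_at_iff_sequentially comp_def\<close>)
    show "AE x in N. norm (s (X i) x) \<le> w x" for i
      using X bound[of "X i"] by auto
  qed
qed

text \<open>Local boundedness of the norms upgrades strong continuity to joint
  continuity, through \<open>P r x - P r0 x0 = P r (x - x0) + (P r x0 - P r0 x0)\<close>. Joint continuity is
  what makes \<open>s \<mapsto> P (t - s) (\<phi> s)\<close> measurable for measurable \<open>\<phi>\<close>.\<close>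

lemma continuous_on_operator_family:
  fixes P :: "'t::topological_space \<Rightarrow> 'a::real_normed_vector \<Rightarrow> 'b::real_normed_vector"
  assumes diff: "\<And>r x y. P r (x - y) = P r x - P r y"
    and bound: "\<And>r x. norm (P r x) \<le> c r * norm x"
    and c: "continuous_on UNIV c" and P: "\<And>x. continuous_on UNIV (\<lambda>r. P r x)"
  shows "continuous_on UNIV (\<lambda>p. P (fst p) (snd p))"
  unfolding continuous_on_def
proof
  fix p :: "'t \<times> 'a"
  have fst: "(fst \<longlongrightarrow> fst p) (at p)" and snd: "(snd \<longlongrightarrow> snd p) (at p)"
    by (auto intro!: tendsto_intros)
  have ct: "((\<lambda>q. c (fst q)) \<longlongrightarrow> c (fst p)) (at p)"
    using continuous_on_tendsto_compose[OF c fst] by simp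
  have Pt: "((\<lambda>q. P (fst q) (snd p)) \<longlongrightarrow> P (fst p) (snd p)) (at p)"
    using continuous_on_tendsto_compose[OF P fst] by simp
  have "((\<lambda>q. P (fst q) (snd q - snd p)) \<longlongrightarrow> 0) (at p)"
  proof (rule Lim_null_comparison)
    show "\<forall>\<^sub>F q in at p. norm (P (fst q) (snd q - snd p)) \<le> c (fst q) * norm (snd q - snd p)"
      using bound by simp
    have "((\<lambda>q. c (fst q) * norm (snd q - snd p)) \<longlongrightarrow> c (fst p) * norm (snd p - snd p)) (at p)"
      by (intro tendsto_intros ct snd)
    then show "((\<lambda>q. c (fst q) * norm (snd q - snd p)) \<longlongrightarrow> 0) (at p)" by simp
  qed
  from tendsto_add[OF this Pt]
  show "((\<lambda>p. P (fst p) (snd p)) \<longlongrightarrow> P (fst p) (snd p)) (at p within UNIV)"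
    by (simp add: diff)
qed

lemma borel_measurable_operator_family:
  fixes P :: "real \<Rightarrow> 'a::{second_countable_topology,real_normed_vector}
    \<Rightarrow> 'b::{second_countable_topology,real_normed_vector}"
  assumes P: "continuous_on UNIV (\<lambda>p. P (fst p) (snd p))" and \<phi>: "\<phi> \<in> borel_measurable lborel"
  shows "(\<lambda>s. P (t - s) (\<phi> s)) \<in> borel_measurable lborel"
proof -
  have "(\<lambda>s. (t - s, \<phi> s)) \<in> borel_measurable lborel"
    using \<phi> by (intro borel_measurable_Pair) auto
  from measurable_compose[OF this borel_measurable_continuous_onI[OF P]]
  show ?thesis by simp
qed

text \<open>The mean of \<open>z\<close> over a short interval that ends at \<open>t\<close> is close to
  \<open>z t\<close> by continuity; only the norm bound for Bochner integrals enters, so the values may lie in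
  any separable Banach space.\<close>

lemma has_vector_derivative_LINT:
  fixes z :: "real \<Rightarrow> 'x::{banach,second_countable_topology}"
  assumes z: "continuous_on {0..T} z" and t: "t \<in> {0..T}"
  shows "((\<lambda>t. LINT s:{0..t}|lborel. z s) has_vector_derivative z t) (at t within {0..T})"
  unfolding has_vector_derivative_iff_quotient tendsto_iff
proof (intro allI impI)
  fix e :: real assume e: "0 < e"
  obtain d where d: "0 < d" "\<And>s. s \<in> {0..T} \<Longrightarrow> dist s t < d \<Longrightarrow> dist (z s) (z t) < e / 2"
    using z[unfolded continuous_on_iff, rule_format, OF t, of "e / 2"] e by auto
  have int: "set_integrable lborel A z" if "A \<in> sets borel" "A \<subseteq> {0..T}" for A
  proof (rule set_integrable_subset)
    show "set_integrable lborel {0..T} z"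
      using borel_integrable_compact[OF compact_Icc z] by (simp add: set_integrable_def)
  qed (use that in auto)
  have diff: "(LINT s:{0..b}|lborel. z s) - (LINT s:{0..a}|lborel. z s) = (LINT s:{a<..b}|lborel. z s)"
    if "0 \<le> a" "a \<le> b" "b \<le> T" for a b
  proof -
    have eq: "{0..b} = {0..a} \<union> {a<..b}" using that by auto
    have "(LINT s:{0..b}|lborel. z s) = (LINT s:{0..a}|lborel. z s) + (LINT s:{a<..b}|lborel. z s)"
      unfolding eq
    proof (rule set_integral_Un)
      show "set_integrable lborel {0..a} z" by (rule int) (use that in auto)
      show "set_integrable lborel {a<..b} z" by (rule int) (use that in auto)
    qed auto
    then show ?thesis by (metis add_diff_cancel_left')
  qed
  have near: "norm ((LINT s:{a<..b}|lborel. z s) - (b - a) *\<^sub>R z t) \<le> (b - a) * (e / 2)"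
    if ab: "0 \<le> a" "a \<le> b" "b \<le> T" "{a..b} \<subseteq> ball t d" for a b
  proof -
    have c: "set_integrable lborel {a<..b} (\<lambda>s. c)" for c :: 'x
      using ab by (simp add: set_integrable_def)
    have "(b - a) *\<^sub>R z t = (LINT s:{a<..b}|lborel. z t)"
      using ab by (simp add: set_lebesgue_integral_def)
    then have "norm ((LINT s:{a<..b}|lborel. z s) - (b - a) *\<^sub>R z t)
        = norm (LINT s:{a<..b}|lborel. z s - z t)"
      using ab by (subst set_integral_diff) (auto intro!: int c)
    also have "\<dots> \<le> (LINT s:{a<..b}|lborel. norm (z s - z t))"
      using ab by (intro set_integral_norm_bound set_integral_diff int c) auto
    also have "\<dots> \<le> (LINT s:{a<..b}|lborel. e / 2)"
    proof (rule set_integral_mono)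
      show "set_integrable lborel {a<..b} (\<lambda>s. norm (z s - z t))"
        using ab by (intro set_integrable_norm set_integral_diff int c) auto
      show "set_integrable lborel {a<..b} (\<lambda>s. e / 2)"
        using ab by (simp add: set_integrable_def)
      fix s assume s: "s \<in> {a<..b}"
      then have "s \<in> {a..b}" by auto
      then have "dist s t < d" "s \<in> {0..T}" using ab by (auto simp: dist_commute)
      then show "norm (z s - z t) \<le> e / 2"
        using d(2)[of s] by (simp add: dist_norm)
    qed
    also have "\<dots> = (b - a) * (e / 2)"
      using ab by (simp add: set_lebesgue_integral_def)
    finally show ?thesis .
  qed
  have "dist (((LINT s:{0..y}|lborel. z s) - (LINT s:{0..t}|lborel. z s)) /\<^sub>R (y - t)) (z t) < e"
    if y: "y \<in> {0..T}" "y \<noteq> t" "dist y t < d" for y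
  proof -
    define a b where "a = min y t" and "b = max y t"
    have ab: "0 \<le> a" "a < b" "b \<le> T" "{a..b} \<subseteq> ball t d"
    proof -
      show "0 \<le> a" "b \<le> T" using y t by (auto simp: a_def b_def)
      show "a < b" using y by (auto simp: a_def b_def)
      have "\<bar>t - s\<bar> < d" if "a \<le> s" "s \<le> b" for s
        using that y(3) d(1) unfolding a_def b_def dist_real_def by linarith
      then show "{a..b} \<subseteq> ball t d" by (auto simp: dist_real_def)
    qed
    have "((LINT s:{0..y}|lborel. z s) - (LINT s:{0..t}|lborel. z s)) /\<^sub>R (y - t)
        = ((LINT s:{0..b}|lborel. z s) - (LINT s:{0..a}|lborel. z s)) /\<^sub>R (b - a)"
    proof (cases "y \<le> t")
      case True
      then show ?thesis
        by (subst difference_quotient_swap) (simp add: a_def b_def min_def max_def)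
    next
      case False
      then show ?thesis by (simp add: a_def b_def min_def max_def)
    qed
    also have "\<dots> - z t = ((LINT s:{a<..b}|lborel. z s) - (b - a) *\<^sub>R z t) /\<^sub>R (b - a)"
      using ab by (subst diff) (auto simp: scaleR_diff_right)
    also have "norm \<dots> \<le> ((b - a) * (e / 2)) / (b - a)"
    proof -
      have "norm (((LINT s:{a<..b}|lborel. z s) - (b - a) *\<^sub>R z t) /\<^sub>R (b - a))
          = norm ((LINT s:{a<..b}|lborel. z s) - (b - a) *\<^sub>R z t) / (b - a)"
        using ab by (simp add: divide_inverse mult.commute)
      then show ?thesis
        using ab by (simp only:) (intro divide_right_mono near, auto)
    qed
    also have "\<dots> = e / 2"
      by (rule nonzero_mult_div_cancel_left) (use ab in simp)
    finally show ?thesis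
      using e unfolding dist_norm by linarith
  qed
  then show "\<forall>\<^sub>F y in at t within {0..T}.
      dist (((LINT s:{0..y}|lborel. z s) - (LINT s:{0..t}|lborel. z s)) /\<^sub>R (y - t)) (z t) < e"
    unfolding eventually_at using d(1) by blast
qed

lemma LINT_derivative:
  fixes z :: "real \<Rightarrow> 'x::{banach,second_countable_topology}"
  assumes u: "\<And>t. t \<in> {0..T} \<Longrightarrow> (u has_vector_derivative z t) (at t within {0..T})"
    and z: "continuous_on {0..T} z" and t: "t \<in> {0..T}"
  shows "(LINT s:{0..t}|lborel. z s) = u t - u 0"
proof -
  let ?F = "\<lambda>t. LINT s:{0..t}|lborel. z s"
  have der: "((\<lambda>t. ?F t - u t) has_vector_derivative 0) (at s within {0..T})" if "s \<in> {0..T}" for s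
    using has_vector_derivative_diff[OF has_vector_derivative_LINT[OF z that] u[OF that]] by simp
  have "?F t - u t = ?F 0 - u 0"
    by (rule has_derivative_zero_unique[of "{0..T}" "\<lambda>t. ?F t - u t"])
       (use der t in \<open>auto simp: has_vector_derivative_def\<close>)
  moreover have "?F 0 = 0"
    unfolding set_lebesgue_integral_def
  proof (rule integral_eq_zero_AE)
    show "AE s in lborel. indicator {0..0} s *\<^sub>R z s = 0"
      using AE_lborel_singleton[of 0] by eventually_elim (auto simp: indicator_def)
  qed
  ultimately show ?thesis by (simp add: algebra_simps)
qed

section \<open>Strongly continuous semigroups and their integrated orbits\<close>

text \<open>The linear evolution equation is solved for an arbitrary semigroup on a
  separable Banach space. Separability is there for the measurability of
  \<open>s \<mapsto> S (t - s) (\<phi> s)\<close>.\<close>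

locale C0_semigroup_growth =
  fixes S :: "real \<Rightarrow> 'x::{banach,second_countable_topology} \<Rightarrow> 'x" and M w :: real
  assumes bounded_linear_S: "0 \<le> t \<Longrightarrow> bounded_linear (S t)"
    and S_0: "S 0 x = x"
    and S_add: "0 \<le> s \<Longrightarrow> 0 \<le> t \<Longrightarrow> S (s + t) x = S s (S t x)"
    and S_right_continuous: "((\<lambda>t. S t x) \<longlongrightarrow> x) (at_right 0)"
    and norm_S_le: "0 \<le> t \<Longrightarrow> norm (S t x) \<le> M * exp (w * t) * norm x"
    and M_pos: "0 < M"
begin

text \<open>The absolute values make this a bound on all \<open>S t\<close> with \<open>0 \<le> t \<le> r\<close>
  whatever the sign of \<open>w\<close>, and a continuous one for the extension \<open>t \<mapsto> S (max 0 t)\<close> of the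
  semigroup to the whole line.\<close>

definition growth :: "real \<Rightarrow> real" where
  "growth r = M * exp (\<bar>w\<bar> * \<bar>r\<bar>)"

lemma growth_pos [simp]: "0 < growth r" "0 \<le> growth r"
  using M_pos by (auto simp: growth_def)

lemma growth_mono: "0 \<le> r \<Longrightarrow> r \<le> R \<Longrightarrow> growth r \<le> growth R"
  using M_pos by (auto simp: growth_def intro!: mult_left_mono)

lemma continuous_growth: "continuous_on UNIV growth"
  unfolding growth_def by (intro continuous_intros)

lemma norm_S_growth: "0 \<le> t \<Longrightarrow> t \<le> R \<Longrightarrow> norm (S t x) \<le> growth R * norm x"
proof -
  assume t: "0 \<le> t" "t \<le> R"
  have "w * t \<le> \<bar>w\<bar> * \<bar>R\<bar>"
    using t mult_mono[of w "\<bar>w\<bar>" t "\<bar>R\<bar>"] by linarith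
  then have "M * exp (w * t) * norm x \<le> growth R * norm x"
    using M_pos by (auto simp: growth_def intro!: mult_right_mono)
  then show ?thesis using norm_S_le[OF t(1), of x] by linarith
qed

lemma S_diff: "0 \<le> t \<Longrightarrow> S t (x - y) = S t x - S t y"
  by (simp add: bounded_linear_S linear_diff bounded_linear.linear)

lemma S_plus: "0 \<le> t \<Longrightarrow> S t (x + y) = S t x + S t y"
  by (simp add: bounded_linear_S linear_add bounded_linear.linear)

lemma S_scaleR: "0 \<le> t \<Longrightarrow> S t (r *\<^sub>R x) = r *\<^sub>R S t x"
  by (simp add: bounded_linear_S linear_scale bounded_linear.linear)

lemma S_zero: "0 \<le> t \<Longrightarrow> S t 0 = 0"
  using S_diff[of t 0 0] by simp

lemma norm_S_diff_le:
  assumes "0 \<le> s" "s \<le> t" "s \<le> R"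
  shows "norm (S t x - S s x) \<le> growth R * norm (S (t - s) x - x)"
proof -
  have "S t x - S s x = S s (S (t - s) x - x)"
    using assms S_add[of s "t - s" x] by (simp add: S_diff)
  then show ?thesis using norm_S_growth[of s R] assms by simp
qed

text \<open>Right continuity at \<open>0\<close> gives continuity from both sides everywhere: for
  \<open>a \<le> b\<close> the difference \<open>S b x - S a x\<close> is \<open>S a\<close> applied to \<open>S (b - a) x - x\<close>.\<close>

lemma continuous_orbit: "continuous_on UNIV (\<lambda>t. S (max 0 t) x)"
  unfolding continuous_on_iff
proof (intro ballI allI impI)
  fix t e :: real assume e: "0 < e"
  define R where "R = \<bar>t\<bar> + 1"
  define e' where "e' = e / growth R"
  have e': "0 < e'" using e by (simp add: e'_def)
  have "\<forall>\<^sub>F h in at_right 0. dist (S h x) x < e'"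
    using S_right_continuous[of x] e' by (simp add: tendsto_iff)
  then obtain d where d: "0 < d" "\<And>h. 0 < h \<Longrightarrow> h < d \<Longrightarrow> dist (S h x) x < e'"
    unfolding eventually_at_right_field by auto
  have small: "norm (S h x - x) < e'" if "0 \<le> h" "h < d" for h
    using d(2)[of h] that e' S_0[of x] by (cases "h = 0") (auto simp: dist_norm)
  have "dist (S (max 0 s) x) (S (max 0 t) x) < e" if s: "dist s t < min d 1" for s
  proof -
    define a b where "a = min (max 0 s) (max 0 t)" and "b = max (max 0 s) (max 0 t)"
    have ab: "0 \<le> a" "a \<le> b" "a \<le> R" "b - a < d" "0 \<le> b - a"
      using s d by (auto simp: a_def b_def R_def dist_real_def)
    have "dist (S (max 0 s) x) (S (max 0 t) x) = norm (S b x - S a x)"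
      by (auto simp: a_def b_def min_def max_def dist_norm norm_minus_commute)
    also have "\<dots> \<le> growth R * norm (S (b - a) x - x)"
      using ab by (intro norm_S_diff_le)
    also have "\<dots> < growth R * e'"
      using small[of "b - a"] ab by simp
    also have "\<dots> = e" using less_imp_neq[OF growth_pos(1)[of R]] by (simp add: e'_def)
    finally show ?thesis .
  qed
  then show "\<exists>d>0. \<forall>s\<in>UNIV. dist s t < d \<longrightarrow> dist (S (max 0 s) x) (S (max 0 t) x) < e"
    using d(1) by (intro exI[of _ "min d 1"]) auto
qed

lemma continuous_orbit_on: "A \<subseteq> {0..} \<Longrightarrow> continuous_on A (\<lambda>t. S t x)"
  by (rule continuous_on_eq[OF continuous_on_subset[OF continuous_orbit[of x]]]) auto

lemma continuous_S: "continuous_on UNIV (\<lambda>p. S (max 0 (fst p)) (snd p))"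
proof (rule continuous_on_operator_family)
  show "norm (S (max 0 r) x) \<le> growth r * norm x" for r x
    using norm_S_growth[of "max 0 r" "\<bar>r\<bar>" x] by (simp add: growth_def)
qed (auto simp: S_diff continuous_growth continuous_orbit)

lemma tendsto_S:
  assumes "(\<tau> \<longlongrightarrow> t) F" "(v \<longlongrightarrow> x) F" "\<forall>\<^sub>F y in F. 0 \<le> \<tau> y" "0 \<le> t"
  shows "((\<lambda>y. S (\<tau> y) (v y)) \<longlongrightarrow> S t x) F"
proof -
  have "((\<lambda>y. S (max 0 (\<tau> y)) (v y)) \<longlongrightarrow> S (max 0 t) x) F"
    using continuous_on_tendsto_compose[OF continuous_S tendsto_Pair[OF assms(1,2)]] by simp
  moreover have "\<forall>\<^sub>F y in F. S (max 0 (\<tau> y)) (v y) = S (\<tau> y) (v y)"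
    using assms(3) by eventually_elim simp
  ultimately show ?thesis
    using assms(4) tendsto_cong by fastforce
qed

text \<open>The graph of the generator. As a relation it needs no value of the generator
  outside its domain.\<close>

definition in_generator :: "'x \<Rightarrow> 'x \<Rightarrow> bool" where
  "in_generator x y \<longleftrightarrow> ((\<lambda>h. (S h x - x) /\<^sub>R h) \<longlongrightarrow> y) (at_right 0)"

lemma in_generator_add:
  assumes "in_generator x y" "in_generator x' y'"
  shows "in_generator (x + x') (y + y')"
proof -
  have ev: "\<forall>\<^sub>F h in at_right 0. (S h x - x) /\<^sub>R h + (S h x' - x') /\<^sub>R h
      = (S h (x + x') - (x + x')) /\<^sub>R h"
    by (auto simp: eventually_at_filter S_plus algebra_simps)
  show ?thesis
    using tendsto_add[OF assms[unfolded in_generator_def]] tendsto_cong[OF ev]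
    unfolding in_generator_def by blast
qed

lemma in_generator_uminus: "in_generator x y \<Longrightarrow> in_generator (- x) (- y)"
proof -
  assume "in_generator x y"
  then have *: "((\<lambda>h. - ((S h x - x) /\<^sub>R h)) \<longlongrightarrow> - y) (at_right 0)"
    unfolding in_generator_def by (rule tendsto_minus)
  have ev: "\<forall>\<^sub>F h in at_right 0. - ((S h x - x) /\<^sub>R h) = (S h (- x) - (- x)) /\<^sub>R h"
    using S_scaleR[of _ "-1" x] by (auto simp: eventually_at_filter algebra_simps)
  show ?thesis
    using * tendsto_cong[OF ev] unfolding in_generator_def by blast
qed

lemma in_generator_diff:
  "in_generator x y \<Longrightarrow> in_generator x' y' \<Longrightarrow> in_generator (x - x') (y - y')"
  using in_generator_add[of x y "- x'" "- y'"] in_generator_uminus[of x' y'] by simp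

text \<open>The quotient from the right is \<open>S t\<close> applied to the quotient at
  \<open>0\<close>. From the left it is \<open>S s\<close> applied to it, with \<open>s\<close> varying, and joint continuity is
  needed.\<close>

lemma orbit_has_vector_derivative:
  assumes x: "in_generator x y" and t: "0 < t"
  shows "((\<lambda>t. S t x) has_vector_derivative S t y) (at t)"
proof -
  have q: "((\<lambda>h. (S h x - x) /\<^sub>R h) \<longlongrightarrow> y) (at_right 0)"
    using x by (simp add: in_generator_def)
  have r: "((\<lambda>s. (S s x - S t x) /\<^sub>R (s - t)) \<longlongrightarrow> S t y) (at_right t)"
  proof -
    have "filterlim (\<lambda>s. s - t) (at_right 0) (at_right t)"
      by (auto simp: filterlim_at eventually_at_filter intro!: tendsto_eq_intros)
    from filterlim_compose[OF q this]
    have "((\<lambda>s. S t ((S (s - t) x - x) /\<^sub>R (s - t))) \<longlongrightarrow> S t y) (at_right t)"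
      using t by (intro tendsto_S tendsto_const) auto
    moreover have "\<forall>\<^sub>F s in at_right t. S t ((S (s - t) x - x) /\<^sub>R (s - t)) = (S s x - S t x) /\<^sub>R (s - t)"
      unfolding eventually_at_filter
    proof (intro always_eventually allI impI)
      fix s assume "s \<noteq> t" "s \<in> {t<..}"
      then show "S t ((S (s - t) x - x) /\<^sub>R (s - t)) = (S s x - S t x) /\<^sub>R (s - t)"
        using t S_add[of t "s - t" x] by (simp add: S_scaleR S_diff)
    qed
    ultimately show ?thesis by (rule Lim_transform_eventually)
  qed
  have l: "((\<lambda>s. (S s x - S t x) /\<^sub>R (s - t)) \<longlongrightarrow> S t y) (at_left t)"
  proof -
    have "filterlim (\<lambda>s. t - s) (at_right 0) (at_left t)"
      by (auto simp: filterlim_at eventually_at_filter intro!: tendsto_eq_intros)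
    from filterlim_compose[OF q this]
    have "((\<lambda>s. S s ((S (t - s) x - x) /\<^sub>R (t - s))) \<longlongrightarrow> S t y) (at_left t)"
      using t eventually_at_left_real[OF t]
      by (intro tendsto_S tendsto_const) (auto elim: eventually_mono)
    moreover have "\<forall>\<^sub>F s in at_left t. S s ((S (t - s) x - x) /\<^sub>R (t - s)) = (S s x - S t x) /\<^sub>R (s - t)"
      using eventually_at_left_real[OF t]
    proof eventually_elim
      case (elim s)
      then have "S s ((S (t - s) x - x) /\<^sub>R (t - s)) = (S t x - S s x) /\<^sub>R (t - s)"
        using S_add[of s "t - s" x] by (simp add: S_scaleR S_diff)
      also have "\<dots> = (S s x - S t x) /\<^sub>R (s - t)"
        by (rule difference_quotient_swap)
      finally show ?case .
    qed
    ultimately show ?thesis by (rule Lim_transform_eventually)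
  qed
  show ?thesis
    unfolding has_vector_derivative_iff_quotient using filterlim_split_at[OF l r] .
qed

text \<open>For \<open>r \<le> 0\<close> this is \<open>0\<close>, so the family is Lipschitz in \<open>r\<close> on the whole line
  and differentiable except at \<open>0\<close>. A convolution with it can therefore be written as an integral
  over a fixed domain.\<close>

definition orbit_integral :: "real \<Rightarrow> 'x \<Rightarrow> 'x" where
  "orbit_integral r x = integral {0..r} (\<lambda>s. S s x)"

lemma orbit_integral_neg: "r \<le> 0 \<Longrightarrow> orbit_integral r x = 0"
  by (cases "r = 0") (auto simp: orbit_integral_def)

lemma S_integrable: "0 \<le> a \<Longrightarrow> (\<lambda>s. S s x) integrable_on {a..b}"
  by (intro integrable_continuous_real continuous_orbit_on) auto

lemma orbit_integral_split:
  assumes "0 \<le> a" "a \<le> b"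
  shows "orbit_integral b x - orbit_integral a x = integral {a..b} (\<lambda>s. S s x)"
  using Henstock_Kurzweil_Integration.integral_combine[OF assms S_integrable[of 0 x b]]
  by (simp add: orbit_integral_def algebra_simps)

lemma orbit_integral_lipschitz:
  assumes "a \<le> R" "b \<le> R"
  shows "norm (orbit_integral b x - orbit_integral a x) \<le> growth R * norm x * \<bar>b - a\<bar>"
proof -
  have *: "norm (orbit_integral b x - orbit_integral a x) \<le> growth R * norm x * (b - a)"
    if "0 \<le> a" "a \<le> b" "b \<le> R" for a b
    unfolding orbit_integral_split[OF that(1,2)] using that
    by (intro integral_bound continuous_orbit_on) (auto intro: norm_S_growth)
  have **: "norm (orbit_integral b x - orbit_integral a x) \<le> growth R * norm x * (b - a)"
    if "a \<le> b" "b \<le> R" for a b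
  proof (cases "b \<le> 0")
    case True
    then show ?thesis using that by (simp add: orbit_integral_neg)
  next
    case False
    have "orbit_integral (max 0 a) x = orbit_integral a x"
      by (cases "a \<le> 0") (auto simp: orbit_integral_neg)
    then have "norm (orbit_integral b x - orbit_integral a x) \<le> growth R * norm x * (b - max 0 a)"
      using *[of "max 0 a" b] False that by auto
    also have "\<dots> \<le> growth R * norm x * (b - a)"
      by (intro mult_left_mono) auto
    finally show ?thesis .
  qed
  show ?thesis
    using **[of a b] **[of b a] assms by (cases "a \<le> b") (auto simp: norm_minus_commute)
qed

lemma norm_orbit_integral_le: "norm (orbit_integral r x) \<le> growth r * \<bar>r\<bar> * norm x"
proof -
  have "norm (orbit_integral r x) \<le> growth \<bar>r\<bar> * norm x * \<bar>r\<bar>"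
    using orbit_integral_lipschitz[of 0 "\<bar>r\<bar>" r x] by (simp add: orbit_integral_neg)
  also have "growth \<bar>r\<bar> = growth r" by (simp add: growth_def)
  finally show ?thesis by (simp add: ac_simps)
qed

lemma orbit_integral_diff: "orbit_integral r (x - y) = orbit_integral r x - orbit_integral r y"
proof -
  have "orbit_integral r (x - y) = integral {0..r} (\<lambda>s. S s x - S s y)"
    unfolding orbit_integral_def by (intro integral_cong) (auto simp: S_diff)
  then show ?thesis
    by (simp add: orbit_integral_def Henstock_Kurzweil_Integration.integral_diff S_integrable)
qed

lemma orbit_integral_has_vector_derivative:
  assumes "r \<noteq> 0"
  shows "((\<lambda>r. orbit_integral r x) has_vector_derivative (if 0 < r then S r x else 0)) (at r)"
proof (cases "0 < r")
  case True
  have "((\<lambda>u. integral {0..u} (\<lambda>s. S s x)) has_vector_derivative S r x) (at r within {0..r + 1})"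
    using True by (intro integral_has_vector_derivative continuous_orbit_on) auto
  moreover have "at r within {0..r + 1} = at r"
    using True by (intro at_within_interior) (auto simp: interior_atLeastAtMost_real)
  ultimately show ?thesis using True by (simp add: orbit_integral_def[abs_def])
next
  case False
  then have "r < 0" using assms by simp
  have "((\<lambda>r. 0) has_vector_derivative 0) (at r)" by simp
  then have "((\<lambda>r. orbit_integral r x) has_vector_derivative 0) (at r)"
    by (rule has_vector_derivative_transform_within_open[where S = "{..<0}"])
       (use \<open>r < 0\<close> in \<open>auto simp: orbit_integral_neg\<close>)
  then show ?thesis using False by simp
qed

lemma continuous_orbit_integral: "continuous_on UNIV (\<lambda>p. orbit_integral (fst p) (snd p))"
proof (rule continuous_on_operator_family[where c = "\<lambda>r. growth r * \<bar>r\<bar>"])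
  show "continuous_on UNIV (\<lambda>r. orbit_integral r x)" for x
    unfolding continuous_on_def
  proof
    fix r :: real
    define R where "R = \<bar>r\<bar> + 1"
    have "((\<lambda>s. growth R * norm x * \<bar>s - r\<bar>) \<longlongrightarrow> growth R * norm x * \<bar>r - r\<bar>) (at r)"
      by (intro tendsto_intros)
    then have "((\<lambda>s. growth R * norm x * \<bar>s - r\<bar>) \<longlongrightarrow> 0) (at r)" by simp
    moreover have "\<forall>\<^sub>F s in at r. norm (orbit_integral s x - orbit_integral r x) \<le> growth R * norm x * \<bar>s - r\<bar>"
      unfolding eventually_at
      by (intro exI[of _ 1]) (auto simp: R_def dist_real_def intro!: orbit_integral_lipschitz)
    ultimately have "((\<lambda>s. orbit_integral s x - orbit_integral r x) \<longlongrightarrow> 0) (at r)"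
      by (rule Lim_null_comparison[rotated])
    then show "((\<lambda>r. orbit_integral r x) \<longlongrightarrow> orbit_integral r x) (at r within UNIV)"
      by (simp add: LIM_zero_iff)
  qed
qed (auto simp: orbit_integral_diff norm_orbit_integral_le intro!: continuous_intros continuous_growth)

lemma S_orbit_integral:
  assumes "0 \<le> h" "0 \<le> r"
  shows "S h (orbit_integral r x) = orbit_integral (r + h) x - orbit_integral h x"
proof -
  have "S h (orbit_integral r x) = integral {0..r} (\<lambda>s. S h (S s x))"
    unfolding orbit_integral_def
    using integral_linear[OF S_integrable[of 0 x r] bounded_linear_S[OF assms(1)]]
    by (simp add: o_def)
  also have "\<dots> = integral {0..r} (\<lambda>s. S (s + h) x)"
    using assms by (intro integral_cong) (auto simp: S_add[symmetric] add.commute)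
  also have "\<dots> = integral {h..r + h} (\<lambda>s. S s x)"
    using integral_shift_real_ivl[of h h "r + h" "\<lambda>s. S s x"] by simp
  also have "\<dots> = orbit_integral (r + h) x - orbit_integral h x"
    using assms by (intro orbit_integral_split[symmetric]) auto
  finally show ?thesis .
qed

lemma generator_quotient_orbit_integral:
  assumes "0 < h" "0 \<le> r"
  shows "(S h (orbit_integral r x) - orbit_integral r x) /\<^sub>R h
    = (orbit_integral (r + h) x - orbit_integral r x) /\<^sub>R h - orbit_integral h x /\<^sub>R h"
  using S_orbit_integral[of h r x] assms
  by (simp add: scaleR_diff_right[symmetric] diff_diff_add add.commute)

lemma orbit_integral_quotient_tendsto:
  assumes "0 \<le> r"
  shows "((\<lambda>h. (orbit_integral (r + h) x - orbit_integral r x) /\<^sub>R h) \<longlongrightarrow> S r x) (at_right 0)"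
proof -
  have "((\<lambda>u. integral {0..u} (\<lambda>s. S s x)) has_vector_derivative S r x) (at r within {0..r + 1})"
    using assms by (intro integral_has_vector_derivative continuous_orbit_on) auto
  then have "((\<lambda>y. (orbit_integral y x - orbit_integral r x) /\<^sub>R (y - r)) \<longlongrightarrow> S r x) (at r within {0..r + 1})"
    by (simp add: has_vector_derivative_iff_quotient orbit_integral_def)
  moreover have "filterlim (\<lambda>h. r + h) (at r within {0..r + 1}) (at_right 0)"
  proof (rule filterlim_at_withinI)
    show "((\<lambda>h. r + h) \<longlongrightarrow> r) (at_right 0)" by (auto intro!: tendsto_eq_intros)
    show "\<forall>\<^sub>F h in at_right 0. r + h \<in> {0..r + 1} - {r}"
      using eventually_at_right_real[OF zero_less_one] assms by (auto elim: eventually_mono)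
  qed
  ultimately show ?thesis by (auto dest: filterlim_compose)
qed

text \<open>Time averages of orbits lie in the domain of the generator for every
  initial value.\<close>

lemma in_generator_orbit_integral:
  assumes "0 \<le> r"
  shows "in_generator (orbit_integral r x) (S r x - x)"
proof -
  have "((\<lambda>h. (orbit_integral (r + h) x - orbit_integral r x) /\<^sub>R h - (orbit_integral (0 + h) x - orbit_integral 0 x) /\<^sub>R h)
     \<longlongrightarrow> S r x - S 0 x) (at_right 0)"
    using assms by (intro tendsto_diff orbit_integral_quotient_tendsto) auto
  moreover have "\<forall>\<^sub>F h in at_right 0. (orbit_integral (r + h) x - orbit_integral r x) /\<^sub>R h - (orbit_integral (0 + h) x - orbit_integral 0 x) /\<^sub>R h
    = (S h (orbit_integral r x) - orbit_integral r x) /\<^sub>R h"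
    using assms by (auto simp: eventually_at_filter generator_quotient_orbit_integral orbit_integral_neg)
  ultimately show ?thesis
    unfolding in_generator_def S_0[of x] by (rule Lim_transform_eventually)
qed

end

section \<open>Convolution of a semigroup with an integrable source\<close>

lemma norm_quotient_le:
  fixes x :: "'a::real_normed_vector"
  assumes "norm x \<le> c * \<bar>h\<bar>" "h \<noteq> 0"
  shows "norm (x /\<^sub>R h) \<le> c"
proof -
  have "norm (x /\<^sub>R h) = norm x / \<bar>h\<bar>" by (simp add: divide_inverse mult.commute)
  then show ?thesis using assms by (simp add: pos_divide_le_eq)
qed

context C0_semigroup_growth
begin

text \<open>The convolution of the semigroup with a source. The integrand vanishes for \<open>t \<le> s\<close>,
  which keeps the domain of integration independent of \<open>t\<close>.\<close>

definition conv :: "(real \<Rightarrow> 'x) \<Rightarrow> real \<Rightarrow> 'x" where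
  "conv \<phi> t = (\<integral>s. (if s < t then S (max 0 (t - s)) (\<phi> s) else 0) \<partial>lborel)"

text \<open>This will be the antiderivative of \<open>conv \<phi>\<close> that vanishes at \<open>0\<close>. Writing
  it with the integrated semigroup, and not as an iterated integral, replaces Fubini's theorem by
  differentiation under the integral sign.\<close>

definition conv_primitive :: "(real \<Rightarrow> 'x) \<Rightarrow> real \<Rightarrow> 'x" where
  "conv_primitive \<phi> t = (\<integral>s. orbit_integral (t - s) (\<phi> s) \<partial>lborel)"

context
  fixes \<phi> :: "real \<Rightarrow> 'x"
  assumes \<phi>: "integrable lborel \<phi>" and \<phi>_neg: "\<And>s. s < 0 \<Longrightarrow> \<phi> s = 0"
begin

lemma measurable_conv [measurable]:
  "(\<lambda>s. if s < t then S (max 0 (t - s)) (\<phi> s) else 0) \<in> borel_measurable lborel"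
proof -
  have [measurable]: "(\<lambda>s. S (max 0 (t - s)) (\<phi> s)) \<in> borel_measurable lborel"
    using borel_measurable_operator_family[OF continuous_S, of \<phi>] \<phi> by simp
  show ?thesis by measurable
qed

lemma measurable_conv_primitive [measurable]:
  "(\<lambda>s. orbit_integral (t - s) (\<phi> s)) \<in> borel_measurable lborel"
  using borel_measurable_operator_family[OF continuous_orbit_integral, of \<phi>] \<phi> by simp

lemma norm_conv_integrand_le:
  assumes "t \<le> T"
  shows "norm (if s < t then S (max 0 (t - s)) (\<phi> s) else 0) \<le> growth T * norm (\<phi> s)"
  using assms \<phi>_neg[of s] norm_S_growth[of "t - s" T "\<phi> s"]
  by (cases "s < 0") (auto simp: S_zero)

lemma integrable_conv:
  "integrable lborel (\<lambda>s. if s < t then S (max 0 (t - s)) (\<phi> s) else 0)"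
proof (rule Bochner_Integration.integrable_bound[OF _ measurable_conv AE_I2])
  show "integrable lborel (\<lambda>s. growth t * norm (\<phi> s))" using \<phi> by auto
  show "norm (if s < t then S (max 0 (t - s)) (\<phi> s) else 0) \<le> norm (growth t * norm (\<phi> s))" for s
    using norm_conv_integrand_le[OF order_refl, of s t] by (simp only: real_norm_def abs_mult abs_norm_cancel abs_of_pos growth_pos)
qed

lemma integrable_conv_primitive: "integrable lborel (\<lambda>s. orbit_integral (t - s) (\<phi> s))"
proof (rule Bochner_Integration.integrable_bound[OF _ measurable_conv_primitive AE_I2])
  show "integrable lborel (\<lambda>s. growth t * \<bar>t\<bar> * norm (\<phi> s))"
    using \<phi> by auto
  fix s
  show "norm (orbit_integral (t - s) (\<phi> s)) \<le> norm (growth t * \<bar>t\<bar> * norm (\<phi> s))"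
  proof (cases "0 \<le> s \<and> s \<le> t")
    case True
    then have "growth (t - s) * \<bar>t - s\<bar> \<le> growth t * \<bar>t\<bar>"
      by (intro mult_mono growth_mono) auto
    then have "growth (t - s) * \<bar>t - s\<bar> * norm (\<phi> s) \<le> growth t * \<bar>t\<bar> * norm (\<phi> s)"
      by (rule mult_right_mono) auto
    then show ?thesis
      using norm_orbit_integral_le[of "t - s" "\<phi> s"] by auto
  next
    case False
    then have "orbit_integral (t - s) (\<phi> s) = 0"
      using \<phi>_neg[of s] norm_orbit_integral_le[of "t - s" 0]
      by (cases "s < 0") (auto simp: orbit_integral_neg)
    then show ?thesis by simp
  qed
qed

lemma continuous_conv: "continuous_on {0..T} (conv \<phi>)"
  unfolding continuous_on_def conv_def
proof
  fix t assume t: "t \<in> {0..T}"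
  show "((\<lambda>t. \<integral>s. (if s < t then S (max 0 (t - s)) (\<phi> s) else 0) \<partial>lborel)
     \<longlongrightarrow> (\<integral>s. (if s < t then S (max 0 (t - s)) (\<phi> s) else 0) \<partial>lborel)) (at t within {0..T})"
  proof (rule tendsto_integral_at_within[where w = "\<lambda>s. growth T * norm (\<phi> s)"])
    show "integrable lborel (\<lambda>s. growth T * norm (\<phi> s))" using \<phi> by auto
    have lim: "((\<lambda>y. if s < y then S (max 0 (y - s)) (\<phi> s) else 0)
        \<longlongrightarrow> (if s < t then S (max 0 (t - s)) (\<phi> s) else 0)) (at t within {0..T})" if "s \<noteq> t" for s
    proof (cases "s < t")
      case True
      have "((\<lambda>y. y - s) \<longlongrightarrow> t - s) (at t within {0..T})" by (intro tendsto_intros)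
      from continuous_on_tendsto_compose[OF continuous_orbit[of "\<phi> s"] this]
      have "((\<lambda>y. S (max 0 (y - s)) (\<phi> s)) \<longlongrightarrow> S (max 0 (t - s)) (\<phi> s)) (at t within {0..T})"
        by simp
      moreover have "\<forall>\<^sub>F y in at t within {0..T}. s < y"
        using True by (intro order_tendstoD[OF tendsto_ident_at])
      then have "\<forall>\<^sub>F y in at t within {0..T}. S (max 0 (y - s)) (\<phi> s)
          = (if s < y then S (max 0 (y - s)) (\<phi> s) else 0)"
        by eventually_elim simp
      ultimately have "((\<lambda>y. if s < y then S (max 0 (y - s)) (\<phi> s) else 0)
        \<longlongrightarrow> S (max 0 (t - s)) (\<phi> s)) (at t within {0..T})"
        by (rule Lim_transform_eventually)
      then show ?thesis using True by simp
    next
      case False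
      then have "\<forall>\<^sub>F y in at t within {0..T}. y < s"
        using that by (intro order_tendstoD[OF tendsto_ident_at]) auto
      then have "\<forall>\<^sub>F y in at t within {0..T}. 0 = (if s < y then S (max 0 (y - s)) (\<phi> s) else 0)"
        by eventually_elim simp
      then show ?thesis using False by (auto intro: Lim_transform_eventually[OF tendsto_const])
    qed
    show "AE s in lborel. ((\<lambda>y. if s < y then S (max 0 (y - s)) (\<phi> s) else 0)
        \<longlongrightarrow> (if s < t then S (max 0 (t - s)) (\<phi> s) else 0)) (at t within {0..T})"
      using AE_lborel_singleton[of t] by eventually_elim (rule lim)
    show "AE s in lborel. norm (if s < y then S (max 0 (y - s)) (\<phi> s) else 0) \<le> growth T * norm (\<phi> s)"
      if "y \<in> {0..T}" for y
      by (rule AE_I2, rule norm_conv_integrand_le) (use that in auto)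
  qed auto
qed

text \<open>The integrand is Lipschitz in \<open>t\<close> with constant
  \<open>growth T * norm (\<phi> s)\<close> and differentiable for \<open>s \<noteq> t\<close>. Dominated convergence then needs the
  source to be integrable and nothing more.\<close>

lemma conv_primitive_has_vector_derivative:
  assumes t: "t \<in> {0..T}"
  shows "(conv_primitive \<phi> has_vector_derivative conv \<phi> t) (at t within {0..T})"
  unfolding has_vector_derivative_iff_quotient
proof -
  have "((\<lambda>y. \<integral>s. (orbit_integral (y - s) (\<phi> s) - orbit_integral (t - s) (\<phi> s)) /\<^sub>R (y - t) \<partial>lborel)
      \<longlongrightarrow> conv \<phi> t) (at t within {0..T})"
    unfolding conv_def
  proof (rule tendsto_integral_at_within[where w = "\<lambda>s. growth T * norm (\<phi> s)"])
    show "integrable lborel (\<lambda>s. growth T * norm (\<phi> s))" using \<phi> by auto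
    have lim: "((\<lambda>y. (orbit_integral (y - s) (\<phi> s) - orbit_integral (t - s) (\<phi> s)) /\<^sub>R (y - t))
        \<longlongrightarrow> (if s < t then S (max 0 (t - s)) (\<phi> s) else 0)) (at t within {0..T})" if "s \<noteq> t" for s
    proof -
      have "((\<lambda>r. orbit_integral r (\<phi> s)) has_vector_derivative (if s < t then S (max 0 (t - s)) (\<phi> s) else 0)) (at (t - s))"
        using orbit_integral_has_vector_derivative[of "t - s" "\<phi> s"] that by (auto split: if_splits)
      then have "((\<lambda>r. (orbit_integral r (\<phi> s) - orbit_integral (t - s) (\<phi> s)) /\<^sub>R (r - (t - s)))
         \<longlongrightarrow> (if s < t then S (max 0 (t - s)) (\<phi> s) else 0)) (at (t - s))"
        by (simp only: has_vector_derivative_iff_quotient)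
      moreover have "filterlim (\<lambda>y. y - s) (at (t - s)) (at t within {0..T})"
        by (auto simp: filterlim_at eventually_at_filter intro!: tendsto_eq_intros)
      ultimately show ?thesis
        using filterlim_compose[of "\<lambda>r. (orbit_integral r (\<phi> s) - orbit_integral (t - s) (\<phi> s)) /\<^sub>R (r - (t - s))"
            _ "at (t - s)" "\<lambda>y. y - s" "at t within {0..T}"]
        by (simp del: max.absorb1 max.absorb2)
    qed
    show "AE s in lborel. ((\<lambda>y. (orbit_integral (y - s) (\<phi> s) - orbit_integral (t - s) (\<phi> s)) /\<^sub>R (y - t))
        \<longlongrightarrow> (if s < t then S (max 0 (t - s)) (\<phi> s) else 0)) (at t within {0..T})"
      using AE_lborel_singleton[of t] by eventually_elim (rule lim)
    fix y assume y: "y \<in> {0..T}" "y \<noteq> t"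
    show "AE s in lborel. norm ((orbit_integral (y - s) (\<phi> s) - orbit_integral (t - s) (\<phi> s)) /\<^sub>R (y - t))
        \<le> growth T * norm (\<phi> s)"
    proof (rule AE_I2)
      fix s
      show "norm ((orbit_integral (y - s) (\<phi> s) - orbit_integral (t - s) (\<phi> s)) /\<^sub>R (y - t))
        \<le> growth T * norm (\<phi> s)"
      proof (cases "s < 0")
        case True
        then show ?thesis using \<phi>_neg[of s] norm_orbit_integral_le[of _ 0] by simp
      next
        case False
        then have "norm (orbit_integral (y - s) (\<phi> s) - orbit_integral (t - s) (\<phi> s))
            \<le> growth T * norm (\<phi> s) * \<bar>y - t\<bar>"
          using orbit_integral_lipschitz[of "t - s" T "y - s" "\<phi> s"] y t by simp
        then show ?thesis using y(2) by (intro norm_quotient_le) auto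
      qed
    qed
  qed auto
  also have "(\<lambda>y. \<integral>s. (orbit_integral (y - s) (\<phi> s) - orbit_integral (t - s) (\<phi> s)) /\<^sub>R (y - t) \<partial>lborel)
     = (\<lambda>y. (conv_primitive \<phi> y - conv_primitive \<phi> t) /\<^sub>R (y - t))"
    by (simp add: conv_primitive_def integrable_conv_primitive)
  finally show "((\<lambda>y. (conv_primitive \<phi> y - conv_primitive \<phi> t) /\<^sub>R (y - t)) \<longlongrightarrow> conv \<phi> t) (at t within {0..T})" .
qed

lemma conv_primitive_0: "conv_primitive \<phi> 0 = 0"
proof -
  have "orbit_integral (0 - s) (\<phi> s) = 0" for s
    using \<phi>_neg[of s] norm_orbit_integral_le[of _ 0] by (cases "s < 0") (auto simp: orbit_integral_neg)
  then show ?thesis by (simp add: conv_primitive_def)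
qed

text \<open>The quotients of \<open>S\<close> at \<open>orbit_integral (t - s) (\<phi> s)\<close>
  converge to \<open>S (t - s) (\<phi> s) - \<phi> s\<close> and are dominated by a multiple of \<open>norm (\<phi> s)\<close>. So the
  antiderivative takes values in the domain, although \<open>\<phi>\<close> and \<open>conv \<phi>\<close> need not.\<close>

lemma in_generator_conv_primitive:
  "in_generator (conv_primitive \<phi> t) (conv \<phi> t - (LINT s:{..<t}|lborel. \<phi> s))"
proof -
  let ?q = "\<lambda>h s. (S (max 0 h) (orbit_integral (t - s) (\<phi> s)) - orbit_integral (t - s) (\<phi> s)) /\<^sub>R h"
  have meas: "(\<lambda>s. ?q h s) \<in> borel_measurable lborel" for h
  proof -
    have "integrable lborel (\<lambda>s. S (max 0 h) (orbit_integral (t - s) (\<phi> s)))"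
      by (intro integrable_bounded_linear[OF bounded_linear_S] integrable_conv_primitive) auto
    then show ?thesis by measurable
  qed
  have int_\<phi>: "integrable lborel (\<lambda>s. if s < t then \<phi> s else 0)"
    by (rule Bochner_Integration.integrable_bound[OF \<phi>]) (use \<phi> in \<open>auto\<close>)
  let ?T = "\<bar>t\<bar> + 1"
  have "((\<lambda>h. \<integral>s. ?q h s \<partial>lborel)
      \<longlongrightarrow> (\<integral>s. (if s < t then S (max 0 (t - s)) (\<phi> s) else 0) - (if s < t then \<phi> s else 0) \<partial>lborel)) (at 0 within {0<..<1})"
  proof (rule tendsto_integral_at_within[where w = "\<lambda>s. 2 * growth ?T * norm (\<phi> s)"])
    show "integrable lborel (\<lambda>s. 2 * growth ?T * norm (\<phi> s))" using \<phi> by auto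
    have lim: "((\<lambda>h. ?q h s) \<longlongrightarrow>
       (if s < t then S (max 0 (t - s)) (\<phi> s) else 0) - (if s < t then \<phi> s else 0)) (at_right 0)" for s
    proof (cases "s < t")
      case True
      have "\<forall>\<^sub>F h in at_right 0. (S h (orbit_integral (t - s) (\<phi> s)) - orbit_integral (t - s) (\<phi> s)) /\<^sub>R h = ?q h s"
        by (auto simp: eventually_at_filter)
      from Lim_transform_eventually[OF in_generator_orbit_integral[of "t - s" "\<phi> s", unfolded in_generator_def] this]
      show ?thesis using True by simp
    next
      case False
      then show ?thesis by (simp add: orbit_integral_neg S_zero)
    qed
    show "AE s in lborel. ((\<lambda>h. ?q h s) \<longlongrightarrow>
       (if s < t then S (max 0 (t - s)) (\<phi> s) else 0) - (if s < t then \<phi> s else 0)) (at 0 within {0<..<1})"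
      using lim by (intro AE_I2 tendsto_within_subset[OF lim]) auto
    fix h :: real assume h: "h \<in> {0<..<1}"
    show "AE s in lborel. norm (?q h s) \<le> 2 * growth ?T * norm (\<phi> s)"
    proof (rule AE_I2)
      fix s
      show "norm (?q h s) \<le> 2 * growth ?T * norm (\<phi> s)"
      proof (cases "0 \<le> s \<and> s \<le> t")
        case False
        then have "orbit_integral (t - s) (\<phi> s) = 0"
          using \<phi>_neg[of s] norm_orbit_integral_le[of "t - s" 0]
          by (cases "s < 0") (auto simp: orbit_integral_neg)
        then show ?thesis by (simp add: S_zero)
      next
        case True
        have 1: "norm (orbit_integral (t - s + h) (\<phi> s) - orbit_integral (t - s) (\<phi> s))
            \<le> growth ?T * norm (\<phi> s) * \<bar>t - s + h - (t - s)\<bar>"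
          using True h by (intro orbit_integral_lipschitz) auto
        have 2: "norm (orbit_integral h (\<phi> s) - orbit_integral 0 (\<phi> s))
            \<le> growth ?T * norm (\<phi> s) * \<bar>h - 0\<bar>"
          using True h by (intro orbit_integral_lipschitz) auto
        have "?q h s = (orbit_integral (t - s + h) (\<phi> s) - orbit_integral (t - s) (\<phi> s)) /\<^sub>R h - orbit_integral h (\<phi> s) /\<^sub>R h"
          using generator_quotient_orbit_integral[of h "t - s" "\<phi> s"] True h by simp
        also have "norm \<dots> \<le> norm ((orbit_integral (t - s + h) (\<phi> s) - orbit_integral (t - s) (\<phi> s)) /\<^sub>R h) + norm (orbit_integral h (\<phi> s) /\<^sub>R h)"
          by (rule norm_triangle_ineq4)
        also have "\<dots> \<le> growth ?T * norm (\<phi> s) + growth ?T * norm (\<phi> s)"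
          using 1 2 h by (intro add_mono norm_quotient_le) (auto simp: orbit_integral_neg)
        finally show ?thesis by (simp add: ac_simps)
      qed
    qed
  qed (use meas int_\<phi> in auto)
  also have "(\<integral>s. (if s < t then S (max 0 (t - s)) (\<phi> s) else 0) - (if s < t then \<phi> s else 0) \<partial>lborel)
      = conv \<phi> t - (LINT s:{..<t}|lborel. \<phi> s)"
  proof -
    have "(LINT s:{..<t}|lborel. \<phi> s) = (\<integral>s. (if s < t then \<phi> s else 0) \<partial>lborel)"
      unfolding set_lebesgue_integral_def by (intro Bochner_Integration.integral_cong) auto
    then show ?thesis
      unfolding conv_def by (simp only: Bochner_Integration.integral_diff[OF integrable_conv int_\<phi>])
  qed
  also have "at 0 within {0<..<1} = at_right (0::real)"
    by (rule at_within_nhd[of _ "{..<1}"]) auto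
  finally have lim: "((\<lambda>h. \<integral>s. ?q h s \<partial>lborel) \<longlongrightarrow> conv \<phi> t - (LINT s:{..<t}|lborel. \<phi> s)) (at_right 0)" .
  have eq: "(\<integral>s. ?q h s \<partial>lborel) = (S h (conv_primitive \<phi> t) - conv_primitive \<phi> t) /\<^sub>R h" if "0 < h" for h
  proof -
    have "integrable lborel (\<lambda>s. S h (orbit_integral (t - s) (\<phi> s)))"
      using that by (intro integrable_bounded_linear[OF bounded_linear_S] integrable_conv_primitive) auto
    moreover have "(\<integral>s. S h (orbit_integral (t - s) (\<phi> s)) \<partial>lborel) = S h (conv_primitive \<phi> t)"
      unfolding conv_primitive_def
      using that by (intro integral_bounded_linear[OF bounded_linear_S] integrable_conv_primitive) auto
    ultimately show ?thesis
      using that integrable_conv_primitive by (simp add: conv_primitive_def)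
  qed
  have "\<forall>\<^sub>F h in at_right 0. (\<integral>s. ?q h s \<partial>lborel) = (S h (conv_primitive \<phi> t) - conv_primitive \<phi> t) /\<^sub>R h"
    using eq by (auto simp: eventually_at_filter)
  then show ?thesis
    unfolding in_generator_def by (rule Lim_transform_eventually[OF lim])
qed

end

lemma conv_diff:
  assumes "integrable lborel \<phi>" "\<And>s. s < 0 \<Longrightarrow> \<phi> s = 0"
    "integrable lborel \<psi>" "\<And>s. s < 0 \<Longrightarrow> \<psi> s = 0"
  shows "conv \<phi> t - conv \<psi> t = conv (\<lambda>s. \<phi> s - \<psi> s) t"
  unfolding conv_def
  by (subst Bochner_Integration.integral_diff[symmetric, OF integrable_conv integrable_conv])
     (auto simp: assms S_diff intro!: Bochner_Integration.integral_cong)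

end

section \<open>Classical solutions of perturbed evolution equations\<close>

text \<open>With \<open>z t\<close> the right-hand side of the hypothesis, the function
  \<open>exp (- K * t) * z t - t * \<beta>\<close> has derivative \<open>K * exp (- K * t) * (y t - z t) \<le> 0\<close>. The forcing
  term grows like \<open>exp (K * s)\<close> because it then contributes the same amount \<open>\<beta>\<close> at every time.\<close>

lemma gronwall_exponential_forcing:
  fixes y :: "real \<Rightarrow> real"
  assumes y: "continuous_on {0..T} y" and K: "0 \<le> K"
    and le: "\<And>t. t \<in> {0..T} \<Longrightarrow> y t \<le> c + integral {0..t} (\<lambda>s. \<beta> * exp (K * s) + K * y s)"
    and t: "t \<in> {0..T}"
  shows "y t \<le> exp (K * t) * (c + t * \<beta>)"
proof -
  define z where "z t = c + integral {0..t} (\<lambda>s. \<beta> * exp (K * s) + K * y s)" for t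
  define D where "D t = exp (- (K * t)) * z t - t * \<beta>" for t
  have z_der: "(z has_vector_derivative \<beta> * exp (K * s) + K * y s) (at s within {0..T})" if "s \<in> {0..T}" for s
    unfolding z_def using that
    by (auto intro!: derivative_eq_intros integral_has_vector_derivative continuous_intros y)
  have z_cont: "continuous_on {0..T} z"
    by (rule continuous_on_vector_derivative) (rule z_der)
  have "D t \<le> D 0"
    proof (rule DERIV_nonpos_imp_decreasing_open[where f = D and a = 0 and b = t])
      show "0 \<le> t" using t by simp
      show "continuous_on {0..t} D"
        unfolding D_def using t
        by (intro continuous_intros continuous_on_subset[OF z_cont]) auto
      fix s assume s: "0 < s" "s < t"
      have at: "at s within {0..T} = at s"
        using s t by (intro at_within_Icc_at) auto
      have zs: "(z has_real_derivative \<beta> * exp (K * s) + K * y s) (at s)"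
        using z_der[of s] s t unfolding at has_real_derivative_iff_has_vector_derivative by simp
      have "(D has_real_derivative
          exp (- (K * s)) * (\<beta> * exp (K * s) + K * y s) - K * exp (- (K * s)) * z s - \<beta>) (at s)"
        unfolding D_def by (auto intro!: derivative_eq_intros zs)
      moreover have "exp (- (K * s)) * (\<beta> * exp (K * s) + K * y s) - K * exp (- (K * s)) * z s - \<beta>
          = K * exp (- (K * s)) * (y s - z s)"
        by (simp add: algebra_simps flip: exp_add)
      moreover have "K * exp (- (K * s)) * (y s - z s) \<le> 0"
        using K le[of s] s t by (intro mult_nonneg_nonpos) (auto simp: z_def)
      ultimately show "\<exists>d. (D has_real_derivative d) (at s) \<and> d \<le> 0" by auto
    qed
  then have "exp (- (K * t)) * z t \<le> c + t * \<beta>"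
    by (simp add: D_def z_def)
  then have "exp (K * t) * (exp (- (K * t)) * z t) \<le> exp (K * t) * (c + t * \<beta>)"
    by (rule mult_left_mono) simp
  moreover have "exp (K * t) * (exp (- (K * t)) * z t) = z t"
    by (simp add: mult.assoc[symmetric] exp_add[symmetric])
  ultimately show ?thesis
    using le[OF t] unfolding z_def by linarith
qed

lemma integral_indicator_exp:
  assumes "0 < (\<mu>::real)" "0 \<le> t"
  shows "integrable lborel (\<lambda>s. indicator {0..t} s * exp (\<mu> * s))"
    and "(\<integral>s. indicator {0..t} s * exp (\<mu> * s) \<partial>lborel) \<le> exp (\<mu> * t) / \<mu>"
proof -
  show "integrable lborel (\<lambda>s. indicator {0..t} s * exp (\<mu> * s))"
  proof -
    have "continuous_on {0..t} (\<lambda>s. exp (\<mu> * s))" by (intro continuous_intros)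
    from borel_integrable_compact[OF compact_Icc this] show ?thesis by simp
  qed
  have "(\<integral>s. exp (\<mu> * s) * indicator {0..t} s \<partial>lborel) = exp (\<mu> * t) / \<mu> - exp (\<mu> * 0) / \<mu>"
    by (rule integral_FTC_Icc_real) (use assms in \<open>auto intro!: derivative_eq_intros\<close>)
  then show "(\<integral>s. indicator {0..t} s * exp (\<mu> * s) \<partial>lborel) \<le> exp (\<mu> * t) / \<mu>"
    using assms by (simp add: mult.commute)
qed

context C0_semigroup_growth
begin

lemma continuous_on_S:
  assumes "continuous_on A \<tau>" "continuous_on A v" "\<And>s. s \<in> A \<Longrightarrow> 0 \<le> \<tau> s"
  shows "continuous_on A (\<lambda>s. S (\<tau> s) (v s))"
proof -
  have "continuous_on A (\<lambda>s. S (max 0 (fst (\<tau> s, v s))) (snd (\<tau> s, v s)))"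
    by (rule continuous_on_compose2[OF continuous_S]) (auto intro!: continuous_intros assms)
  then show ?thesis
    by (rule continuous_on_eq) (simp add: assms)
qed

text \<open>The path \<open>s \<mapsto> S (t - s) (u s)\<close> leads from \<open>S t (u 0)\<close> to \<open>u t\<close>, and in its
  derivative the two terms with the generator cancel.\<close>

lemma duhamel:
  assumes u: "continuous_on {0..T} u"
    and der: "\<And>s. s \<in> {0<..<T} \<Longrightarrow> (u has_vector_derivative u' s) (at s)"
    and gen: "\<And>s. s \<in> {0<..<T} \<Longrightarrow> in_generator (u s) (u' s - \<psi> s)"
    and t: "t \<in> {0..T}"
  shows "((\<lambda>s. S (t - s) (\<psi> s)) has_integral (u t - S t (u 0))) {0..t}"
proof -
  let ?k = "\<lambda>s. S (t - s) (u s)"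
  have "((\<lambda>s. S (t - s) (\<psi> s)) has_integral (?k t - ?k 0)) {0..t}"
  proof (rule fundamental_theorem_of_calculus_interior)
    show "0 \<le> t" using t by simp
    show "continuous_on {0..t} ?k"
      using t by (intro continuous_on_S continuous_intros continuous_on_subset[OF u]) auto
    fix s assume s: "s \<in> {0<..<t}"
    then have s': "s \<in> {0<..<T}" using t by auto
    have "((\<lambda>y. S (t - y) ((u y - u s) /\<^sub>R (y - s))) \<longlongrightarrow> S (t - s) (u' s)) (at s)"
    proof (rule tendsto_S)
      show "((\<lambda>y. (u y - u s) /\<^sub>R (y - s)) \<longlongrightarrow> u' s) (at s)"
        using der[OF s'] by (simp only: has_vector_derivative_iff_quotient)
      have "\<forall>\<^sub>F y in at s. y < t"
        using s by (intro order_tendstoD[OF tendsto_ident_at]) auto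
      then show "\<forall>\<^sub>F y in at s. 0 \<le> t - y" by eventually_elim simp
    qed (use s in \<open>auto intro!: tendsto_intros\<close>)
    moreover have "((\<lambda>y. (S (t - y) (u s) - S (t - s) (u s)) /\<^sub>R (y - s)) \<longlongrightarrow> - S (t - s) (u' s - \<psi> s)) (at s)"
    proof -
      have "((\<lambda>y. t - y) has_vector_derivative -1) (at s)"
        by (auto intro!: derivative_eq_intros)
      from vector_diff_chain_at[OF this, of "\<lambda>r. S r (u s)"]
      have "((\<lambda>y. S (t - y) (u s)) has_vector_derivative - S (t - s) (u' s - \<psi> s)) (at s)"
        using orbit_has_vector_derivative[OF gen[OF s'], of "t - s"] s by (simp add: o_def)
      then show ?thesis by (simp only: has_vector_derivative_iff_quotient)
    qed
    ultimately have "((\<lambda>y. S (t - y) ((u y - u s) /\<^sub>R (y - s)) + (S (t - y) (u s) - S (t - s) (u s)) /\<^sub>R (y - s))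
        \<longlongrightarrow> S (t - s) (u' s) + - S (t - s) (u' s - \<psi> s)) (at s)"
      by (rule tendsto_add)
    also have "S (t - s) (u' s) + - S (t - s) (u' s - \<psi> s) = S (t - s) (\<psi> s)"
      using s by (simp add: S_diff)
    finally have lim: "((\<lambda>y. S (t - y) ((u y - u s) /\<^sub>R (y - s)) + (S (t - y) (u s) - S (t - s) (u s)) /\<^sub>R (y - s))
        \<longlongrightarrow> S (t - s) (\<psi> s)) (at s)" .
    have "\<forall>\<^sub>F y in at s. y < t"
      using s by (intro order_tendstoD[OF tendsto_ident_at]) auto
    then have "\<forall>\<^sub>F y in at s. S (t - y) ((u y - u s) /\<^sub>R (y - s)) + (S (t - y) (u s) - S (t - s) (u s)) /\<^sub>R (y - s)
       = (?k y - ?k s) /\<^sub>R (y - s)"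
      by eventually_elim (simp add: S_scaleR S_diff scaleR_diff_right)
    from Lim_transform_eventually[OF lim this]
    show "(?k has_vector_derivative S (t - s) (\<psi> s)) (at s)"
      by (simp only: has_vector_derivative_iff_quotient)
  qed
  then show ?thesis by (simp add: S_0)
qed

text \<open>A bounded perturbation of norm \<open>k\<close> is treated as part of the source
  \<open>\<psi>\<close>. Gronwall's inequality for \<open>exp (- w * t) * norm (u t)\<close> raises the growth rate from \<open>w\<close> to
  \<open>w + M * k\<close>, exactly as for the semigroup generated by the perturbed operator, which does not have
  to be constructed.\<close>

lemma classical_solution_bound:
  assumes u: "continuous_on {0..T} u"
    and der: "\<And>s. s \<in> {0<..<T} \<Longrightarrow> (u has_vector_derivative u' s) (at s)"
    and gen: "\<And>s. s \<in> {0<..<T} \<Longrightarrow> in_generator (u s) (u' s - \<psi> s)"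
    and \<psi>: "\<And>s. s \<in> {0..T} \<Longrightarrow> norm (\<psi> s) \<le> k * norm (u s) + h s"
    and k: "0 \<le> k"
    and h: "\<And>s. s \<in> {0..T} \<Longrightarrow> M * h s \<le> \<beta> * exp ((w + M * k) * s)"
    and t: "t \<in> {0..T}"
  shows "norm (u t) \<le> exp ((w + M * k) * t) * (M * norm (u 0) + t * \<beta>)"
proof -
  let ?K = "M * k"
  define y where "y s = exp (- (w * s)) * norm (u s)" for s
  have y_cont: "continuous_on {0..T} y"
    unfolding y_def by (intro continuous_intros u)
  have "y t \<le> exp (?K * t) * (M * norm (u 0) + t * \<beta>)"
  proof (rule gronwall_exponential_forcing[OF y_cont _ _ t])
    show "0 \<le> ?K" using M_pos k by simp
    fix t assume t: "t \<in> {0..T}"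
    note int = duhamel[OF u der gen t]
    let ?r = "\<lambda>s. exp (w * t) * (\<beta> * exp (?K * s) + ?K * y s)"
    have "norm (integral {0..t} (\<lambda>s. S (t - s) (\<psi> s))) \<le> integral {0..t} ?r"
    proof (rule integral_norm_bound_integral)
      show "(\<lambda>s. S (t - s) (\<psi> s)) integrable_on {0..t}" using int by blast
      show "?r integrable_on {0..t}"
        using t by (intro integrable_continuous_real continuous_intros continuous_on_subset[OF y_cont]) auto
      fix s assume s: "s \<in> {0..t}"
      then have s': "s \<in> {0..T}" using t by auto
      have "norm (S (t - s) (\<psi> s)) \<le> M * exp (w * (t - s)) * norm (\<psi> s)"
        using s by (intro norm_S_le) auto
      also have "\<dots> \<le> M * exp (w * (t - s)) * (k * norm (u s) + h s)"
        using M_pos by (intro mult_left_mono \<psi> s') auto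
      also have "\<dots> = exp (w * (t - s)) * (M * h s) + exp (w * (t - s)) * (?K * norm (u s))"
        by (simp add: algebra_simps)
      also have "\<dots> \<le> exp (w * (t - s)) * (\<beta> * exp ((w + ?K) * s)) + exp (w * (t - s)) * (?K * norm (u s))"
        by (intro add_right_mono mult_left_mono h s') auto
      also have "\<dots> = ?r s"
        by (simp add: y_def algebra_simps exp_add exp_diff exp_minus field_simps)
      finally show "norm (S (t - s) (\<psi> s)) \<le> ?r s" .
    qed
    then have "norm (u t - S t (u 0)) \<le> exp (w * t) * integral {0..t} (\<lambda>s. \<beta> * exp (?K * s) + ?K * y s)"
      using integral_unique[OF int] by simp
    moreover have "norm (S t (u 0)) \<le> exp (w * t) * (M * norm (u 0))"
      using norm_S_le[of t "u 0"] t by (simp add: ac_simps)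
    ultimately have "norm (u t) \<le> exp (w * t) * (M * norm (u 0) + integral {0..t} (\<lambda>s. \<beta> * exp (?K * s) + ?K * y s))"
      using norm_triangle_sub[of "u t" "S t (u 0)"] by (simp only: distrib_left)
    then have "exp (- (w * t)) * norm (u t) \<le> exp (- (w * t)) * (exp (w * t) * (M * norm (u 0) + integral {0..t} (\<lambda>s. \<beta> * exp (?K * s) + ?K * y s)))"
      by (rule mult_left_mono) simp
    also have "\<dots> = M * norm (u 0) + integral {0..t} (\<lambda>s. \<beta> * exp (?K * s) + ?K * y s)"
      by (simp add: mult.assoc[symmetric] exp_add[symmetric])
    finally show "y t \<le> M * norm (u 0) + integral {0..t} (\<lambda>s. \<beta> * exp (?K * s) + ?K * y s)"
      by (simp only: y_def)
  qed
  then have "exp (w * t) * y t \<le> exp (w * t) * (exp (?K * t) * (M * norm (u 0) + t * \<beta>))"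
    by (rule mult_left_mono) simp
  moreover have "exp (w * t) * y t = norm (u t)"
    by (simp add: y_def mult.assoc[symmetric] exp_add[symmetric])
  ultimately show ?thesis
    by (simp add: distrib_right exp_add mult.assoc)
qed

text \<open>Picard iteration in the norm \<open>sup exp (- \<mu> * t) * norm (z t)\<close>, in which the
  convolution with \<open>B\<close> is a contraction as soon as \<open>\<mu>\<close> is large. Clamping the time to \<open>[0, T]\<close>
  places the iteration in the Banach space of bounded continuous functions on the line.\<close>

lemma mild_solution:
  assumes T: "0 \<le> T" and B: "bounded_linear B" and f': "set_integrable lborel {0..T} f'"
  obtains z where "continuous_on {0..T} z"
    "\<And>t. t \<in> {0..T} \<Longrightarrow> z t = S t init + conv (\<lambda>s. indicator {0..T} s *\<^sub>R (f' s - B (z s))) t"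
proof -
  obtain k where k: "0 < k" "\<And>x. norm (B x) \<le> norm x * k"
    using bounded_linear.pos_bounded[OF B] by blast
  define G where "G = growth T"
  \<comment> \<open>With this choice the convolution is a contraction with factor 1/2.\<close>
  define \<mu> where "\<mu> = 2 * (G * k)"
  have G: "0 < G" and \<mu>: "0 < \<mu>" using k by (auto simp: G_def \<mu>_def)
  define \<phi> where "\<phi> v s = indicator {0..T} s *\<^sub>R (f' s - B (exp (\<mu> * s) *\<^sub>R v s))" for v s
  have \<phi>_int: "integrable lborel (\<phi> v)" if v: "continuous_on {0..T} v" for v
  proof -
    have "continuous_on {0..T} (\<lambda>s. B (exp (\<mu> * s) *\<^sub>R v s))"
      by (intro bounded_linear.continuous_on[OF B] continuous_intros v)
    then have "integrable lborel (\<lambda>s. indicator {0..T} s *\<^sub>R B (exp (\<mu> * s) *\<^sub>R v s))"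
      by (intro borel_integrable_compact) auto
    from Bochner_Integration.integrable_diff[OF f'[unfolded set_integrable_def] this]
    show ?thesis by (simp add: \<phi>_def[abs_def] scaleR_diff_right)
  qed
  have \<phi>_neg: "\<phi> v s = 0" if "s < 0" for v s using that by (simp add: \<phi>_def)
  define c where "c t = max 0 (min T t)" for t
  have c: "c t \<in> {0..T}" for t using T by (auto simp: c_def)
  have c_id: "c t = t" if "t \<in> {0..T}" for t using that by (auto simp: c_def)
  have c_cont: "continuous_on UNIV c" unfolding c_def by (intro continuous_intros)
  define F where "F v t = exp (- (\<mu> * t)) *\<^sub>R (S t init + conv (\<phi> v) t)" for v t
  have F_cont: "continuous_on {0..T} (F v)" if "continuous_on {0..T} v" for v
    unfolding F_def
    by (intro continuous_intros continuous_orbit_on continuous_conv \<phi>_int that \<phi>_neg) auto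
  define \<Phi> where "\<Phi> v = Bcontfun (\<lambda>t. F (apply_bcontfun v) (c t))" for v :: "real \<Rightarrow>\<^sub>C 'x"
  have \<Phi>: "apply_bcontfun (\<Phi> v) t = F (apply_bcontfun v) (c t)" for v t
  proof -
    have Fv: "continuous_on {0..T} (F (apply_bcontfun v))"
      by (intro F_cont) (auto intro!: continuous_intros)
    have "bounded (F (apply_bcontfun v) ` {0..T})"
      by (intro compact_imp_bounded compact_continuous_image Fv) auto
    then have "bounded (range (\<lambda>t. F (apply_bcontfun v) (c t)))"
      by (rule bounded_subset) (use c in auto)
    moreover have "continuous_on UNIV (\<lambda>t. F (apply_bcontfun v) (c t))"
      by (rule continuous_on_compose2[OF Fv c_cont]) (use c in auto)
    ultimately have "(\<lambda>t. F (apply_bcontfun v) (c t)) \<in> bcontfun"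
      by (simp add: bcontfun_def)
    then show ?thesis by (simp add: \<Phi>_def Bcontfun_inverse)
  qed
  have contr: "norm (F v t - F v' t) \<le> 1 / 2 * d"
    if v: "continuous_on {0..T} v" "continuous_on {0..T} v'"
      and d: "\<And>s. norm (v s - v' s) \<le> d" and t: "t \<in> {0..T}" for v v' d t
  proof -
    have d0: "0 \<le> d" using d[of 0] norm_ge_zero order_trans by blast
    let ?\<delta> = "\<lambda>s. \<phi> v s - \<phi> v' s"
    have \<delta>: "norm (?\<delta> s) \<le> exp (\<mu> * s) * (k * d)" for s
    proof (cases "s \<in> {0..T}")
      case True
      then have "?\<delta> s = B (exp (\<mu> * s) *\<^sub>R (v' s - v s))"
        using B by (simp add: \<phi>_def bounded_linear.linear linear_diff linear_scale scaleR_diff_right)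
      then have "norm (?\<delta> s) \<le> exp (\<mu> * s) * norm (v s - v' s) * k"
        using k(2)[of "exp (\<mu> * s) *\<^sub>R (v' s - v s)"] by (simp add: norm_minus_commute)
      also have "\<dots> \<le> exp (\<mu> * s) * d * k"
        using k by (intro mult_right_mono mult_left_mono d) auto
      finally show ?thesis by (simp add: ac_simps)
    next
      case False
      then show ?thesis using d0 k by (auto simp: \<phi>_def)
    qed
    note int = \<phi>_int[OF v(1)] \<phi>_int[OF v(2)]
    have \<delta>_int: "integrable lborel ?\<delta>" using int by auto
    have \<delta>_neg: "?\<delta> s = 0" if "s < 0" for s using that by (simp add: \<phi>_neg)
    have "norm (conv (\<phi> v) t - conv (\<phi> v') t) = norm (conv ?\<delta> t)"
      by (subst conv_diff) (use int \<phi>_neg in auto)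
    also have "\<dots> \<le> (\<integral>s. indicator {0..t} s * exp (\<mu> * s) * (G * k * d) \<partial>lborel)"
      unfolding conv_def
    proof (rule Bochner_Integration.integral_norm_bound_integral)
      show "integrable lborel (\<lambda>s. if s < t then S (max 0 (t - s)) (?\<delta> s) else 0)"
        by (rule integrable_conv[OF \<delta>_int \<delta>_neg])
      show "integrable lborel (\<lambda>s. indicator {0..t} s * exp (\<mu> * s) * (G * k * d))"
        using integral_indicator_exp(1)[OF \<mu>, of t] t by (intro integrable_mult_left) auto
      fix s :: real
      show "norm (if s < t then S (max 0 (t - s)) (?\<delta> s) else 0) \<le> indicator {0..t} s * exp (\<mu> * s) * (G * k * d)"
      proof (cases "s \<in> {0..<t}")
        case True
        have "norm (if s < t then S (max 0 (t - s)) (?\<delta> s) else 0) \<le> G * norm (?\<delta> s)"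
          unfolding G_def using t by (intro norm_conv_integrand_le[OF \<delta>_int \<delta>_neg]) auto
        also have "\<dots> \<le> G * (exp (\<mu> * s) * (k * d))"
          using G by (intro mult_left_mono \<delta>) auto
        finally show ?thesis using True by (simp add: ac_simps)
      next
        case False
        then show ?thesis using \<delta>_neg[of s] G k d0 by (cases "s < 0") (auto simp: S_zero)
      qed
    qed
    also have "\<dots> = (\<integral>s. indicator {0..t} s * exp (\<mu> * s) \<partial>lborel) * (G * k * d)"
      by simp
    also have "\<dots> \<le> exp (\<mu> * t) / \<mu> * (G * k * d)"
      using integral_indicator_exp(2)[OF \<mu>, of t] t G k d0 by (intro mult_right_mono) auto
    also have "\<dots> = exp (\<mu> * t) * (1 / 2 * d)"
      using G k by (simp add: \<mu>_def)
    finally have *: "norm (conv (\<phi> v) t - conv (\<phi> v') t) \<le> exp (\<mu> * t) * (1 / 2 * d)" .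
    have "norm (F v t - F v' t) = exp (- (\<mu> * t)) * norm (conv (\<phi> v) t - conv (\<phi> v') t)"
      by (simp add: F_def scaleR_diff_right[symmetric])
    also have "\<dots> \<le> exp (- (\<mu> * t)) * (exp (\<mu> * t) * (1 / 2 * d))"
      by (intro mult_left_mono *) auto
    also have "\<dots> = 1 / 2 * d"
      by (simp add: mult.assoc[symmetric] exp_add[symmetric])
    finally show ?thesis .
  qed
  have "\<exists>!v. \<Phi> v = v"
  proof (rule banach_fix_type)
    show "\<forall>v v'. dist (\<Phi> v) (\<Phi> v') \<le> 1 / 2 * dist v v'"
    proof (intro allI dist_bound)
      fix v v' :: "real \<Rightarrow>\<^sub>C 'x" and t
      show "dist (apply_bcontfun (\<Phi> v) t) (apply_bcontfun (\<Phi> v') t) \<le> 1 / 2 * dist v v'"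
        unfolding \<Phi> dist_norm[of "F _ _"]
        by (rule contr[OF _ _ _ c])
           (auto intro!: continuous_intros dist_bounded simp flip: dist_norm)
    qed
  qed auto
  then obtain v where v: "\<Phi> v = v" by blast
  define z where "z t = exp (\<mu> * t) *\<^sub>R apply_bcontfun v t" for t
  show ?thesis
  proof (rule that[of z])
    show "continuous_on {0..T} z"
      unfolding z_def by (intro continuous_intros continuous_on_apply_bcontfun)
    fix t assume t: "t \<in> {0..T}"
    have "z t = exp (\<mu> * t) *\<^sub>R apply_bcontfun (\<Phi> v) t" by (simp add: z_def v)
    also have "\<dots> = S t init + conv (\<phi> (apply_bcontfun v)) t"
      unfolding \<Phi> c_id[OF t] F_def scaleR_scaleR exp_add[symmetric] by simp
    finally show "z t = S t init + conv (\<lambda>s. indicator {0..T} s *\<^sub>R (f' s - B (z s))) t"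
      by (simp add: \<phi>_def[abs_def] z_def)
  qed
qed

text \<open>Write \<open>A\<close> for the generator. Differentiating \<open>u' = A u - B u + f\<close>
  formally shows that \<open>z = u'\<close> solves \<open>z' = A z - B z + f'\<close> with \<open>z 0 = A g - B g + f 0\<close>. In its mild
  form this equation makes sense for integrable \<open>f'\<close> and can be solved. The integral of \<open>z\<close>
  takes values in the domain, and applying \<open>A\<close> to it gives back the original equation.\<close>

lemma classical_solution_exists:
  assumes T: "0 \<le> T" and B: "bounded_linear B"
    and f': "set_integrable lborel {0..T} f'"
    and f: "\<And>t. t \<in> {0..T} \<Longrightarrow> f t = f 0 + (LINT s:{0..t}|lborel. f' s)"
    and g: "in_generator g g'"
  obtains u z where "continuous_on {0..T} z" "u 0 = g"
    "\<And>t. t \<in> {0..T} \<Longrightarrow> (u has_vector_derivative z t) (at t within {0..T})"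
    "\<And>t. t \<in> {0..T} \<Longrightarrow> in_generator (u t) (z t + B (u t) - f t)"
proof -
  define z0 where "z0 = g' - B g + f 0"
  obtain z where z: "continuous_on {0..T} z"
    and z_eq: "\<And>t. t \<in> {0..T} \<Longrightarrow> z t = S t z0 + conv (\<lambda>s. indicator {0..T} s *\<^sub>R (f' s - B (z s))) t"
    by (rule mild_solution[OF T B f', where init = z0]) blast
  define \<phi> where "\<phi> s = indicator {0..T} s *\<^sub>R (f' s - B (z s))" for s
  have Bz: "continuous_on {0..T} (\<lambda>s. B (z s))"
    by (intro bounded_linear.continuous_on[OF B] z)
  have z_int: "set_integrable lborel {0..t} z" if "t \<le> T" for t
    unfolding set_integrable_def using that
    by (intro borel_integrable_compact continuous_on_subset[OF z]) auto
  have Bz_int: "set_integrable lborel {0..t} (\<lambda>s. B (z s))" if "t \<le> T" for t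
    unfolding set_integrable_def using that
    by (intro borel_integrable_compact continuous_on_subset[OF Bz]) auto
  have \<phi>_int: "integrable lborel \<phi>"
    using set_integral_diff(1)[OF f' Bz_int[OF order_refl]]
    by (simp add: \<phi>_def[abs_def] set_integrable_def)
  have \<phi>_neg: "\<phi> s = 0" if "s < 0" for s using that by (simp add: \<phi>_def)
  define u where "u t = g + orbit_integral t z0 + conv_primitive \<phi> t" for t
  have u0: "u 0 = g"
    using conv_primitive_0[OF \<phi>_int \<phi>_neg] by (simp add: u_def orbit_integral_neg)
  have u_der: "(u has_vector_derivative z t) (at t within {0..T})" if t: "t \<in> {0..T}" for t
  proof -
    have "((\<lambda>t. orbit_integral t z0) has_vector_derivative S t z0) (at t within {0..T})"
      unfolding orbit_integral_def
      by (intro integral_has_vector_derivative continuous_orbit_on t) auto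
    moreover have "(conv_primitive \<phi> has_vector_derivative conv \<phi> t) (at t within {0..T})"
      by (rule conv_primitive_has_vector_derivative[OF \<phi>_int \<phi>_neg t])
    ultimately show ?thesis
      unfolding u_def[abs_def] z_eq[OF t] \<phi>_def[symmetric]
      by (auto intro!: derivative_eq_intros)
  qed
  have u_gen: "in_generator (u t) (z t + B (u t) - f t)" if t: "t \<in> {0..T}" for t
  proof -
    have "(LINT s:{..<t}|lborel. \<phi> s) = (LINT s:{0..t}|lborel. f' s - B (z s))"
      unfolding set_lebesgue_integral_def
    proof (rule integral_cong_AE)
      have f't: "set_integrable lborel {0..t} f'"
        by (rule set_integrable_subset[OF f']) (use t in auto)
      show "(\<lambda>s. indicator {0..t} s *\<^sub>R (f' s - B (z s))) \<in> borel_measurable lborel"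
        using set_integral_diff(1)[OF f't Bz_int] t by (auto simp: set_integrable_def)
      show "(\<lambda>s. indicator {..<t} s *\<^sub>R \<phi> s) \<in> borel_measurable lborel"
        using \<phi>_int by (intro borel_measurable_scaleR) auto
      show "AE s in lborel. indicator {..<t} s *\<^sub>R \<phi> s = indicator {0..t} s *\<^sub>R (f' s - B (z s))"
        using AE_lborel_singleton[of t]
        by eventually_elim (use t in \<open>auto simp: \<phi>_def indicator_def\<close>)
    qed
    also have "\<dots> = (LINT s:{0..t}|lborel. f' s) - (LINT s:{0..t}|lborel. B (z s))"
      using t by (intro set_integral_diff set_integrable_subset[OF f'] Bz_int) auto
    also have "(LINT s:{0..t}|lborel. B (z s)) = B (LINT s:{0..t}|lborel. z s)"
      using integral_bounded_linear[OF B, of lborel "\<lambda>s. indicator {0..t} s *\<^sub>R z s"] z_int[of t] t B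
      by (simp add: set_lebesgue_integral_def set_integrable_def bounded_linear.linear linear_scale)
    also have "(LINT s:{0..t}|lborel. z s) = u t - g"
      using LINT_derivative[OF u_der z t] u0 by simp
    also have "B (u t - g) = B (u t) - B g"
      using B by (simp add: bounded_linear.linear linear_diff)
    finally have I: "(LINT s:{..<t}|lborel. \<phi> s) = (f t - f 0) - (B (u t) - B g)"
      using f[OF t] by (simp add: algebra_simps)
    have "in_generator (u t) (g' + (S t z0 - z0) + (conv \<phi> t - (LINT s:{..<t}|lborel. \<phi> s)))"
      unfolding u_def using t
      by (intro in_generator_add g in_generator_orbit_integral in_generator_conv_primitive \<phi>_int \<phi>_neg) auto
    also have "g' + (S t z0 - z0) + (conv \<phi> t - (LINT s:{..<t}|lborel. \<phi> s)) = z t + B (u t) - f t"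
      unfolding I z_eq[OF t] \<phi>_def[symmetric] z0_def by (simp add: algebra_simps)
    finally show ?thesis .
  qed
  show ?thesis
    by (rule that[OF z u0 u_der u_gen])
qed

end

section \<open>Weights of multi-indices and convolution inequalities\<close>

lemma mi_abs_superset:
  assumes "finite A" "Poly_Mapping.keys \<alpha> \<subseteq> A"
  shows "mi_abs \<alpha> = (\<Sum>i\<in>A. Poly_Mapping.lookup \<alpha> i)"
  unfolding mi_abs_def using assms
  by (intro sum.mono_neutral_left) (auto simp: in_keys_iff)

lemma mi_abs_add: "mi_abs (\<alpha> + \<beta>) = mi_abs \<alpha> + mi_abs \<beta>"
proof -
  let ?A = "Poly_Mapping.keys \<alpha> \<union> Poly_Mapping.keys \<beta>"
  have "mi_abs \<gamma> = (\<Sum>i\<in>?A. Poly_Mapping.lookup \<gamma> i)" if "\<gamma> \<in> {\<alpha>, \<beta>, \<alpha> + \<beta>}" for \<gamma>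
    using that keys_add[of \<alpha> \<beta>] by (intro mi_abs_superset) auto
  then show ?thesis by (simp add: lookup_add sum.distrib)
qed

lemma mi_abs_0 [simp]: "mi_abs 0 = 0"
  by (simp add: mi_abs_def)

lemma mi_abs_eq_0_iff: "mi_abs \<alpha> = 0 \<longleftrightarrow> \<alpha> = 0"
  by (auto simp: mi_abs_def poly_mapping_eq_iff in_keys_iff fun_eq_iff)

lemma mi_abs_pos: "\<alpha> \<noteq> 0 \<Longrightarrow> 1 \<le> mi_abs \<alpha>"
  using mi_abs_eq_0_iff[of \<alpha>] by linarith

lemma mi_weight_superset:
  assumes "finite A" "Poly_Mapping.keys \<alpha> \<subseteq> A"
  shows "mi_weight p \<alpha> = (\<Prod>i\<in>A. (2 * real (Suc i)) powr (p * real (Poly_Mapping.lookup \<alpha> i)))"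
  unfolding mi_weight_def using assms
  by (intro prod.mono_neutral_left) (auto simp: in_keys_iff)

lemma mi_weight_pos: "0 < mi_weight p \<alpha>"
  unfolding mi_weight_def by (intro prod_pos) auto

lemma mi_weight_nonneg [simp]: "0 \<le> mi_weight p \<alpha>"
  using mi_weight_pos[of p \<alpha>] by simp

lemma mi_weight_add_index: "mi_weight p (\<alpha> + \<beta>) = mi_weight p \<alpha> * mi_weight p \<beta>"
proof -
  let ?A = "Poly_Mapping.keys \<alpha> \<union> Poly_Mapping.keys \<beta>"
  have "mi_weight p \<gamma> = (\<Prod>i\<in>?A. (2 * real (Suc i)) powr (p * real (Poly_Mapping.lookup \<gamma> i)))"
    if "\<gamma> \<in> {\<alpha>, \<beta>, \<alpha> + \<beta>}" for \<gamma>
    using that keys_add[of \<alpha> \<beta>] by (intro mi_weight_superset) auto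
  then show ?thesis by (simp add: lookup_add prod.distrib distrib_left powr_add)
qed

lemma mi_weight_add_exponent: "mi_weight (p + r) \<alpha> = mi_weight p \<alpha> * mi_weight r \<alpha>"
  by (simp add: mi_weight_def distrib_right powr_add prod.distrib)

lemma mi_weight_le_power:
  assumes "0 \<le> p"
  shows "mi_weight (- p) \<alpha> \<le> 2 powr (- p * real (mi_abs \<alpha>))"
proof -
  have "mi_weight (- p) \<alpha> \<le> (\<Prod>i\<in>Poly_Mapping.keys \<alpha>. 2 powr (- p * real (Poly_Mapping.lookup \<alpha> i)))"
    unfolding mi_weight_def
    by (intro prod_mono conjI powr_mono2') (use assms in \<open>auto intro!: mult_nonneg_nonneg\<close>)
  also have "\<dots> = 2 powr (- p * real (mi_abs \<alpha>))"
    by (subst powr_sum[symmetric]) (auto simp: mi_abs_def sum_distrib_left)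
  finally show ?thesis .
qed

lemma mi_weight_le_1: "0 \<le> p \<Longrightarrow> mi_weight (- p) \<alpha> \<le> 1"
proof -
  assume p: "0 \<le> p"
  have "2 powr (- p * real (mi_abs \<alpha>)) \<le> 2 powr (0::real)"
    using p by (intro powr_mono) auto
  then show ?thesis using mi_weight_le_power[OF p, of \<alpha>] by simp
qed

lemma mi_weight_antimono: "s \<le> s' \<Longrightarrow> mi_weight (- s') \<alpha> \<le> mi_weight (- s) \<alpha>"
  using mi_weight_add_exponent[of "- s" "- (s' - s)" \<alpha>] mi_weight_le_1[of "s' - s" \<alpha>]
  by (simp add: mult_left_le)

text \<open>Raising the exponent makes the total weight of the nonzero indices as
  small as desired, while a fixed summable family remains as majorant.\<close>

lemma mi_weight_nonzero_index:
  assumes "2 \<le> s" "\<alpha> \<noteq> 0"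
  shows "mi_weight (- s) \<alpha> \<le> 2 powr (2 - s) * mi_weight (- 2) \<alpha>"
proof -
  have "mi_weight (- (s - 2)) \<alpha> \<le> 2 powr (- (s - 2) * real (mi_abs \<alpha>))"
    using assms by (intro mi_weight_le_power) auto
  also have "\<dots> \<le> 2 powr (2 - s)"
  proof (rule powr_mono)
    have "(s - 2) * 1 \<le> (s - 2) * real (mi_abs \<alpha>)"
      using assms mi_abs_pos[of \<alpha>] by (intro mult_left_mono) auto
    then show "- (s - 2) * real (mi_abs \<alpha>) \<le> 2 - s"
      by (simp only: mult_minus_left mult_1_right)
  qed simp
  finally have "mi_weight (- (s - 2)) \<alpha> * mi_weight (- 2) \<alpha> \<le> 2 powr (2 - s) * mi_weight (- 2) \<alpha>"
    by (rule mult_right_mono) simp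
  then show ?thesis
    using mi_weight_add_exponent[of "- (s - 2)" "- 2" \<alpha>] by simp
qed

text \<open>A finite set of multi-indices lies in a box, and over a box the sum is a
  product of truncated geometric series with ratios \<open>x i\<close>. The product of the full series is
  finite because the \<open>x i\<close> are summable.\<close>

lemma sum_mi_weight_bounded:
  obtains C where "0 \<le> C" "\<And>F. finite F \<Longrightarrow> (\<Sum>\<alpha>\<in>F. mi_weight (- 2) \<alpha>) \<le> C"
proof -
  define x where "x i = (2 * real (Suc i)) powr (- 2)" for i
  have x_eq: "x i = inverse (real (Suc i) ^ 2) / 4" for i
  proof -
    have "x i = 1 / (2 * real (Suc i)) ^ 2"
      unfolding x_def by (rule powr_neg_numeral) simp
    then show ?thesis
      by (simp only: power_mult_distrib divide_inverse inverse_mult_distrib) simp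
  qed
  have x: "0 \<le> x i" "x i \<le> 1 / 4" for i
  proof -
    have "1 \<le> real (Suc i) ^ 2" by (intro one_le_power) simp
    then have "inverse (real (Suc i) ^ 2) \<le> 1" by (rule inverse_le_1_iff[THEN iffD2, OF disjI2])
    then show "0 \<le> x i" "x i \<le> 1 / 4" by (simp_all only: x_eq) auto
  qed
  have "summable (\<lambda>i. inverse (real (Suc i) ^ 2))"
    using inverse_power_summable[of 2, where 'a = real] by (subst summable_Suc_iff) simp
  then have sx: "summable x"
    unfolding x_eq[abs_def] by (rule summable_divide)
  have bound: "(\<Sum>\<alpha>\<in>F. mi_weight (- 2) \<alpha>) \<le> exp (2 * suminf x)" if F: "finite F" for F
  proof -
    define A where "A = (\<Union>\<alpha>\<in>F. Poly_Mapping.keys \<alpha>)"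
    define K where "K = (\<Sum>\<alpha>\<in>F. mi_abs \<alpha>)"
    have A: "finite A" using F by (auto simp: A_def)
    have keys: "Poly_Mapping.keys \<alpha> \<subseteq> A" if "\<alpha> \<in> F" for \<alpha> using that by (auto simp: A_def)
    have le_K: "Poly_Mapping.lookup \<alpha> i \<le> K" if "\<alpha> \<in> F" for \<alpha> i
    proof -
      have "Poly_Mapping.lookup \<alpha> i \<le> mi_abs \<alpha>"
        unfolding mi_abs_def
        by (cases "i \<in> Poly_Mapping.keys \<alpha>") (auto simp: in_keys_iff intro: member_le_sum)
      also have "\<dots> \<le> K" unfolding K_def using F that by (intro member_le_sum) auto
      finally show ?thesis .
    qed
    let ?r = "\<lambda>\<alpha>. restrict (Poly_Mapping.lookup \<alpha>) A"
    have inj: "inj_on ?r F"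
    proof (rule inj_onI)
      have zero: "Poly_Mapping.lookup \<alpha> i = 0" if "\<alpha> \<in> F" "i \<notin> A" for \<alpha> i
      proof -
        have "i \<notin> Poly_Mapping.keys \<alpha>" using keys[OF that(1)] that(2) by auto
        then show ?thesis by (simp add: in_keys_iff)
      qed
      fix \<alpha> \<beta> assume \<alpha>: "\<alpha> \<in> F" and \<beta>: "\<beta> \<in> F" and eq: "?r \<alpha> = ?r \<beta>"
      show "\<alpha> = \<beta>"
      proof (rule poly_mapping_eqI)
        fix i
        show "Poly_Mapping.lookup \<alpha> i = Poly_Mapping.lookup \<beta> i"
          using fun_cong[OF eq, of i] zero[OF \<alpha>] zero[OF \<beta>] by (cases "i \<in> A") auto
      qed
    qed
    have "(\<Sum>\<alpha>\<in>F. mi_weight (- 2) \<alpha>) = (\<Sum>\<alpha>\<in>F. \<Prod>i\<in>A. x i ^ ?r \<alpha> i)"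
    proof (rule sum.cong[OF refl])
      fix \<alpha> assume "\<alpha> \<in> F"
      then show "mi_weight (- 2) \<alpha> = (\<Prod>i\<in>A. x i ^ ?r \<alpha> i)"
        by (subst mi_weight_superset[OF A keys])
           (auto intro!: prod.cong simp: x_def powr_powr simp flip: powr_realpow)
    qed
    also have "\<dots> = (\<Sum>h\<in>?r ` F. \<Prod>i\<in>A. x i ^ h i)"
      by (subst sum.reindex[OF inj]) (simp add: o_def)
    also have "\<dots> \<le> (\<Sum>h\<in>PiE A (\<lambda>_. {..K}). \<Prod>i\<in>A. x i ^ h i)"
      using A x le_K by (intro sum_mono2 finite_PiE) (auto intro!: prod_nonneg)
    also have "\<dots> = (\<Prod>i\<in>A. \<Sum>j\<le>K. x i ^ j)"
      using A by (subst prod_sum_PiE) auto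
    also have "\<dots> \<le> (\<Prod>i\<in>A. exp (2 * x i))"
    proof (intro prod_mono conjI)
      fix i
      show "0 \<le> (\<Sum>j\<le>K. x i ^ j)" using x by (intro sum_nonneg) auto
      have "(\<Sum>j\<le>K. x i ^ j) \<le> suminf (\<lambda>j. x i ^ j)"
        using x[of i] by (intro sum_le_suminf summable_geometric) auto
      also have "\<dots> = 1 / (1 - x i)" using x[of i] by (intro suminf_geometric) auto
      also have "\<dots> \<le> 1 + 2 * x i"
      proof -
        have "x i * x i \<le> x i * (1 / 4)" using x[of i] by (intro mult_left_mono) auto
        then have "1 \<le> (1 + 2 * x i) * (1 - x i)" using x[of i] by (simp add: algebra_simps)
        then show ?thesis using x[of i] by (simp add: pos_divide_le_eq)
      qed
      also have "\<dots> \<le> exp (2 * x i)" by (rule exp_ge_add_one_self)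
      finally show "(\<Sum>j\<le>K. x i ^ j) \<le> exp (2 * x i)" .
    qed
    also have "\<dots> = exp (2 * (\<Sum>i\<in>A. x i))"
      using A by (simp add: exp_sum sum_distrib_left)
    also have "\<dots> \<le> exp (2 * suminf x)"
      using A x sx by (simp add: sum_le_suminf)
    finally show ?thesis .
  qed
  show thesis
    by (rule that[OF _ bound]) auto
qed

lemma mi_le_addD: "mi_le (\<alpha> + \<beta>) \<delta> \<Longrightarrow> mi_le \<alpha> \<delta> \<and> mi_le \<beta> \<delta>"
  unfolding mi_le_def lookup_add by (meson add_leD1 add_leD2)

text \<open>The pair \<open>(0, \<gamma>)\<close> is left out because it couples the coefficient \<open>\<gamma>\<close> of a
  Wick product to itself; all other pairs refer to coefficients of strictly smaller order.\<close>

definition proper_splits :: "multi_index \<Rightarrow> (multi_index \<times> multi_index) set" where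
  "proper_splits \<gamma> = {(\<alpha>, \<beta>). \<alpha> + \<beta> = \<gamma> \<and> \<alpha> \<noteq> 0}"

lemma finite_proper_splits [simp]: "finite (proper_splits \<gamma>)"
  by (rule finite_subset[OF _ finite_mi_add[of \<gamma>]]) (auto simp: proper_splits_def)

lemma proper_splits_mi_abs_less: "(\<alpha>, \<beta>) \<in> proper_splits \<gamma> \<Longrightarrow> mi_abs \<beta> < mi_abs \<gamma>"
  using mi_abs_pos[of \<alpha>] by (auto simp: proper_splits_def mi_abs_add)

lemma sum_splits:
  fixes h :: "multi_index \<times> multi_index \<Rightarrow> 'a::comm_monoid_add"
  shows "sum h {(\<alpha>, \<beta>). \<alpha> + \<beta> = \<gamma>} = h (0, \<gamma>) + sum h (proper_splits \<gamma>)"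
proof -
  have "{(\<alpha>, \<beta>). \<alpha> + \<beta> = \<gamma>} = insert (0, \<gamma>) (proper_splits \<gamma>)"
    by (auto simp: proper_splits_def)
  moreover have "(0, \<gamma>) \<notin> proper_splits \<gamma>" by (simp add: proper_splits_def)
  ultimately show ?thesis by simp
qed

text \<open>The weights are multiplicative, so the weighted inequality reads
  \<open>X \<le> B + c * (\<Sum>\<alpha>\<noteq>0. weight \<alpha>) * X\<close> for the sum \<open>X\<close> of the left-hand sides. If the exponent is so
  large that the factor of \<open>X\<close> is at most \<open>1/2\<close>, then \<open>X \<le> 2 * B\<close>. To be allowed to subtract
  \<open>X/2\<close>, one first sums over the finite sets \<open>{\<gamma>. mi_le \<gamma> \<delta>}\<close>, which contain both parts of
  every splitting of their members.\<close>

lemma convolution_bound_summable: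
  fixes U b :: "multi_index \<Rightarrow> real"
  assumes U: "\<And>\<gamma>. 0 \<le> U \<gamma>" and b: "\<And>\<gamma>. 0 \<le> b \<gamma>" and c: "0 \<le> c"
    and le: "\<And>\<gamma>. U \<gamma> \<le> b \<gamma> + c * (\<Sum>(\<alpha>, \<beta>)\<in>proper_splits \<gamma>. U \<beta>)"
    and sum: "(\<lambda>\<gamma>. b \<gamma> * mi_weight (- r) \<gamma>) summable_on UNIV"
  obtains s where "0 \<le> s" "(\<lambda>\<gamma>. U \<gamma> * mi_weight (- s) \<gamma>) summable_on UNIV"
proof -
  obtain W where W: "0 \<le> W" "\<And>F. finite F \<Longrightarrow> (\<Sum>\<alpha>\<in>F. mi_weight (- 2) \<alpha>) \<le> W"
    by (rule sum_mi_weight_bounded) blast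
  \<comment> \<open>The exponent s is chosen such that c * W * 2 powr (2 - s) is at most 1/2.\<close>
  define X where "X = 2 * (c * W) + 1"
  have X: "1 \<le> X" using c W(1) by (simp add: X_def)
  define s where "s = max r (2 + log 2 X)"
  have s: "2 \<le> s" "r \<le> s"
    using X by (auto simp: s_def le_max_iff_disj)
  have small: "c * W * 2 powr (2 - s) \<le> 1 / 2"
  proof -
    have "2 powr (2 - s) \<le> 2 powr (- log 2 X)"
      by (intro powr_mono) (auto simp: s_def)
    also have "\<dots> = inverse X" using X by (simp add: powr_minus)
    finally have "c * W * 2 powr (2 - s) \<le> c * W * inverse X"
      using c W(1) by (intro mult_left_mono) auto
    also have "\<dots> \<le> 1 / 2" using X by (simp add: X_def field_simps)
    finally show ?thesis .
  qed
  let ?w = "mi_weight (- s)"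
  define B where "B = infsum (\<lambda>\<gamma>. b \<gamma> * mi_weight (- r) \<gamma>) UNIV"
  have down: "(\<Sum>\<gamma>\<in>{\<gamma>. mi_le \<gamma> \<delta>}. U \<gamma> * ?w \<gamma>) \<le> 2 * B" for \<delta>
  proof -
    let ?I = "{\<gamma>. mi_le \<gamma> \<delta>}"
    let ?X = "\<Sum>\<gamma>\<in>?I. U \<gamma> * ?w \<gamma>"
    have X0: "0 \<le> ?X" using U by (intro sum_nonneg) auto
    have fin: "finite ?I" by (rule finite_mi_le)
    have "(\<Sum>\<gamma>\<in>?I. (\<Sum>(\<alpha>, \<beta>)\<in>proper_splits \<gamma>. U \<beta>) * ?w \<gamma>)
        = (\<Sum>\<gamma>\<in>?I. \<Sum>p\<in>proper_splits \<gamma>. ?w (fst p) * (U (snd p) * ?w (snd p)))"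
      unfolding sum_distrib_right
      by (intro sum.cong refl) (auto simp: proper_splits_def mi_weight_add_index)
    also have "\<dots> = (\<Sum>(\<gamma>, p)\<in>Sigma ?I proper_splits. ?w (fst p) * (U (snd p) * ?w (snd p)))"
      by (subst sum.Sigma) (auto simp: fin)
    also have "\<dots> = (\<Sum>p\<in>snd ` Sigma ?I proper_splits. ?w (fst p) * (U (snd p) * ?w (snd p)))"
      by (subst sum.reindex) (auto simp: inj_on_def proper_splits_def o_def case_prod_beta)
    also have "\<dots> \<le> (\<Sum>p\<in>(?I - {0}) \<times> ?I. ?w (fst p) * (U (snd p) * ?w (snd p)))"
    proof (rule sum_mono2)
      show "snd ` Sigma ?I proper_splits \<subseteq> (?I - {0}) \<times> ?I"
        by (auto simp: proper_splits_def dest!: mi_le_addD)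
      show "0 \<le> ?w (fst p) * (U (snd p) * ?w (snd p))" for p
        using U by auto
    qed (use fin in auto)
    also have "\<dots> = (\<Sum>\<alpha>\<in>?I - {0}. ?w \<alpha>) * ?X"
      by (simp add: sum_product sum.cartesian_product case_prod_beta)
    also have "\<dots> \<le> (2 powr (2 - s) * W) * ?X"
    proof (rule mult_right_mono[OF _ X0])
      have "(\<Sum>\<alpha>\<in>?I - {0}. ?w \<alpha>) \<le> (\<Sum>\<alpha>\<in>?I - {0}. 2 powr (2 - s) * mi_weight (- 2) \<alpha>)"
        using s by (intro sum_mono mi_weight_nonzero_index) auto
      also have "\<dots> = 2 powr (2 - s) * (\<Sum>\<alpha>\<in>?I - {0}. mi_weight (- 2) \<alpha>)"
        by (rule sum_distrib_left[symmetric])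
      also have "\<dots> \<le> 2 powr (2 - s) * W"
        using fin by (intro mult_left_mono W) auto
      finally show "(\<Sum>\<alpha>\<in>?I - {0}. ?w \<alpha>) \<le> 2 powr (2 - s) * W" .
    qed
    finally have conv: "(\<Sum>\<gamma>\<in>?I. (\<Sum>(\<alpha>, \<beta>)\<in>proper_splits \<gamma>. U \<beta>) * ?w \<gamma>) \<le> (2 powr (2 - s) * W) * ?X" .
    have "?X \<le> (\<Sum>\<gamma>\<in>?I. (b \<gamma> + c * (\<Sum>(\<alpha>, \<beta>)\<in>proper_splits \<gamma>. U \<beta>)) * ?w \<gamma>)"
      by (intro sum_mono mult_right_mono le) auto
    also have "\<dots> = (\<Sum>\<gamma>\<in>?I. b \<gamma> * ?w \<gamma>) + c * (\<Sum>\<gamma>\<in>?I. (\<Sum>(\<alpha>, \<beta>)\<in>proper_splits \<gamma>. U \<beta>) * ?w \<gamma>)"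
      by (simp only: distrib_right sum.distrib mult.assoc sum_distrib_left[symmetric])
    also have "\<dots> \<le> B + c * ((2 powr (2 - s) * W) * ?X)"
    proof (intro add_mono mult_left_mono conv c)
      have "(\<Sum>\<gamma>\<in>?I. b \<gamma> * ?w \<gamma>) \<le> (\<Sum>\<gamma>\<in>?I. b \<gamma> * mi_weight (- r) \<gamma>)"
        using s b by (intro sum_mono mult_left_mono mi_weight_antimono) auto
      also have "\<dots> \<le> B"
        unfolding B_def using sum fin b by (intro finite_sum_le_infsum) auto
      finally show "(\<Sum>\<gamma>\<in>?I. b \<gamma> * ?w \<gamma>) \<le> B" .
    qed
    also have "c * ((2 powr (2 - s) * W) * ?X) = (c * W * 2 powr (2 - s)) * ?X"
      by (simp add: ac_simps)
    also have "B + \<dots> \<le> B + 1 / 2 * ?X"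
      using small X0 by (intro add_left_mono mult_right_mono)
    finally show ?thesis by simp
  qed
  show thesis
  proof (rule that)
    show "0 \<le> s" using s by simp
    show "(\<lambda>\<gamma>. U \<gamma> * ?w \<gamma>) summable_on UNIV"
    proof (rule nonneg_bdd_above_summable_on)
      show "bdd_above (sum (\<lambda>\<gamma>. U \<gamma> * ?w \<gamma>) ` {F. F \<subseteq> UNIV \<and> finite F})"
      proof (rule bdd_aboveI)
        fix y assume "y \<in> sum (\<lambda>\<gamma>. U \<gamma> * ?w \<gamma>) ` {F. F \<subseteq> UNIV \<and> finite F}"
        then obtain F where F: "finite F" "y = (\<Sum>\<gamma>\<in>F. U \<gamma> * ?w \<gamma>)" by auto
        have "mi_le \<gamma> (\<Sum>F)" if "\<gamma> \<in> F" for \<gamma>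
          using F(1) that by (subst sum.remove) (auto simp: mi_le_def lookup_add)
        then have "y \<le> (\<Sum>\<gamma>\<in>{\<gamma>. mi_le \<gamma> (\<Sum>F)}. U \<gamma> * ?w \<gamma>)"
          unfolding F(2) using U by (intro sum_mono2 finite_mi_le) auto
        then show "y \<le> 2 * B" using down[of "\<Sum>F"] by linarith
      qed
    qed (use U in auto)
  qed
qed

text \<open>The inequality \<open>2 * x * y \<le> x\<^sup>2 + y\<^sup>2\<close> trades square
  summability for summability at the cost of a summable weight.\<close>

lemma kondratiev_finite_imp_summable:
  assumes "kondratiev_finite N F p"
  shows "(\<lambda>\<gamma>. \<bar>N (F \<gamma>)\<bar> * mi_weight (- (p / 2 + 1)) \<gamma>) summable_on UNIV"
proof -
  obtain W where W: "\<And>F. finite F \<Longrightarrow> (\<Sum>\<alpha>\<in>F. mi_weight (- 2) \<alpha>) \<le> W"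
    by (rule sum_mi_weight_bounded) blast
  have "mi_weight (- 2) summable_on UNIV"
    using W by (intro nonneg_bdd_above_summable_on) (auto intro!: bdd_aboveI)
  with assms have "(\<lambda>\<gamma>. ((N (F \<gamma>))\<^sup>2 * mi_weight (- p) \<gamma> + mi_weight (- 2) \<gamma>) * (1 / 2)) summable_on UNIV"
    unfolding kondratiev_finite_def by (intro summable_on_cmult_left summable_on_add)
  then show ?thesis
  proof (rule summable_on_comparison_test)
    fix \<gamma>
    let ?x = "\<bar>N (F \<gamma>)\<bar> * mi_weight (- (p / 2)) \<gamma>" and ?y = "mi_weight (- 1) \<gamma>"
    have "\<bar>N (F \<gamma>)\<bar> * mi_weight (- (p / 2 + 1)) \<gamma> = ?x * ?y"
      using mi_weight_add_exponent[of "- (p / 2)" "- 1" \<gamma>] by (simp add: ac_simps)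
    also have "\<dots> \<le> (?x\<^sup>2 + ?y\<^sup>2) * (1 / 2)"
      using sum_squares_bound[of ?x ?y] by simp
    also have "?x\<^sup>2 = (N (F \<gamma>))\<^sup>2 * mi_weight (- p) \<gamma>"
      using mi_weight_add_exponent[of "- (p / 2)" "- (p / 2)" \<gamma>] by (simp add: power_mult_distrib power2_eq_square)
    also have "?y\<^sup>2 = mi_weight (- 2) \<gamma>"
      using mi_weight_add_exponent[of "- 1" "- 1" \<gamma>] by (simp add: power2_eq_square)
    finally show "\<bar>N (F \<gamma>)\<bar> * mi_weight (- (p / 2 + 1)) \<gamma>
      \<le> ((N (F \<gamma>))\<^sup>2 * mi_weight (- p) \<gamma> + mi_weight (- 2) \<gamma>) * (1 / 2)" .
  qed simp
qed

lemma summable_imp_kondratiev_finite: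
  assumes N: "\<And>\<gamma>. 0 \<le> N (F \<gamma>)"
    and sum: "(\<lambda>\<gamma>. N (F \<gamma>) * mi_weight (- s) \<gamma>) summable_on UNIV"
  shows "kondratiev_finite N F (2 * s)"
  unfolding kondratiev_finite_def
proof -
  let ?v = "\<lambda>\<gamma>. N (F \<gamma>) * mi_weight (- s) \<gamma>"
  define B where "B = infsum ?v UNIV"
  have v0: "0 \<le> ?v \<gamma>" for \<gamma> using N by simp
  have vB: "?v \<gamma> \<le> B" for \<gamma>
    using finite_sum_le_infsum[OF sum, of "{\<gamma>}"] v0 by (simp add: B_def)
  show "(\<lambda>\<gamma>. (N (F \<gamma>))\<^sup>2 * mi_weight (- (2 * s)) \<gamma>) summable_on UNIV"
  proof (rule summable_on_comparison_test)
    show "(\<lambda>\<gamma>. B * ?v \<gamma>) summable_on UNIV"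
      using sum by (rule summable_on_cmult_right)
    fix \<gamma>
    have "(N (F \<gamma>))\<^sup>2 * mi_weight (- (2 * s)) \<gamma> = ?v \<gamma> * ?v \<gamma>"
      using mi_weight_add_exponent[of "- s" "- s" \<gamma>] by (simp add: power2_eq_square)
    also have "\<dots> \<le> B * ?v \<gamma>"
      by (intro mult_right_mono vB v0)
    finally show "(N (F \<gamma>))\<^sup>2 * mi_weight (- (2 * s)) \<gamma> \<le> B * ?v \<gamma>" .
  qed simp
qed

section \<open>Resummation over ordered decompositions\<close>

definition decomposition_sum :: "(multi_index \<Rightarrow> real) \<Rightarrow> nat \<Rightarrow> multi_index \<Rightarrow> real" where
  "decomposition_sum n k \<delta> = (\<Sum>\<theta>\<in>decompositions k \<delta>. \<Prod>\<eta>\<leftarrow>\<theta>. n \<eta>)"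

lemma decomposition_sum_0: "decomposition_sum n 0 \<delta> = (if \<delta> = 0 then 1 else 0)"
proof -
  have "decompositions 0 \<delta> = (if \<delta> = 0 then {[]} else {})"
    by (auto simp: decompositions_def)
  then show ?thesis by (simp add: decomposition_sum_def)
qed

lemma decomposition_sum_Suc:
  "decomposition_sum n (Suc k) \<delta> = (\<Sum>(\<alpha>, \<beta>)\<in>proper_splits \<delta>. n \<alpha> * decomposition_sum n k \<beta>)"
proof -
  have "(\<Sum>(\<alpha>, \<beta>)\<in>proper_splits \<delta>. n \<alpha> * decomposition_sum n k \<beta>)
      = (\<Sum>p\<in>proper_splits \<delta>. \<Sum>\<theta>\<in>decompositions k (snd p). n (fst p) * (\<Prod>\<eta>\<leftarrow>\<theta>. n \<eta>))"
    by (simp add: decomposition_sum_def sum_distrib_left case_prod_beta)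
  also have "\<dots> = (\<Sum>(p, \<theta>)\<in>Sigma (proper_splits \<delta>) (\<lambda>p. decompositions k (snd p)). n (fst p) * (\<Prod>\<eta>\<leftarrow>\<theta>. n \<eta>))"
    by (subst sum.Sigma) (auto simp: finite_decompositions)
  also have "\<dots> = decomposition_sum n (Suc k) \<delta>"
    unfolding decomposition_sum_def
    by (rule sum.reindex_bij_witness[where i = "\<lambda>\<theta>. ((hd \<theta>, sum_list (tl \<theta>)), tl \<theta>)"
          and j = "\<lambda>(p, \<theta>). fst p # \<theta>"])
       (auto simp: decompositions_def proper_splits_def length_Suc_conv)
  finally show ?thesis by (rule sym)
qed

text \<open>A sum of \<open>k\<close> nonzero multi-indices has order at least \<open>k\<close>.\<close>

lemma decomposition_sum_eq_0:
  assumes "mi_abs \<delta> < k"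
  shows "decomposition_sum n k \<delta> = 0"
proof -
  have "length \<theta> \<le> mi_abs (sum_list \<theta>)" if "\<forall>\<eta>\<in>set \<theta>. \<eta> \<noteq> 0" for \<theta>
    using that
  proof (induction \<theta>)
    case (Cons \<eta> \<theta>)
    then show ?case using mi_abs_pos[of \<eta>] by (auto simp: mi_abs_add)
  qed simp
  then have "decompositions k \<delta> = {}"
    using assms by (fastforce simp: decompositions_def)
  then show ?thesis by (simp add: decomposition_sum_def)
qed

text \<open>The summand of order \<open>k\<close> collects what reaches the coefficient \<open>\<gamma>\<close> from the
  data \<open>a \<beta>\<close> by \<open>k\<close> successive multiplications with coefficients of the potential; each of
  them costs a time integration, hence a factor \<open>m\<close>.\<close>

definition chaos_bound :: "real \<Rightarrow> (multi_index \<Rightarrow> real) \<Rightarrow> (multi_index \<Rightarrow> real) \<Rightarrow> multi_index \<Rightarrow> real" where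
  "chaos_bound m n a \<gamma> = a \<gamma> + (\<Sum>k=1..mi_abs \<gamma>. m ^ k *
     (\<Sum>\<beta>\<in>{\<beta>. mi_less \<beta> \<gamma> \<and> mi_abs \<beta> \<le> mi_abs \<gamma> - k}. a \<beta> * decomposition_sum n k (\<gamma> - \<beta>)))"

lemma mi_le_iff_add: "mi_le \<beta> \<gamma> \<longleftrightarrow> \<beta> + (\<gamma> - \<beta>) = \<gamma>"
  by (auto simp: mi_le_def poly_mapping_eq_iff fun_eq_iff lookup_add lookup_minus)
     (metis le_add1)

text \<open>The side conditions on \<open>\<beta>\<close> and the upper limit for \<open>k\<close> only remove
  terms that vanish, because there \<open>\<gamma> - \<beta>\<close> has no decomposition into \<open>k\<close> nonzero parts. Without
  them the term of order \<open>k\<close> is a convolution, and one cut-off \<open>K\<close> serves all smaller indices at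
  once.\<close>

lemma chaos_bound_convolution:
  assumes K: "mi_abs \<gamma> \<le> K"
  shows "chaos_bound m n a \<gamma>
    = (\<Sum>k\<le>K. m ^ k * (\<Sum>(\<beta>, \<delta>)\<in>{(\<beta>, \<delta>). \<beta> + \<delta> = \<gamma>}. a \<beta> * decomposition_sum n k \<delta>))"
proof -
  let ?P = "{(\<beta>, \<delta>). \<beta> + \<delta> = \<gamma>}"
  let ?c = "\<lambda>k. \<Sum>(\<beta>, \<delta>)\<in>?P. a \<beta> * decomposition_sum n k \<delta>"
  have fin: "finite ?P" by (rule finite_mi_add)
  have c0: "?c 0 = a \<gamma>"
  proof -
    have "?c 0 = (\<Sum>(\<beta>, \<delta>)\<in>{(\<gamma>, 0)}. a \<beta> * decomposition_sum n 0 \<delta>)"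
      using fin by (intro sum.mono_neutral_right) (auto simp: decomposition_sum_0 split: if_splits)
    then show ?thesis by (simp add: decomposition_sum_0)
  qed
  have ck: "(\<Sum>\<beta>\<in>{\<beta>. mi_less \<beta> \<gamma> \<and> mi_abs \<beta> \<le> mi_abs \<gamma> - k}. a \<beta> * decomposition_sum n k (\<gamma> - \<beta>)) = ?c k"
    if k: "k \<in> {1..mi_abs \<gamma>}" for k
  proof -
    let ?B = "{\<beta>. mi_less \<beta> \<gamma> \<and> mi_abs \<beta> \<le> mi_abs \<gamma> - k}"
    have split: "\<beta> + (\<gamma> - \<beta>) = \<gamma>" if "\<beta> \<in> ?B" for \<beta>
      using that by (simp add: mi_less_def mi_le_iff_add)
    have "(\<Sum>\<beta>\<in>?B. a \<beta> * decomposition_sum n k (\<gamma> - \<beta>))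
        = (\<Sum>(\<beta>, \<delta>)\<in>(\<lambda>\<beta>. (\<beta>, \<gamma> - \<beta>)) ` ?B. a \<beta> * decomposition_sum n k \<delta>)"
      by (subst sum.reindex) (auto simp: inj_on_def)
    also have "\<dots> = ?c k"
    proof (rule sum.mono_neutral_left[OF fin])
      show "(\<lambda>\<beta>. (\<beta>, \<gamma> - \<beta>)) ` ?B \<subseteq> ?P" using split by auto
      show "\<forall>p\<in>?P - (\<lambda>\<beta>. (\<beta>, \<gamma> - \<beta>)) ` ?B. (case p of (\<beta>, \<delta>) \<Rightarrow> a \<beta> * decomposition_sum n k \<delta>) = 0"
      proof (clarify)
        fix \<beta> \<delta> assume \<gamma>: "\<gamma> = \<beta> + \<delta>" and no: "(\<beta>, \<delta>) \<notin> (\<lambda>\<beta>'. (\<beta>', \<beta> + \<delta> - \<beta>')) ` {\<beta>'. mi_less \<beta>' (\<beta> + \<delta>) \<and> mi_abs \<beta>' \<le> mi_abs (\<beta> + \<delta>) - k}"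
        have "mi_abs \<delta> < k"
        proof (rule ccontr)
          assume "\<not> mi_abs \<delta> < k"
          then have le: "mi_abs \<beta> \<le> mi_abs (\<beta> + \<delta>) - k" by (simp add: mi_abs_add)
          have "\<delta> \<noteq> 0" using \<open>\<not> mi_abs \<delta> < k\<close> k by auto
          then have "mi_less \<beta> (\<beta> + \<delta>)" by (simp add: mi_less_def mi_le_def lookup_add)
          then show False using no le by force
        qed
        then show "a \<beta> * decomposition_sum n k \<delta> = 0" by (simp add: decomposition_sum_eq_0)
      qed
    qed
    finally show ?thesis .
  qed
  have "(\<Sum>k\<le>K. m ^ k * ?c k) = (\<Sum>k\<le>mi_abs \<gamma>. m ^ k * ?c k)"
  proof (rule sum.mono_neutral_right)
    show "\<forall>k\<in>{..K} - {..mi_abs \<gamma>}. m ^ k * ?c k = 0"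
      by (auto intro!: sum.neutral decomposition_sum_eq_0 disjI2 simp: mi_abs_add)
  qed (use K in auto)
  also have "\<dots> = ?c 0 + (\<Sum>k=1..mi_abs \<gamma>. m ^ k * ?c k)"
    by (subst atMost_atLeast0, subst sum.atLeast_Suc_atMost) auto
  also have "\<dots> = chaos_bound m n a \<gamma>"
    unfolding chaos_bound_def c0 using ck by (intro arg_cong2[where f = "(+)"] refl sum.cong) auto
  finally show ?thesis by (rule sym)
qed

text \<open>This is the recursion that the a priori bounds of the coefficients satisfy;
  \<open>\<alpha>\<close> is the first entry of the decomposition.\<close>

lemma chaos_bound_recursion:
  "chaos_bound m n a \<gamma> = a \<gamma> + m * (\<Sum>(\<alpha>, \<beta>)\<in>proper_splits \<gamma>. n \<alpha> * chaos_bound m n a \<beta>)"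
proof -
  let ?P = "\<lambda>\<gamma>::multi_index. {(\<beta>, \<delta>). \<beta> + \<delta> = \<gamma>}"
  let ?c = "\<lambda>k \<gamma>. \<Sum>(\<beta>, \<delta>)\<in>?P \<gamma>. a \<beta> * decomposition_sum n k \<delta>"
  let ?K = "mi_abs \<gamma>"
  have swap: "?c (Suc k) \<gamma> = (\<Sum>(\<alpha>, \<beta>)\<in>proper_splits \<gamma>. n \<alpha> * ?c k \<beta>)" for k
  proof -
    have "?c (Suc k) \<gamma> = (\<Sum>p\<in>?P \<gamma>. \<Sum>r\<in>proper_splits (snd p). a (fst p) * (n (fst r) * decomposition_sum n k (snd r)))"
      by (simp add: decomposition_sum_Suc sum_distrib_left case_prod_beta)
    also have "\<dots> = (\<Sum>(p, r)\<in>Sigma (?P \<gamma>) (\<lambda>p. proper_splits (snd p)). a (fst p) * (n (fst r) * decomposition_sum n k (snd r)))"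
      by (subst sum.Sigma) (auto simp: finite_mi_add)
    also have "\<dots> = (\<Sum>(p, r)\<in>Sigma (proper_splits \<gamma>) (\<lambda>p. ?P (snd p)). n (fst p) * (a (fst r) * decomposition_sum n k (snd r)))"
      by (rule sum.reindex_bij_witness[where
            i = "\<lambda>(p, r). ((fst r, fst p + snd r), (fst p, snd r))" and
            j = "\<lambda>(p, r). ((fst r, fst p + snd r), (fst p, snd r))"])
         (auto simp: proper_splits_def ac_simps)
    also have "\<dots> = (\<Sum>p\<in>proper_splits \<gamma>. \<Sum>r\<in>?P (snd p). n (fst p) * (a (fst r) * decomposition_sum n k (snd r)))"
      by (subst sum.Sigma) (auto simp: finite_mi_add)
    also have "\<dots> = (\<Sum>(\<alpha>, \<beta>)\<in>proper_splits \<gamma>. n \<alpha> * ?c k \<beta>)"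
      by (simp add: sum_distrib_left case_prod_beta)
    finally show ?thesis .
  qed
  have "(\<Sum>(\<alpha>, \<beta>)\<in>proper_splits \<gamma>. n \<alpha> * chaos_bound m n a \<beta>)
      = (\<Sum>p\<in>proper_splits \<gamma>. \<Sum>k\<le>?K. m ^ k * (n (fst p) * ?c k (snd p)))"
  proof (rule sum.cong[OF refl])
    fix p assume p: "p \<in> proper_splits \<gamma>"
    have "mi_abs (snd p) \<le> ?K"
      using proper_splits_mi_abs_less[of "fst p" "snd p" \<gamma>] p by simp
    then have "chaos_bound m n a (snd p) = (\<Sum>k\<le>?K. m ^ k * ?c k (snd p))"
      by (rule chaos_bound_convolution)
    then show "(case p of (\<alpha>, \<beta>) \<Rightarrow> n \<alpha> * chaos_bound m n a \<beta>) = (\<Sum>k\<le>?K. m ^ k * (n (fst p) * ?c k (snd p)))"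
      by (simp add: case_prod_beta sum_distrib_left ac_simps)
  qed
  also have "\<dots> = (\<Sum>k\<le>?K. m ^ k * ?c (Suc k) \<gamma>)"
    unfolding swap by (subst sum.swap) (simp add: sum_distrib_left case_prod_beta)
  finally have "m * (\<Sum>(\<alpha>, \<beta>)\<in>proper_splits \<gamma>. n \<alpha> * chaos_bound m n a \<beta>) = (\<Sum>k\<le>?K. m ^ Suc k * ?c (Suc k) \<gamma>)"
    by (simp add: sum_distrib_left mult.assoc)
  moreover have "?c 0 \<gamma> = a \<gamma>"
  proof -
    have "?c 0 \<gamma> = (\<Sum>(\<beta>, \<delta>)\<in>{(\<gamma>, 0)}. a \<beta> * decomposition_sum n 0 \<delta>)"
      using finite_mi_add[of \<gamma>] by (intro sum.mono_neutral_right) (auto simp: decomposition_sum_0 split: if_splits)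
    then show ?thesis by (simp add: decomposition_sum_0)
  qed
  moreover have "chaos_bound m n a \<gamma> = (\<Sum>k\<le>Suc ?K. m ^ k * ?c k \<gamma>)"
    by (rule chaos_bound_convolution) simp
  ultimately show ?thesis
    by (subst (asm) sum.atMost_Suc_shift) simp
qed

lemma decomposition_sum_nonneg:
  assumes "\<And>\<eta>. 0 \<le> n \<eta>"
  shows "0 \<le> decomposition_sum n k \<delta>"
proof -
  have "0 \<le> (\<Prod>\<eta>\<leftarrow>\<theta>. n \<eta>)" for \<theta>
    by (induction \<theta>) (auto simp: assms)
  then show ?thesis by (simp add: decomposition_sum_def sum_nonneg)
qed

lemma chaos_bound_mono:
  assumes "0 \<le> m" "m \<le> m'" "\<And>\<eta>. 0 \<le> n \<eta>" "\<And>\<beta>. 0 \<le> a \<beta>" "\<And>\<beta>. a \<beta> \<le> a' \<beta>"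
  shows "chaos_bound m n a \<gamma> \<le> chaos_bound m' n a' \<gamma>"
  unfolding chaos_bound_def using assms decomposition_sum_nonneg[of n] order_trans[OF assms(4,5)]
  by (intro add_mono sum_mono mult_mono power_mono sum_nonneg mult_nonneg_nonneg) auto

section \<open>Absolutely continuous functions\<close>

text \<open>Of the properties that make up absolute continuity this is the integral
  representation alone, which bounded operators and finite sums preserve by linearity.\<close>

definition primitive_on :: "real \<Rightarrow> (real \<Rightarrow> 'x::{banach,second_countable_topology}) \<Rightarrow> (real \<Rightarrow> 'x) \<Rightarrow> bool" where
  "primitive_on T f f' \<longleftrightarrow> set_integrable lborel {0..T} f' \<and>
     (\<forall>t\<in>{0..T}. f t = f 0 + (LINT s:{0..t}|lborel. f' s))"

lemma AC_primitive_on: "f \<in> AC T X \<Longrightarrow> \<exists>f'. primitive_on T f f'"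
  unfolding AC_def primitive_on_def by blast

lemma primitive_on_eq:
  "primitive_on T f f' \<Longrightarrow> t \<in> {0..T} \<Longrightarrow> f t = f 0 + (LINT s:{0..t}|lborel. f' s)"
  unfolding primitive_on_def by blast

lemma primitive_on_integrable:
  "primitive_on T f f' \<Longrightarrow> t \<in> {0..T} \<Longrightarrow> set_integrable lborel {0..t} f'"
  by (rule set_integrable_subset[of lborel "{0..T}"]) (auto simp: primitive_on_def)

lemma primitive_on_bounded_linear:
  assumes B: "bounded_linear B" and f: "primitive_on T f f'"
  shows "primitive_on T (\<lambda>t. B (f t)) (\<lambda>t. B (f' t))"
proof -
  have B_ind: "indicator A s *\<^sub>R B x = B (indicator A s *\<^sub>R x)" for A :: "real set" and s :: real and x
    using B by (simp add: bounded_linear.linear linear_scale)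
  have int: "set_integrable lborel {0..t} (\<lambda>s. B (f' s))"
    "(LINT s:{0..t}|lborel. B (f' s)) = B (LINT s:{0..t}|lborel. f' s)" if "t \<in> {0..T}" for t
    using primitive_on_integrable[OF f that]
    unfolding set_integrable_def set_lebesgue_integral_def B_ind
    by (auto intro: integrable_bounded_linear[OF B] integral_bounded_linear[OF B])
  show ?thesis
    unfolding primitive_on_def
  proof (intro conjI ballI)
    show "set_integrable lborel {0..T} (\<lambda>s. B (f' s))"
      unfolding set_integrable_def B_ind
      by (rule integrable_bounded_linear[OF B]) (use f in \<open>simp add: primitive_on_def set_integrable_def\<close>)
    fix t assume t: "t \<in> {0..T}"
    have "B (f t) = B (f 0 + (LINT s:{0..t}|lborel. f' s))"
      by (rule arg_cong[OF primitive_on_eq[OF f t]])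
    also have "\<dots> = B (f 0) + (LINT s:{0..t}|lborel. B (f' s))"
      using B by (simp add: bounded_linear.linear linear_add int(2)[OF t])
    finally show "B (f t) = B (f 0) + (LINT s:{0..t}|lborel. B (f' s))" .
  qed
qed

lemma primitive_on_diff:
  assumes "primitive_on T f f'" "primitive_on T h h'"
  shows "primitive_on T (\<lambda>t. f t - h t) (\<lambda>t. f' t - h' t)"
proof -
  show ?thesis
    unfolding primitive_on_def
  proof (intro conjI ballI)
    show "set_integrable lborel {0..T} (\<lambda>t. f' t - h' t)"
      using assms by (intro set_integral_diff) (auto simp: primitive_on_def)
    fix t assume t: "t \<in> {0..T}"
    have "(LINT s:{0..t}|lborel. f' s - h' s) = (LINT s:{0..t}|lborel. f' s) - (LINT s:{0..t}|lborel. h' s)"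
      by (intro set_integral_diff primitive_on_integrable[OF assms(1) t] primitive_on_integrable[OF assms(2) t])
    then show "f t - h t = f 0 - h 0 + (LINT s:{0..t}|lborel. f' s - h' s)"
      using primitive_on_eq[OF assms(1) t] primitive_on_eq[OF assms(2) t] by (metis add_diff_add)
  qed
qed

lemma primitive_on_diff_sum:
  assumes "finite I" "primitive_on T f f'" "\<And>i. i \<in> I \<Longrightarrow> \<exists>h'. primitive_on T (h i) h'"
  shows "\<exists>k. primitive_on T (\<lambda>t. f t - (\<Sum>i\<in>I. h i t)) k"
  using assms
proof (induction I rule: finite_induct)
  case empty
  then show ?case by auto
next
  case (insert i I)
  then obtain k where "primitive_on T (\<lambda>t. f t - (\<Sum>i\<in>I. h i t)) k" by auto
  moreover obtain h' where "primitive_on T (h i) h'" using insert.prems by blast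
  ultimately have "primitive_on T (\<lambda>t. (f t - (\<Sum>i\<in>I. h i t)) - h i t) (\<lambda>t. k t - h' t)"
    by (rule primitive_on_diff)
  with insert.hyps show ?case
    by (auto simp: algebra_simps)
qed

lemma primitive_on_continuous:
  assumes "primitive_on T f f'"
  shows "continuous_on {0..T} f"
proof -
  have int: "integrable lborel (\<lambda>s. indicator {0..T} s *\<^sub>R f' s)"
    using assms by (simp add: primitive_on_def set_integrable_def)
  have "continuous_on {0..T} (\<lambda>t. LINT s:{0..t}|lborel. f' s)"
    unfolding continuous_on_def set_lebesgue_integral_def
  proof
    fix t assume t: "t \<in> {0..T}"
    let ?F = "\<lambda>s. indicator {0..T} s *\<^sub>R f' s"
    have meas: "(\<lambda>s. indicator {0..y} s *\<^sub>R ?F s) \<in> borel_measurable lborel" for y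
      by (rule borel_measurable_scaleR[OF _ borel_measurable_integrable[OF int]]) auto
    have lim: "((\<lambda>y. \<integral>s. indicator {0..y} s *\<^sub>R ?F s \<partial>lborel)
        \<longlongrightarrow> (\<integral>s. indicator {0..t} s *\<^sub>R ?F s \<partial>lborel)) (at t within {0..T})"
    proof (rule tendsto_integral_at_within)
      show "integrable lborel (\<lambda>s. norm (?F s))" using int by (rule integrable_norm)
      have "((\<lambda>y. indicator {0..y} s *\<^sub>R ?F s) \<longlongrightarrow> indicator {0..t} s *\<^sub>R ?F s) (at t within {0..T})"
        if "s \<noteq> t" for s
      proof (rule Lim_transform_eventually[OF tendsto_const])
        have "\<forall>\<^sub>F y in at t within {0..T}. (if s < t then s < y else y < s)"
          using that order_tendstoD(1)[OF tendsto_ident_at[of t "{0..T}"], of s]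
            order_tendstoD(2)[OF tendsto_ident_at[of t "{0..T}"], of s]
          by (cases "s < t") auto
        then show "\<forall>\<^sub>F y in at t within {0..T}. indicator {0..t} s *\<^sub>R ?F s = indicator {0..y} s *\<^sub>R ?F s"
          by eventually_elim (use that in \<open>auto simp: indicator_def split: if_splits\<close>)
      qed
      then show "AE s in lborel. ((\<lambda>y. indicator {0..y} s *\<^sub>R ?F s) \<longlongrightarrow> indicator {0..t} s *\<^sub>R ?F s) (at t within {0..T})"
        using AE_lborel_singleton[of t] by (auto elim: eventually_mono)
      show "AE s in lborel. norm (indicator {0..y} s *\<^sub>R ?F s) \<le> norm (?F s)" for y
        by (auto simp: indicator_def)
    qed (rule meas)+
    have eq: "(\<integral>s. indicator {0..y} s *\<^sub>R ?F s \<partial>lborel) = (\<integral>s. indicator {0..y} s *\<^sub>R f' s \<partial>lborel)"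
      if "y \<le> T" for y
      by (rule Bochner_Integration.integral_cong) (use that in \<open>auto simp: indicator_def\<close>)
    have "\<forall>\<^sub>F y in at t within {0..T}. (\<integral>s. indicator {0..y} s *\<^sub>R ?F s \<partial>lborel) = (\<integral>s. indicator {0..y} s *\<^sub>R f' s \<partial>lborel)"
      using eq by (auto simp: eventually_at_filter)
    from Lim_transform_eventually[OF lim this] eq[of t]
    show "((\<lambda>t. \<integral>s. indicator {0..t} s *\<^sub>R f' s \<partial>lborel)
        \<longlongrightarrow> (\<integral>s. indicator {0..t} s *\<^sub>R f' s \<partial>lborel)) (at t within {0..T})"
      using t by (simp only: atLeastAtMost_iff)
  qed
  then have "continuous_on {0..T} (\<lambda>t. f 0 + (LINT s:{0..t}|lborel. f' s))"
    by (intro continuous_intros)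
  then show ?thesis
    by (rule continuous_on_eq) (rule primitive_on_eq[OF assms, symmetric])
qed

lemma AC_continuous: "f \<in> AC T X \<Longrightarrow> continuous_on {0..T} f"
  using AC_primitive_on primitive_on_continuous by blast

lemma C1_restrict_in_AC:
  assumes T: "0 \<le> T" and X: "\<And>t. t \<in> {0..T} \<Longrightarrow> u t \<in> X"
    and u: "\<And>t. t \<in> {0..T} \<Longrightarrow> (u has_vector_derivative z t) (at t within {0..T})"
    and z: "continuous_on {0..T} z"
  shows "restrict u {0..T} \<in> AC T X"
    and "\<And>t. t \<in> {0..T} \<Longrightarrow> (restrict u {0..T} has_vector_derivative z t) (at t within {0..T})"
proof -
  show der: "(restrict u {0..T} has_vector_derivative z t) (at t within {0..T})" if "t \<in> {0..T}" for t
    using u[OF that] that by (rule has_vector_derivative_transform[rotated 2]) auto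
  have eq: "restrict u {0..T} t = restrict u {0..T} 0 + (LINT s:{0..t}|lborel. z s)" if "t \<in> {0..T}" for t
    using LINT_derivative[OF u z that] that by simp
  have "set_integrable lborel {0..T} z"
    unfolding set_integrable_def by (rule borel_integrable_compact[OF compact_Icc z])
  moreover have "restrict u {0..T} \<in> {0..T} \<rightarrow>\<^sub>E X" using X by auto
  ultimately show "restrict u {0..T} \<in> AC T X"
    unfolding AC_def using eq der by blast
qed

lemma norm_le_sup_norm:
  assumes "continuous_on {0..T} v" "t \<in> {0..T}"
  shows "norm (v t) \<le> sup_norm T v"
  unfolding sup_norm_def
proof (rule cSUP_upper[OF assms(2)])
  have "compact ((\<lambda>t. norm (v t)) ` {0..T})"
    by (intro compact_continuous_image continuous_intros assms) auto
  then show "bdd_above ((\<lambda>t. norm (v t)) ` {0..T})"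
    by (intro bounded_imp_bdd_above compact_imp_bounded)
qed

lemma sup_norm_le: "0 \<le> T \<Longrightarrow> (\<And>t. t \<in> {0..T} \<Longrightarrow> norm (v t) \<le> c) \<Longrightarrow> sup_norm T v \<le> c"
  unfolding sup_norm_def by (rule cSUP_least) auto

lemma sup_norm_nonneg: "0 \<le> T \<Longrightarrow> continuous_on {0..T} v \<Longrightarrow> 0 \<le> sup_norm T v"
  using norm_le_sup_norm[of T v 0] norm_ge_zero[of "v 0"] by (simp del: norm_ge_zero)

section \<open>The system of chaos coefficients\<close>

text \<open>The triangular system for the chaos coefficients. Multiplication by the coefficients
  of the potential is replaced by arbitrary bounded operators \<open>B \<alpha>\<close> with norm bounds \<open>\<nu> \<alpha>\<close>.\<close>

locale wick_problem = C0_semigroup_growth S M w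
  for S :: "real \<Rightarrow> 'x::{banach,second_countable_topology} \<Rightarrow> 'x" and M w +
  fixes T :: real and B :: "multi_index \<Rightarrow> 'x \<Rightarrow> 'x" and \<nu> :: "multi_index \<Rightarrow> real"
    and f :: "multi_index \<Rightarrow> real \<Rightarrow> 'x" and g :: "multi_index \<Rightarrow> 'x"
  assumes T_pos: "0 < T" and bounded_linear_B: "bounded_linear (B \<alpha>)"
    and norm_B: "norm (B \<alpha> x) \<le> \<nu> \<alpha> * norm x"
    and \<nu>_nonneg: "0 \<le> \<nu> \<alpha>" and \<nu>_le: "\<nu> \<alpha> \<le> \<nu> 0"
    and f_AC: "f \<gamma> \<in> AC T UNIV"
    and g_domain: "\<exists>y. in_generator (g \<gamma>) y"
begin

abbreviation domain :: "'x set" where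
  "domain \<equiv> {x. \<exists>y. in_generator x y}"

definition source :: "(multi_index \<Rightarrow> real \<Rightarrow> 'x) \<Rightarrow> multi_index \<Rightarrow> real \<Rightarrow> 'x" where
  "source u \<gamma> t = f \<gamma> t - (\<Sum>(\<alpha>, \<beta>)\<in>proper_splits \<gamma>. B \<alpha> (u \<beta> t))"

text \<open>The function \<open>v\<close> solves the equation of index \<open>\<gamma>\<close> when the coefficients
  of smaller order are those of \<open>u\<close>.\<close>

definition coefficient_solution :: "(multi_index \<Rightarrow> real \<Rightarrow> 'x) \<Rightarrow> multi_index \<Rightarrow> (real \<Rightarrow> 'x) \<Rightarrow> bool" where
  "coefficient_solution u \<gamma> v \<longleftrightarrow> v \<in> AC T domain \<and> v 0 = g \<gamma> \<and>
     (\<forall>t\<in>{0<..T}. \<exists>v'. (v has_vector_derivative v') (at t within {0..T}) \<and>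
        in_generator (v t) (v' + B 0 (v t) - source u \<gamma> t))"

definition wick_solution :: "(multi_index \<Rightarrow> real \<Rightarrow> 'x) \<Rightarrow> bool" where
  "wick_solution u \<longleftrightarrow> (\<forall>\<gamma>. coefficient_solution u \<gamma> (u \<gamma>))"

abbreviation rate :: real where
  "rate \<equiv> w + M * \<nu> 0"

lemma source_cong:
  assumes "\<And>\<beta>. mi_abs \<beta> < mi_abs \<gamma> \<Longrightarrow> u \<beta> = u' \<beta>"
  shows "source u \<gamma> = source u' \<gamma>"
proof
  fix t
  have "(\<Sum>(\<alpha>, \<beta>)\<in>proper_splits \<gamma>. B \<alpha> (u \<beta> t)) = (\<Sum>(\<alpha>, \<beta>)\<in>proper_splits \<gamma>. B \<alpha> (u' \<beta> t))"
    using assms proper_splits_mi_abs_less by (intro sum.cong refl) (auto split: prod.split)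
  then show "source u \<gamma> t = source u' \<gamma> t" by (simp add: source_def)
qed

text \<open>The source is a finite sum of images of absolutely continuous
  functions under bounded operators, hence absolutely continuous, and the initial value lies in the domain of the
  generator.\<close>

lemma coefficient_solution_exists:
  assumes u: "\<And>\<beta>. mi_abs \<beta> < mi_abs \<gamma> \<Longrightarrow> u \<beta> \<in> AC T domain"
  shows "\<exists>v. coefficient_solution u \<gamma> v"
proof -
  have T: "0 \<le> T" using T_pos by simp
  obtain f' where "primitive_on T (f \<gamma>) f'" using AC_primitive_on[OF f_AC] by blast
  moreover have "\<exists>h'. primitive_on T (\<lambda>t. B (fst p) (u (snd p) t)) h'" if "p \<in> proper_splits \<gamma>" for p
    using AC_primitive_on[OF u[OF proper_splits_mi_abs_less[of "fst p" "snd p"]]] that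
      primitive_on_bounded_linear[OF bounded_linear_B] by auto blast
  ultimately have "\<exists>k. primitive_on T (\<lambda>t. f \<gamma> t - (\<Sum>p\<in>proper_splits \<gamma>. B (fst p) (u (snd p) t))) k"
    by (intro primitive_on_diff_sum) auto
  then obtain k where k: "primitive_on T (source u \<gamma>) k"
    by (auto simp: source_def[abs_def] case_prod_beta)
  obtain g' where g': "in_generator (g \<gamma>) g'" using g_domain by blast
  have k_int: "set_integrable lborel {0..T} k"
    and k_eq: "\<And>t. t \<in> {0..T} \<Longrightarrow> source u \<gamma> t = source u \<gamma> 0 + (LINT s:{0..t}|lborel. k s)"
    using k unfolding primitive_on_def by blast+
  obtain v z where z: "continuous_on {0..T} z" and v0: "v 0 = g \<gamma>"
    and der: "\<And>t. t \<in> {0..T} \<Longrightarrow> (v has_vector_derivative z t) (at t within {0..T})"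
    and gen: "\<And>t. t \<in> {0..T} \<Longrightarrow> in_generator (v t) (z t + B 0 (v t) - source u \<gamma> t)"
    by (rule classical_solution_exists[OF T bounded_linear_B[of 0] k_int _ g']) (erule k_eq, (rule that; blast))
  have v_dom: "v t \<in> domain" if "t \<in> {0..T}" for t using gen[OF that] by blast
  have AC: "restrict v {0..T} \<in> AC T domain"
    by (rule C1_restrict_in_AC(1)[OF T v_dom der z])
  have AC_der: "(restrict v {0..T} has_vector_derivative z t) (at t within {0..T})" if "t \<in> {0..T}" for t
    by (rule C1_restrict_in_AC(2)[OF T v_dom der z that])
  have "coefficient_solution u \<gamma> (restrict v {0..T})"
    unfolding coefficient_solution_def
  proof (intro conjI ballI)
    show "restrict v {0..T} \<in> AC T domain" by (rule AC)
    show "restrict v {0..T} 0 = g \<gamma>" using v0 T by simp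
    fix t assume t: "t \<in> {0<..T}"
    then have t': "t \<in> {0..T}" by auto
    show "\<exists>v'. (restrict v {0..T} has_vector_derivative v') (at t within {0..T}) \<and>
        in_generator (restrict v {0..T} t) (v' + B 0 (restrict v {0..T} t) - source u \<gamma> t)"
      using AC_der[OF t'] gen[OF t'] t' by (intro exI[of _ "z t"]) simp
  qed
  then show ?thesis by blast
qed

lemma wick_solution_exists: "\<exists>u. wick_solution u"
  unfolding wick_solution_def
proof (rule dependent_wf_choice[of "Wellfounded.measure mi_abs"])
  show "coefficient_solution u \<gamma> v = coefficient_solution u' \<gamma> v"
    if "\<And>\<beta>. (\<beta>, \<gamma>) \<in> Wellfounded.measure mi_abs \<Longrightarrow> u \<beta> = u' \<beta>" for u u' \<gamma> v
    unfolding coefficient_solution_def using source_cong[of \<gamma> u u'] that by simp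
  show "\<exists>v. coefficient_solution u \<gamma> v"
    if "\<And>\<beta>. (\<beta>, \<gamma>) \<in> Wellfounded.measure mi_abs \<Longrightarrow> coefficient_solution u \<beta> (u \<beta>)" for u \<gamma>
    using that by (intro coefficient_solution_exists) (simp add: coefficient_solution_def)
qed simp

lemma coefficient_solution_interior:
  assumes v: "coefficient_solution u \<gamma> v"
  obtains v' where "\<And>s. s \<in> {0<..<T} \<Longrightarrow> (v has_vector_derivative v' s) (at s)"
    "\<And>s. s \<in> {0<..<T} \<Longrightarrow> in_generator (v s) (v' s - (source u \<gamma> s - B 0 (v s)))"
proof -
  have "\<forall>s\<in>{0<..<T}. \<exists>v'. (v has_vector_derivative v') (at s) \<and> in_generator (v s) (v' - (source u \<gamma> s - B 0 (v s)))"
  proof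
    fix s assume s: "s \<in> {0<..<T}"
    then obtain v' where v': "(v has_vector_derivative v') (at s within {0..T})"
      "in_generator (v s) (v' + B 0 (v s) - source u \<gamma> s)"
      using v unfolding coefficient_solution_def by force
    have "at s within {0..T} = at s" using s by (intro at_within_Icc_at) auto
    then show "\<exists>v'. (v has_vector_derivative v') (at s) \<and> in_generator (v s) (v' - (source u \<gamma> s - B 0 (v s)))"
      using v' by (intro exI[of _ v']) (simp add: algebra_simps)
  qed
  then obtain v' where "\<forall>s\<in>{0<..<T}. (v has_vector_derivative v' s) (at s) \<and> in_generator (v s) (v' s - (source u \<gamma> s - B 0 (v s)))"
    by metis
  then show thesis by (intro that) auto
qed

lemma coefficient_solution_continuous: "coefficient_solution u \<gamma> v \<Longrightarrow> continuous_on {0..T} v"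
  unfolding coefficient_solution_def using AC_continuous by blast

lemma coefficient_solution_bound:
  assumes v: "coefficient_solution u \<gamma> v" and t: "t \<in> {0..T}"
    and h: "\<And>s. s \<in> {0..t} \<Longrightarrow> norm (source u \<gamma> s) \<le> h s"
    and \<beta>: "\<And>s. s \<in> {0..t} \<Longrightarrow> M * h s \<le> \<beta> * exp (rate * s)"
  shows "norm (v t) \<le> exp (rate * t) * (M * norm (g \<gamma>) + t * \<beta>)"
proof -
  obtain v' where der: "\<And>s. s \<in> {0<..<T} \<Longrightarrow> (v has_vector_derivative v' s) (at s)"
    and gen: "\<And>s. s \<in> {0<..<T} \<Longrightarrow> in_generator (v s) (v' s - (source u \<gamma> s - B 0 (v s)))"
    using coefficient_solution_interior[OF v] by blast
  have "norm (v t) \<le> exp (rate * t) * (M * norm (v 0) + t * \<beta>)"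
  proof (rule classical_solution_bound[where T = t and u' = v' and \<psi> = "\<lambda>s. source u \<gamma> s - B 0 (v s)" and h = h])
    show "continuous_on {0..t} v"
      by (rule continuous_on_subset[OF coefficient_solution_continuous[OF v]]) (use t in auto)
    fix s assume "s \<in> {0..t}"
    then show "norm (source u \<gamma> s - B 0 (v s)) \<le> \<nu> 0 * norm (v s) + h s"
      using h[of s] norm_B[of 0 "v s"] norm_triangle_ineq4[of "source u \<gamma> s" "B 0 (v s)"] by linarith
  qed (use t der gen \<nu>_nonneg \<beta> in auto)
  then show ?thesis using v by (simp add: coefficient_solution_def)
qed

text \<open>The difference of two solutions has initial value \<open>0\<close> and no source,
  so the a priori bound for it is \<open>0\<close>.\<close>

lemma coefficient_solution_unique:
  assumes v: "coefficient_solution u \<gamma> v" and r: "coefficient_solution u \<gamma> r"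
  shows "v = r"
proof -
  obtain v' where v': "\<And>s. s \<in> {0<..<T} \<Longrightarrow> (v has_vector_derivative v' s) (at s)"
    "\<And>s. s \<in> {0<..<T} \<Longrightarrow> in_generator (v s) (v' s - (source u \<gamma> s - B 0 (v s)))"
    using coefficient_solution_interior[OF v] by blast
  obtain r' where r': "\<And>s. s \<in> {0<..<T} \<Longrightarrow> (r has_vector_derivative r' s) (at s)"
    "\<And>s. s \<in> {0<..<T} \<Longrightarrow> in_generator (r s) (r' s - (source u \<gamma> s - B 0 (r s)))"
    using coefficient_solution_interior[OF r] by blast
  have eq: "v t = r t" if t: "t \<in> {0..T}" for t
  proof -
    let ?d = "\<lambda>s. v s - r s"
    have "norm (?d t) \<le> exp (rate * t) * (M * norm (?d 0) + t * 0)"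
    proof (rule classical_solution_bound[where T = T and u' = "\<lambda>s. v' s - r' s" and \<psi> = "\<lambda>s. - B 0 (?d s)" and h = "\<lambda>s. 0"])
      show "continuous_on {0..T} ?d"
        by (intro continuous_intros coefficient_solution_continuous[OF v] coefficient_solution_continuous[OF r])
      fix s assume s: "s \<in> {0<..<T}"
      show "(?d has_vector_derivative v' s - r' s) (at s)"
        by (intro has_vector_derivative_diff v' r' s)
      have "B 0 (?d s) = B 0 (v s) - B 0 (r s)"
        using bounded_linear_B by (simp add: bounded_linear.linear linear_diff)
      then have "v' s - r' s - - B 0 (?d s)
          = (v' s - (source u \<gamma> s - B 0 (v s))) - (r' s - (source u \<gamma> s - B 0 (r s)))"
        by (simp only:) (simp add: algebra_simps)
      then show "in_generator (?d s) (v' s - r' s - - B 0 (?d s))"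
        using in_generator_diff[OF v'(2)[OF s] r'(2)[OF s]] by (simp only:)
    qed (use t norm_B \<nu>_nonneg in auto)
    moreover have "?d 0 = 0" using v r by (simp add: coefficient_solution_def)
    ultimately show ?thesis by simp
  qed
  have ext: "v \<in> {0..T} \<rightarrow>\<^sub>E domain" "r \<in> {0..T} \<rightarrow>\<^sub>E domain"
    using v r unfolding coefficient_solution_def AC_def by auto
  show ?thesis
    by (rule PiE_ext[OF ext eq])
qed

lemma wick_solution_unique:
  assumes u: "wick_solution u" and v: "wick_solution v"
  shows "u = v"
proof
  fix \<gamma>
  show "u \<gamma> = v \<gamma>"
  proof (induction \<gamma> rule: measure_induct_rule[of mi_abs])
    case (less \<gamma>)
    then have "source u \<gamma> = source v \<gamma>" by (rule source_cong)
    then have "coefficient_solution u \<gamma> (v \<gamma>)"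
      using v by (simp add: wick_solution_def coefficient_solution_def)
    then show ?case
      using u coefficient_solution_unique unfolding wick_solution_def by blast
  qed
qed

lemma norm_source_le:
  assumes "t \<in> {0..T}"
    and "\<And>\<alpha> \<beta>. (\<alpha>, \<beta>) \<in> proper_splits \<gamma> \<Longrightarrow> norm (u \<beta> t) \<le> c \<beta>"
  shows "norm (source u \<gamma> t) \<le> sup_norm T (f \<gamma>) + (\<Sum>(\<alpha>, \<beta>)\<in>proper_splits \<gamma>. \<nu> \<alpha> * c \<beta>)"
proof -
  have "norm (source u \<gamma> t) \<le> norm (f \<gamma> t) + norm (\<Sum>(\<alpha>, \<beta>)\<in>proper_splits \<gamma>. B \<alpha> (u \<beta> t))"
    unfolding source_def by (rule norm_triangle_ineq4)
  also have "\<dots> \<le> sup_norm T (f \<gamma>) + (\<Sum>(\<alpha>, \<beta>)\<in>proper_splits \<gamma>. \<nu> \<alpha> * c \<beta>)"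
  proof (rule add_mono)
    show "norm (f \<gamma> t) \<le> sup_norm T (f \<gamma>)"
      by (rule norm_le_sup_norm[OF AC_continuous[OF f_AC] assms(1)])
    show "norm (\<Sum>(\<alpha>, \<beta>)\<in>proper_splits \<gamma>. B \<alpha> (u \<beta> t)) \<le> (\<Sum>(\<alpha>, \<beta>)\<in>proper_splits \<gamma>. \<nu> \<alpha> * c \<beta>)"
    proof (rule sum_norm_le, clarify)
      fix \<alpha> \<beta> assume "(\<alpha>, \<beta>) \<in> proper_splits \<gamma>"
      then have "\<nu> \<alpha> * norm (u \<beta> t) \<le> \<nu> \<alpha> * c \<beta>"
        using assms(2) \<nu>_nonneg by (intro mult_left_mono) auto
      then show "norm (B \<alpha> (u \<beta> t)) \<le> \<nu> \<alpha> * c \<beta>"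
        using norm_B[of \<alpha> "u \<beta> t"] by linarith
    qed
  qed
  finally show ?thesis .
qed

lemma sup_norm_f_nonneg: "0 \<le> sup_norm T (f \<gamma>)"
  using T_pos by (intro sup_norm_nonneg AC_continuous[OF f_AC]) simp

text \<open>On \<open>[0, T]\<close> all exponential factors are between \<open>1 / E\<close> and \<open>E\<close>. With
  them replaced by constants, the a priori bound becomes a convolution inequality for the sup
  norms, in which only \<open>\<nu> 0\<close> is left of the norms of the operators.\<close>

lemma wick_solution_kondratiev:
  assumes u: "wick_solution u"
    and f: "kondratiev_finite (sup_norm T) f pf" and g: "kondratiev_finite norm g pg"
  shows "u \<in> kondratiev (AC T domain) (sup_norm T)"
proof -
  have T: "0 \<le> T" using T_pos by simp
  define U where "U \<gamma> = sup_norm T (u \<gamma>)" for \<gamma>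
  define E where "E = exp (\<bar>rate\<bar> * T)"
  define b where "b \<gamma> = E * M * norm (g \<gamma>) + E * (T * (M * E)) * sup_norm T (f \<gamma>)" for \<gamma>
  define c where "c = E * (T * (M * E)) * \<nu> 0"
  have sol: "coefficient_solution u \<gamma> (u \<gamma>)" for \<gamma> using u by (simp add: wick_solution_def)
  have U0: "0 \<le> U \<gamma>" for \<gamma>
    unfolding U_def by (intro sup_norm_nonneg T coefficient_solution_continuous[OF sol])
  have E0: "0 \<le> E" by (simp add: E_def)
  have coeff0: "0 \<le> E * (T * (M * E))" "0 \<le> E * M" using T M_pos E0 by auto
  have rate_le: "rate * s \<le> \<bar>rate\<bar> * T" "- (rate * s) \<le> \<bar>rate\<bar> * T" if "s \<in> {0..T}" for s
  proof -
    have *: "\<bar>rate * s\<bar> \<le> \<bar>rate\<bar> * T"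
      unfolding abs_mult using that by (intro mult_mono) auto
    show "rate * s \<le> \<bar>rate\<bar> * T" "- (rate * s) \<le> \<bar>rate\<bar> * T"
      by (rule abs_le_D1[OF *], rule abs_le_D2[OF *])
  qed
  have le: "U \<gamma> \<le> b \<gamma> + c * (\<Sum>(\<alpha>, \<beta>)\<in>proper_splits \<gamma>. U \<beta>)" for \<gamma>
    unfolding U_def[of \<gamma>]
  proof (rule sup_norm_le[OF T])
    fix t assume t: "t \<in> {0..T}"
    define H where "H = sup_norm T (f \<gamma>) + (\<Sum>(\<alpha>, \<beta>)\<in>proper_splits \<gamma>. \<nu> 0 * U \<beta>)"
    have H0: "0 \<le> H"
      unfolding H_def using sup_norm_f_nonneg \<nu>_nonneg U0
      by (intro add_nonneg_nonneg sum_nonneg) (auto intro!: mult_nonneg_nonneg)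
    have "norm (u \<gamma> t) \<le> exp (rate * t) * (M * norm (g \<gamma>) + t * (M * H * E))"
    proof (rule coefficient_solution_bound[OF sol t, where h = "\<lambda>s. H"])
      fix s assume s: "s \<in> {0..t}"
      then have s': "s \<in> {0..T}" using t by auto
      have "norm (source u \<gamma> s) \<le> sup_norm T (f \<gamma>) + (\<Sum>(\<alpha>, \<beta>)\<in>proper_splits \<gamma>. \<nu> \<alpha> * U \<beta>)"
        unfolding U_def by (intro norm_source_le s' norm_le_sup_norm coefficient_solution_continuous[OF sol])
      also have "\<dots> \<le> H"
        unfolding H_def using \<nu>_le U0
        by (intro add_left_mono sum_mono) (auto intro!: mult_right_mono)
      finally show "norm (source u \<gamma> s) \<le> H" .
      \<comment> \<open>The constant source H is at most H * E * exp (rate * s) on the interval, also for a negative rate.\<close>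
      have "1 \<le> exp (\<bar>rate\<bar> * T + rate * s)"
        using rate_le(2)[OF s'] by simp
      then have "M * H * 1 \<le> M * H * (E * exp (rate * s))"
        unfolding E_def exp_add[symmetric] using M_pos H0 by (intro mult_left_mono) auto
      then show "M * H \<le> M * H * E * exp (rate * s)" by (simp add: mult.assoc)
    qed
    also have "\<dots> \<le> E * (M * norm (g \<gamma>) + T * (M * H * E))"
      using rate_le(1)[OF t] t M_pos H0 E0
      by (intro mult_mono add_left_mono mult_right_mono add_nonneg_nonneg mult_nonneg_nonneg) (auto simp: E_def)
    also have "\<dots> = b \<gamma> + c * (\<Sum>(\<alpha>, \<beta>)\<in>proper_splits \<gamma>. U \<beta>)"
    proof -
      have "(\<Sum>(\<alpha>, \<beta>)\<in>proper_splits \<gamma>. \<nu> 0 * U \<beta>) = \<nu> 0 * (\<Sum>(\<alpha>, \<beta>)\<in>proper_splits \<gamma>. U \<beta>)"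
        by (simp add: sum_distrib_left case_prod_beta)
      then show ?thesis by (simp add: H_def b_def c_def algebra_simps)
    qed
    finally show "norm (u \<gamma> t) \<le> b \<gamma> + c * (\<Sum>(\<alpha>, \<beta>)\<in>proper_splits \<gamma>. U \<beta>)" .
  qed
  define r where "r = max (pf / 2 + 1) (pg / 2 + 1)"
  have "(\<lambda>\<gamma>. \<bar>norm (g \<gamma>)\<bar> * mi_weight (- r) \<gamma>) summable_on UNIV"
  proof (rule summable_on_comparison_test[OF kondratiev_finite_imp_summable[OF g]])
    show "\<bar>norm (g \<gamma>)\<bar> * mi_weight (- r) \<gamma> \<le> \<bar>norm (g \<gamma>)\<bar> * mi_weight (- (pg / 2 + 1)) \<gamma>" for \<gamma>
      by (intro mult_left_mono mi_weight_antimono) (simp_all add: r_def)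
  qed simp
  moreover have "(\<lambda>\<gamma>. \<bar>sup_norm T (f \<gamma>)\<bar> * mi_weight (- r) \<gamma>) summable_on UNIV"
  proof (rule summable_on_comparison_test[OF kondratiev_finite_imp_summable[OF f]])
    show "\<bar>sup_norm T (f \<gamma>)\<bar> * mi_weight (- r) \<gamma> \<le> \<bar>sup_norm T (f \<gamma>)\<bar> * mi_weight (- (pf / 2 + 1)) \<gamma>" for \<gamma>
      by (intro mult_left_mono mi_weight_antimono) (simp_all add: r_def)
  qed simp
  ultimately have "(\<lambda>\<gamma>. E * M * (\<bar>norm (g \<gamma>)\<bar> * mi_weight (- r) \<gamma>)
      + E * (T * (M * E)) * (\<bar>sup_norm T (f \<gamma>)\<bar> * mi_weight (- r) \<gamma>)) summable_on UNIV"
    by (intro summable_on_add summable_on_cmult_right)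
  also have "(\<lambda>\<gamma>. E * M * (\<bar>norm (g \<gamma>)\<bar> * mi_weight (- r) \<gamma>)
      + E * (T * (M * E)) * (\<bar>sup_norm T (f \<gamma>)\<bar> * mi_weight (- r) \<gamma>)) = (\<lambda>\<gamma>. b \<gamma> * mi_weight (- r) \<gamma>)"
    using sup_norm_f_nonneg by (auto simp: b_def algebra_simps)
  finally have b_sum: "(\<lambda>\<gamma>. b \<gamma> * mi_weight (- r) \<gamma>) summable_on UNIV" .
  have b0: "0 \<le> b \<gamma>" for \<gamma>
    unfolding b_def by (intro add_nonneg_nonneg mult_nonneg_nonneg[OF coeff0(2)] mult_nonneg_nonneg[OF coeff0(1)] sup_norm_f_nonneg) auto
  have c0: "0 \<le> c" unfolding c_def by (intro mult_nonneg_nonneg[OF coeff0(1)] \<nu>_nonneg)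
  obtain s where s: "0 \<le> s" "(\<lambda>\<gamma>. U \<gamma> * mi_weight (- s) \<gamma>) summable_on UNIV"
    by (rule convolution_bound_summable[OF U0 b0 c0 le b_sum]) blast
  have "kondratiev_finite (sup_norm T) u (2 * s)"
    by (rule summable_imp_kondratiev_finite) (use U0 s(2) in \<open>auto simp: U_def\<close>)
  moreover have "u \<gamma> \<in> AC T domain" for \<gamma> using sol by (simp add: coefficient_solution_def)
  ultimately show ?thesis
    using s(1) unfolding kondratiev_def kondratiev_space_def
    by (intro UN_I[of "2 * s"]) auto
qed

text \<open>By induction, the coefficients \<open>\<beta>\<close> of smaller order satisfy the bound at
  all times \<open>s \<le> t\<close>, and there \<open>Mt s\<close> times the bracket at time \<open>t\<close> is an upper bound. So the source
  is at most \<open>F + M * exp (rate * s) * Q\<close>. If the rate is not negative, both parts, and not only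
  the second, are below a multiple of \<open>exp (rate * s)\<close>, which is the form of source that
  Gronwall's inequality was stated for; the same sign gives \<open>M * t \<le> Mtilde t\<close>. The resulting bound
  is the right-hand side of the recursion for \<open>chaos_bound\<close>.\<close>

lemma wick_solution_estimate:
  assumes u: "wick_solution u" and rate: "0 \<le> rate" and t: "t \<in> {0..T}"
    and Mt: "\<And>t. Mt t = M * exp (rate * t)" and Mtilde: "\<And>t. Mtilde t = integral {0..t} Mt"
    and a: "\<And>\<gamma> t. a \<gamma> t = norm (g \<gamma>) + t * sup_norm T (f \<gamma>)"
  shows "norm (u \<gamma> t) \<le> Mt t * chaos_bound (Mtilde t) \<nu> (\<lambda>\<beta>. a \<beta> t) \<gamma>"
  using t
proof (induction \<gamma> arbitrary: t rule: measure_induct_rule[of mi_abs])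
  case (less \<gamma> t)
  note t = \<open>t \<in> {0..T}\<close>
  have sol: "coefficient_solution u \<gamma> (u \<gamma>)" using u by (simp add: wick_solution_def)
  let ?E = "\<lambda>s \<beta>. chaos_bound (Mtilde s) \<nu> (\<lambda>\<beta>. a \<beta> s) \<beta>"
  have Mt_fun: "Mt = (\<lambda>t. M * exp (rate * t))" using Mt by blast
  have Mt_int: "Mt integrable_on {0..s}" for s
    unfolding Mt_fun by (intro integrable_continuous_real continuous_intros)
  have Mt_ge: "M \<le> Mt s" if "0 \<le> s" for s
    using that rate M_pos by (simp add: Mt)
  have Mtilde_ge: "M * s \<le> Mtilde s" if "0 \<le> s" for s
  proof -
    have "integral {0..s} (\<lambda>s. M) \<le> integral {0..s} Mt"
      by (intro integral_le Mt_int) (auto intro: Mt_ge)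
    then show ?thesis using that by (simp add: Mtilde mult.commute)
  qed
  have Mtilde_nonneg: "0 \<le> Mtilde s" if "0 \<le> s" for s
    using Mtilde_ge[OF that] that M_pos by (meson mult_nonneg_nonneg less_imp_le order_trans)
  have Mtilde_mono: "Mtilde s \<le> Mtilde s'" if "0 \<le> s" "s \<le> s'" for s s'
    unfolding Mtilde using that M_pos
    by (intro integral_subset_le Mt_int) (auto simp: Mt)
  have a_nonneg: "0 \<le> a \<beta> s" if "0 \<le> s" for \<beta> s
    using that sup_norm_f_nonneg by (simp add: a)
  have a_mono: "a \<beta> s \<le> a \<beta> s'" if "s \<le> s'" for \<beta> s s'
    using that sup_norm_f_nonneg by (simp add: a mult_right_mono)
  have E_mono: "?E s \<beta> \<le> ?E s' \<beta>" if "0 \<le> s" "s \<le> s'" for s s' \<beta>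
    using that by (intro chaos_bound_mono Mtilde_nonneg Mtilde_mono \<nu>_nonneg a_nonneg a_mono) auto
  define F where "F = sup_norm T (f \<gamma>)"
  define Q where "Q = (\<Sum>(\<alpha>, \<beta>)\<in>proper_splits \<gamma>. \<nu> \<alpha> * ?E t \<beta>)"
  have F0: "0 \<le> F" unfolding F_def by (rule sup_norm_f_nonneg)
  have E0: "0 \<le> ?E t \<beta>" for \<beta>
    unfolding chaos_bound_def using t
    by (intro add_nonneg_nonneg sum_nonneg mult_nonneg_nonneg zero_le_power Mtilde_nonneg
        a_nonneg decomposition_sum_nonneg \<nu>_nonneg) auto
  have Q0: "0 \<le> Q"
    unfolding Q_def using E0 \<nu>_nonneg by (intro sum_nonneg) auto
  have "norm (u \<gamma> t) \<le> exp (rate * t) * (M * norm (g \<gamma>) + t * (M * (F + M * Q)))"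
  proof (rule coefficient_solution_bound[OF sol t, where h = "\<lambda>s. F + Mt s * Q"])
    fix s assume s: "s \<in> {0..t}"
    then have s': "s \<in> {0..T}" using t by auto
    have "norm (source u \<gamma> s) \<le> F + (\<Sum>(\<alpha>, \<beta>)\<in>proper_splits \<gamma>. \<nu> \<alpha> * (Mt s * ?E t \<beta>))"
      unfolding F_def
    proof (rule norm_source_le[OF s'])
      fix \<alpha> \<beta> assume "(\<alpha>, \<beta>) \<in> proper_splits \<gamma>"
      then have "norm (u \<beta> s) \<le> Mt s * ?E s \<beta>"
        using less.IH s' proper_splits_mi_abs_less by blast
      also have "\<dots> \<le> Mt s * ?E t \<beta>"
        using s M_pos by (intro mult_left_mono E_mono) (auto simp: Mt)
      finally show "norm (u \<beta> s) \<le> Mt s * ?E t \<beta>" .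
    qed
    also have "(\<Sum>(\<alpha>, \<beta>)\<in>proper_splits \<gamma>. \<nu> \<alpha> * (Mt s * ?E t \<beta>)) = Mt s * Q"
      unfolding Q_def by (simp add: sum_distrib_left case_prod_beta ac_simps)
    finally show "norm (source u \<gamma> s) \<le> F + Mt s * Q" .
    \<comment> \<open>Here the sign of the rate enters.\<close>
    have "M * F * 1 \<le> M * F * exp (rate * s)"
      using s rate M_pos F0 by (intro mult_left_mono) auto
    then show "M * (F + Mt s * Q) \<le> M * (F + M * Q) * exp (rate * s)"
      by (simp add: Mt algebra_simps)
  qed
  also have "\<dots> = Mt t * (a \<gamma> t + M * t * Q)"
    by (simp add: Mt a F_def algebra_simps)
  also have "\<dots> \<le> Mt t * (a \<gamma> t + Mtilde t * Q)"
    using t Mtilde_ge[of t] Q0 M_pos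
    by (intro mult_left_mono add_left_mono mult_right_mono) (auto simp: Mt)
  also have "a \<gamma> t + Mtilde t * Q = ?E t \<gamma>"
    unfolding Q_def by (rule chaos_bound_recursion[symmetric])
  finally show ?case .
qed

end

section \<open>The equation with a stochastic potential\<close>

lemma norm_Linf_mult_le: "norm (Linf_mult q f) \<le> norm q * norm f"
proof transfer
  fix q f :: "'a \<Rightarrow> 'b"
  assume "Linf_rel q q" "L2_rel f f"
  then have q: "ess_bounded q" and f: "sq_integrable f" by (auto simp: Linf_rel_def L2_rel_def)
  have "(\<integral>x. (norm (q x * f x))\<^sup>2 \<partial>lborel) \<le> (\<integral>x. (ess_norm q)\<^sup>2 * (norm (f x))\<^sup>2 \<partial>lborel)"
  proof (rule integral_mono_AE)
    show "integrable lborel (\<lambda>x. (norm (q x * f x))\<^sup>2)"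
      using sq_integrable_mult[OF q f] by (simp add: sq_integrable_def)
    show "integrable lborel (\<lambda>x. (ess_norm q)\<^sup>2 * (norm (f x))\<^sup>2)"
      using f by (auto simp: sq_integrable_def)
    show "AE x in lborel. (norm (q x * f x))\<^sup>2 \<le> (ess_norm q)\<^sup>2 * (norm (f x))\<^sup>2"
      using ess_norm_AE[OF q]
      by eventually_elim (auto simp: norm_mult power_mult_distrib intro!: mult_right_mono power_mono)
  qed
  also have "\<dots> = (ess_norm q)\<^sup>2 * (\<integral>x. (norm (f x))\<^sup>2 \<partial>lborel)"
    by simp
  finally have "sqrt (\<integral>x. (norm (q x * f x))\<^sup>2 \<partial>lborel) \<le> sqrt ((ess_norm q)\<^sup>2 * (\<integral>x. (norm (f x))\<^sup>2 \<partial>lborel))"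
    by (rule real_sqrt_le_mono)
  then show "sqrt (\<integral>x. (norm (q x * f x))\<^sup>2 \<partial>lborel) \<le> ess_norm q * sqrt (\<integral>x. (norm (f x))\<^sup>2 \<partial>lborel)"
    using ess_norm_nonneg[OF q] by (simp add: real_sqrt_mult)
qed

lemma bounded_linear_Linf_mult: "bounded_linear (Linf_mult q)"
proof (rule bounded_linear_intro)
  show "Linf_mult q (f + h) = Linf_mult q f + Linf_mult q h" for f h
    by transfer (auto simp: L2_rel_def Linf_rel_def distrib_left intro!: sq_integrable_mult sq_integrable_add)
  show "Linf_mult q (r *\<^sub>R f) = r *\<^sub>R Linf_mult q f" for r f
    by transfer (auto simp: L2_rel_def Linf_rel_def intro!: sq_integrable_mult sq_integrable_scaleR)
  show "norm (Linf_mult q f) \<le> norm f * norm q" for f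
    using norm_Linf_mult_le[of q f] by (simp add: mult.commute)
qed

lemma C0_semigroup_growthI:
  assumes S: "C0_semigroup S" and M: "0 < M" and bound: "\<forall>t\<ge>0. onorm (S t) \<le> M * exp (w * t)"
  shows "C0_semigroup_growth S M w"
proof (rule C0_semigroup_growth.intro)
  show lin: "bounded_linear (S t)" if "0 \<le> t" for t
    using S that unfolding C0_semigroup_def bounded_op_def by blast
  show "S 0 x = x" for x using S unfolding C0_semigroup_def by blast
  show "S (s + t) x = S s (S t x)" if "0 \<le> s" "0 \<le> t" for s t x
    using S that unfolding C0_semigroup_def by blast
  show "((\<lambda>t. S t x) \<longlongrightarrow> x) (at_right 0)" for x
    using S unfolding C0_semigroup_def by blast
  show "norm (S t x) \<le> M * exp (w * t) * norm x" if t: "0 \<le> t" for t x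
    using onorm[OF lin[OF t], of x] mult_right_mono[of "onorm (S t)" "M * exp (w * t)" "norm x"] bound t
    by (auto intro: order_trans)
qed (fact M)

lemma generates_iff_in_generator:
  assumes gen: "generates D L S" and S: "C0_semigroup_growth S M w"
  shows "C0_semigroup_growth.in_generator S x y \<longleftrightarrow> x \<in> D \<and> L x = y"
proof -
  have D: "x \<in> D \<longleftrightarrow> (\<exists>g. ((\<lambda>h. (S h x - x) /\<^sub>R h) \<longlongrightarrow> g) (at_right 0))" for x
    using gen unfolding generates_def by blast
  have L: "((\<lambda>h. (S h x - x) /\<^sub>R h) \<longlongrightarrow> L x) (at_right 0)" if "x \<in> D" for x
    using gen that unfolding generates_def by blast
  show ?thesis
    unfolding C0_semigroup_growth.in_generator_def[OF S]
    using D[of x] L[of x] tendsto_unique[OF trivial_limit_at_right_real] by blast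
qed

theorem theorem4:
  fixes T M w p1 p2 p3 :: real
    and D :: "(real ^ 'n, 'k::{real_normed_field,banach,second_countable_topology}) L2 set"
    and L :: "(real ^ 'n, 'k) L2 \<Rightarrow> (real ^ 'n, 'k) L2"
    and S :: "real \<Rightarrow> (real ^ 'n, 'k) L2 \<Rightarrow> (real ^ 'n, 'k) L2"
    and q :: "multi_index \<Rightarrow> (real ^ 'n, 'k) Linf"
    and f :: "multi_index \<Rightarrow> real \<Rightarrow> (real ^ 'n, 'k) L2"
    and g :: "multi_index \<Rightarrow> (real ^ 'n, 'k) L2"
    and Mt Mtilde :: "real \<Rightarrow> real"
    and a :: "multi_index \<Rightarrow> real \<Rightarrow> real"
  assumes "0 < T"
    and "closed_densely_defined D L"
    and "C0_semigroup S"
    and "generates D L S"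
    and "0 < M"
    and "\<forall>t\<ge>0. onorm (S t) \<le> M * exp (w * t)"
    and "q \<in> kondratiev UNIV norm"
    and "critical_exponent norm q = p1"
    and "\<forall>\<gamma>. norm (q \<gamma>) \<le> norm (q 0)"
    and "\<forall>t. Mt t = M * exp ((w + M * norm (q 0)) * t)"
    and "\<forall>t. Mtilde t = integral {0..t} Mt"
    and "Mtilde T * norm (q 0) \<noteq> 1"
    and "f \<in> kondratiev (AC T UNIV) (sup_norm T)"
    and "critical_exponent (sup_norm T) f = p2"
    and "g \<in> kondratiev D norm"
    and "critical_exponent norm g = p3"
    and "\<forall>\<gamma> t. a \<gamma> t = norm (g \<gamma>) + t * sup_norm T (f \<gamma>)"
  shows "(\<exists>!u. u \<in> kondratiev (AC T D) (sup_norm T) \<and> solves_wick_ivp L T q f g u) \<and>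
    (0 \<le> w + M * norm (q 0) \<longrightarrow>
      (\<forall>u. u \<in> kondratiev (AC T D) (sup_norm T) \<and> solves_wick_ivp L T q f g u \<longrightarrow>
        (\<forall>t\<in>{0..T}. \<forall>\<gamma>.
          norm (u \<gamma> t) \<le> Mt t * (a \<gamma> t +
            (\<Sum>k=1..mi_abs \<gamma>. Mtilde t ^ k *
              (\<Sum>\<beta>\<in>{\<beta>. mi_less \<beta> \<gamma> \<and> mi_abs \<beta> \<le> mi_abs \<gamma> - k}.
                a \<beta> t * (\<Sum>\<theta>\<in>decompositions k (\<gamma> - \<beta>). \<Prod>\<eta>\<leftarrow>\<theta>. norm (q \<eta>))))))))"
proof -
  have S: "C0_semigroup_growth S M w"
    using assms(3,5,6) by (rule C0_semigroup_growthI)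
  interpret C0_semigroup_growth S M w by (rule S)
  have gen: "in_generator x y \<longleftrightarrow> x \<in> D \<and> L x = y" for x y
    by (rule generates_iff_in_generator[OF assms(4) S])
  obtain pf where pf: "kondratiev_finite (sup_norm T) f pf" and f: "\<And>\<gamma>. f \<gamma> \<in> AC T UNIV"
    using assms(13) unfolding kondratiev_def kondratiev_space_def by blast
  obtain pg where pg: "kondratiev_finite norm g pg" and g: "\<And>\<gamma>. g \<gamma> \<in> D"
    using assms(15) unfolding kondratiev_def kondratiev_space_def by blast
  interpret wick_problem S M w T "\<lambda>\<gamma>. Linf_mult (q \<gamma>)" "\<lambda>\<gamma>. norm (q \<gamma>)" f g
  proof (intro wick_problem.intro wick_problem_axioms.intro S)
    show "0 < T" by (fact assms(1))
    show "bounded_linear (Linf_mult (q \<alpha>))" for \<alpha> by (rule bounded_linear_Linf_mult)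
    show "norm (Linf_mult (q \<alpha>) x) \<le> norm (q \<alpha>) * norm x" for \<alpha> x by (rule norm_Linf_mult_le)
    show "0 \<le> norm (q \<alpha>)" for \<alpha> by simp
    show "norm (q \<alpha>) \<le> norm (q 0)" for \<alpha> using assms(9) by blast
    show "f \<gamma> \<in> AC T UNIV" for \<gamma> by (rule f)
    show "\<exists>y. in_generator (g \<gamma>) y" for \<gamma> using g[of \<gamma>] by (auto simp: gen)
  qed
  have domain: "domain = D" by (auto simp: gen)
  have solution_iff: "u \<in> kondratiev (AC T D) (sup_norm T) \<and> solves_wick_ivp L T q f g u \<longleftrightarrow> wick_solution u" for u
  proof
    assume u: "u \<in> kondratiev (AC T D) (sup_norm T) \<and> solves_wick_ivp L T q f g u"
    then have AC: "u \<gamma> \<in> AC T D" for \<gamma>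
      unfolding kondratiev_def kondratiev_space_def by blast
    show "wick_solution u"
      unfolding wick_solution_def coefficient_solution_def domain
    proof (intro allI conjI ballI AC)
      fix \<gamma>
      show "u \<gamma> 0 = g \<gamma>" using u unfolding solves_wick_ivp_def by blast
      fix t assume t: "t \<in> {0<..T}"
      then obtain u' where u': "(u \<gamma> has_vector_derivative u') (at t within {0..T})"
        "(u' - L (u \<gamma> t)) + wick_product Linf_mult q (\<lambda>\<beta>. u \<beta> t) \<gamma> = f \<gamma> t"
        using u unfolding solves_wick_ivp_def by blast
      have "u \<gamma> \<in> {0..T} \<rightarrow>\<^sub>E D" using AC[of \<gamma>] unfolding AC_def by blast
      then have "u \<gamma> t \<in> D" using t by (intro PiE_mem[of "u \<gamma>" "{0..T}"]) auto
      moreover have "L (u \<gamma> t) = u' + Linf_mult (q 0) (u \<gamma> t) - source u \<gamma> t"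
        using u'(2) by (simp add: wick_product_def sum_splits source_def algebra_simps)
      ultimately show "\<exists>v'. (u \<gamma> has_vector_derivative v') (at t within {0..T}) \<and>
          in_generator (u \<gamma> t) (v' + Linf_mult (q 0) (u \<gamma> t) - source u \<gamma> t)"
        using u'(1) gen by blast
    qed
  next
    assume u: "wick_solution u"
    have "solves_wick_ivp L T q f g u"
      unfolding solves_wick_ivp_def
    proof (intro allI conjI ballI)
      fix \<gamma>
      have sol: "coefficient_solution u \<gamma> (u \<gamma>)" using u by (simp add: wick_solution_def)
      show "u \<gamma> 0 = g \<gamma>" using sol by (simp add: coefficient_solution_def)
      fix t assume "t \<in> {0<..T}"
      then obtain u' where u': "(u \<gamma> has_vector_derivative u') (at t within {0..T})"
        "L (u \<gamma> t) = u' + Linf_mult (q 0) (u \<gamma> t) - source u \<gamma> t"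
        using sol gen unfolding coefficient_solution_def by blast
      have "(u' - L (u \<gamma> t)) + wick_product Linf_mult q (\<lambda>\<beta>. u \<beta> t) \<gamma> = f \<gamma> t"
        using u'(2) by (simp add: wick_product_def sum_splits source_def algebra_simps)
      with u'(1) show "\<exists>u'. (u \<gamma> has_vector_derivative u') (at t within {0..T}) \<and>
          (u' - L (u \<gamma> t)) + wick_product Linf_mult q (\<lambda>\<beta>. u \<beta> t) \<gamma> = f \<gamma> t"
        by blast
    qed
    then show "u \<in> kondratiev (AC T D) (sup_norm T) \<and> solves_wick_ivp L T q f g u"
      using wick_solution_kondratiev[OF u pf pg] unfolding domain by blast
  qed
  have ex1: "\<exists>!u. wick_solution u"
    using wick_solution_exists wick_solution_unique by blast
  have estimate: "norm (u \<gamma> t) \<le> Mt t * (a \<gamma> t +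
            (\<Sum>k=1..mi_abs \<gamma>. Mtilde t ^ k *
              (\<Sum>\<beta>\<in>{\<beta>. mi_less \<beta> \<gamma> \<and> mi_abs \<beta> \<le> mi_abs \<gamma> - k}.
                a \<beta> t * (\<Sum>\<theta>\<in>decompositions k (\<gamma> - \<beta>). \<Prod>\<eta>\<leftarrow>\<theta>. norm (q \<eta>)))))"
    if "0 \<le> w + M * norm (q 0)" "wick_solution u" "t \<in> {0..T}" for u t \<gamma>
    using wick_solution_estimate[OF that(2,1,3), of Mt Mtilde a \<gamma>] assms(10,11,17)
    unfolding chaos_bound_def decomposition_sum_def by blast
  show ?thesis
    unfolding solution_iff using ex1 estimate by blast
qed

end
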